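(* Let $D$ be a planar diagram of a finite, slim, semimodular lattice, let $Q$ be a finite quasiplanar diagram with $|Q|\ge 2$, and let $p\in\{1,2\}$. Then the following hold. (i) The diagram $\alpha(D)$ exists and it is a finite quasiplanar diagram. (ii) The diagram $\beta_p(Q)$ exists and it is a planar diagram of a finite, slim, semimodular lattice. (iii) Up to similarity, $\beta_p(\alpha(D))$ equals $D$. (iv) Up to similarity, $\alpha(\beta_p(Q))$ equals $Q$.
   Context: All posets and lattices are finite. A (Hasse) diagram of a poset $P$ consists of distinct points of the plane representing the elements of $P$ and, for each covering pair $a\prec b$ in $P$, a non-horizontal straight line segment (edge) joining the point of $a$ to the point of $b$, with $b$ higher than $a$ (as usual, an edge contains no point of the diagram other than its endpoints). A diagram is identified with its set of elements, and poset/lattice terminology is applied to diagrams. A diagram is planar if its edges do not intersect except possibly at their endpoints; it is bounded if the poset has a least element $0$ and a greatest element $1$. In a bounded diagram a maximal chain $C$ forms, with its edges, a polygonal path from $0$ to $1$ of strictly increasing height; an element $x$ is on the left (right) of $C$ if $x\in C$ or $x$ lies horizontally to the left (right) of the point of that path having the same height as $x$. A diagram is quasiplanar if it is bounded and, for any two incomparable elements $x,y$, whenever $x$ is on the left of some maximal chain through $y$, then $x$ is on the left of every maximal chain through $y$. In a quasiplanar diagram, $x\mathrel{\lambda}y$ ("$x$ is on the left of $y$") means that $x\parallel y$ (incomparable) and $x$ is on the left of some (equivalently, every) maximal chain through $y$; "on the right of" is defined analogously. Planar lattice diagrams are quasiplanar. The leftmost (rightmost) element of an antichain is its element that is on the left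 (right) of all its other elements. Two quasiplanar diagrams $D_1,D_2$ are similar if there is an order isomorphism $\psi\colon D_1\to D_2$ such that $x\mathrel{\lambda}y$ in $D_1$ iff $\psi(x)\mathrel{\lambda}\psi(y)$ in $D_2$; diagrams are considered up to similarity. The left (right) boundary chain of a planar lattice diagram is its leftmost (rightmost) maximal chain. A finite lattice $L$ is slim if the set of its nonzero join-irreducible elements is included in the union of two chains of $L$. $\mathrm{Mi}\,L$ denotes the set of meet-irreducible elements of $L$ (elements with exactly one upper cover; so $1\notin\mathrm{Mi}\,L$). Definition of $\alpha(D)$, for a planar lattice diagram $D$: it is the quasiplanar diagram $Q$ (unique up to similarity if it exists) such that $Q=\{1,\tilde 0\}\cup\mathrm{Mi}\,D$ where $1\in D$ is the top of $D$ and $\tilde 0\notin D$; for $x,y\in Q$, $x\le y$ in $Q$ iff $x\le y$ in $D$ or $x=\tilde 0$; and for incomparable $x,y\in Q$, $x\mathrel{\lambda}y$ in $Q$ iff $x\mathrel{\lambda}y$ in $D$. Definition of $\beta_1(Q)$, for a quasiplanar diagram $Q$: let $Q^+=Q\setminus\{0\}$ and $E(Q)=\{\langle x,y\rangle\in Q^+\times Q^+ : x=y\text{ or }x\mathrel{\lambda}y\}$. Order $E(Q)$ by: $\langle x_1,y_1\rangle\le\langle x_2,y_2\rangle$ iff ($x_1\le x_2$ or $x_1\mathrel{\lambda}x_2$) and ($y_2\ge y_1$ or $y_2\mathrel{\lambda}y_1$). Then $\beta_1(Q)$ is the planar diagram (unique up to similarity if it exists) of the poset $\langle E(Q);\le\rangle$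 whose "on the left" relation is: $\langle x_1,y_1\rangle\mathrel{\lambda}\langle x_2,y_2\rangle$ iff ($x_1<x_2$ or $x_1\mathrel{\lambda}x_2$) and ($y_1>y_2$ or $y_1\mathrel{\lambda}y_2$). Definition of $\beta_2(Q)$: an hco-filter of $Q$ is a nonempty subset $X\subseteq Q^+$ that is an up-set of $Q$ and is horizontally convex, i.e. $x\mathrel{\lambda}y$, $y\mathrel{\lambda}z$ and $x,z\in X$ imply $y\in X$. Let $F_{\mathrm{hco}}(Q)$ be the set of hco-filters, ordered by $X\le^d Y$ iff $X\supseteq Y$. Define $\vec F=(F_0,\dots,F_{|Q|-2})$ by $F_0=\{1\}$ and, while $Q^+\setminus F_n\ne\varnothing$, $F_{n+1}=F_n\cup\{f_n\}$, where $f_n$ is the leftmost element of the set of maximal elements of $Q\setminus F_n$. Define $\vec G=(G_0,\dots,G_{|Q|-2})$ by $G_0=\{1\}$ and, while $Q^+\setminus G_n\neq\varnothing$, $G_{n+1}=G_n\cup\{g_n\}$, where $g_n$ is the rightmost element of the set of maximal elements of $Q\setminus G_n$. Then $\beta_2(Q)$ is the planar lattice diagram of $\langle F_{\mathrm{hco}}(Q);\le^d\rangle$ whose left boundary chain is $\vec F$ and whose right boundary chain is $\vec G$ (unique up to similarity if it exists).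
   Formalization: The definition of quasiplanar is strengthened by requiring that x is on the left of y if and only if y is on the right of x; without this, a pentagon drawn with crossing edges is quasiplanar but has no β₁(Q), and the requirement holds in all planar lattice diagrams. *)

theory Defs
  imports "HOL-Analysis.Analysis" "HOL-Algebra.Lattice"
begin

section \<open>Diagrams\<close>

text \<open>
  A diagram is a poset, in the sense of HOL-Algebra, together with the points of the plane that
  represent its elements: \<open>fst (pos D x)\<close> is the horizontal coordinate of \<open>x\<close> and
  \<open>snd (pos D x)\<close> is its height.
\<close>

record 'a diagram = "'a gorder" +
  pos :: "'a \<Rightarrow> real \<times> real"

definition covers :: "('a, 'b) gorder_scheme \<Rightarrow> 'a \<Rightarrow> 'a \<Rightarrow> bool" where
  "covers D a b \<longleftrightarrow> a \<in> carrier D \<and> b \<in> carrier D \<and> a \<sqsubset>\<^bsub>D\<^esub> b \<and>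
     \<not> (\<exists>c \<in> carrier D. a \<sqsubset>\<^bsub>D\<^esub> c \<and> c \<sqsubset>\<^bsub>D\<^esub> b)"

definition incomparable :: "('a, 'b) gorder_scheme \<Rightarrow> 'a \<Rightarrow> 'a \<Rightarrow> bool" where
  "incomparable D x y \<longleftrightarrow> x \<in> carrier D \<and> y \<in> carrier D \<and> \<not> x \<sqsubseteq>\<^bsub>D\<^esub> y \<and> \<not> y \<sqsubseteq>\<^bsub>D\<^esub> x"

definition edge :: "'a diagram \<Rightarrow> 'a \<Rightarrow> 'a \<Rightarrow> (real \<times> real) set" where
  "edge D a b = closed_segment (pos D a) (pos D b)"

definition hasse_diagram :: "'a diagram \<Rightarrow> bool" where
  "hasse_diagram D \<longleftrightarrow>
     partial_order D \<and> finite (carrier D) \<and> inj_on (pos D) (carrier D) \<and>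
     (\<forall>a b. covers D a b \<longrightarrow> snd (pos D a) < snd (pos D b)) \<and>
     (\<forall>a b. covers D a b \<longrightarrow> (\<forall>c \<in> carrier D. pos D c \<in> edge D a b \<longrightarrow> c = a \<or> c = b))"

definition bounded_diagram :: "'a diagram \<Rightarrow> bool" where
  "bounded_diagram D \<longleftrightarrow>
     hasse_diagram D \<and> weak_partial_order_bottom D \<and> weak_partial_order_top D"

definition planar_diagram :: "'a diagram \<Rightarrow> bool" where
  "planar_diagram D \<longleftrightarrow> hasse_diagram D \<and>
     (\<forall>a b c d. covers D a b \<and> covers D c d \<and> (a, b) \<noteq> (c, d) \<longrightarrow>
        edge D a b \<inter> edge D c d \<subseteq> {pos D a, pos D b} \<inter> {pos D c, pos D d})"

section \<open>Left and right\<close>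

definition chain_in :: "('a, 'b) gorder_scheme \<Rightarrow> 'a set \<Rightarrow> bool" where
  "chain_in D C \<longleftrightarrow> C \<subseteq> carrier D \<and> (\<forall>x \<in> C. \<forall>y \<in> C. x \<sqsubseteq>\<^bsub>D\<^esub> y \<or> y \<sqsubseteq>\<^bsub>D\<^esub> x)"

definition maximal_chain :: "('a, 'b) gorder_scheme \<Rightarrow> 'a set \<Rightarrow> bool" where
  "maximal_chain D C \<longleftrightarrow> chain_in D C \<and> (\<forall>C'. chain_in D C' \<and> C \<subseteq> C' \<longrightarrow> C' = C)"

definition chain_path :: "'a diagram \<Rightarrow> 'a set \<Rightarrow> (real \<times> real) set" where
  "chain_path D C = pos D ` C \<union> \<Union> {edge D a b | a b. a \<in> C \<and> b \<in> C \<and> covers D a b}"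

definition left_of_chain :: "'a diagram \<Rightarrow> 'a \<Rightarrow> 'a set \<Rightarrow> bool" where
  "left_of_chain D x C \<longleftrightarrow> x \<in> C \<or>
     (\<exists>q \<in> chain_path D C. snd q = snd (pos D x) \<and> fst (pos D x) < fst q)"

definition right_of_chain :: "'a diagram \<Rightarrow> 'a \<Rightarrow> 'a set \<Rightarrow> bool" where
  "right_of_chain D x C \<longleftrightarrow> x \<in> C \<or>
     (\<exists>q \<in> chain_path D C. snd q = snd (pos D x) \<and> fst q < fst (pos D x))"

text \<open>\<open>left_of D x y\<close> is the relation \<open>x \<lambda> y\<close>.\<close>

definition left_of :: "'a diagram \<Rightarrow> 'a \<Rightarrow> 'a \<Rightarrow> bool" where
  "left_of D x y \<longleftrightarrow> incomparable D x y \<and>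
     (\<exists>C. maximal_chain D C \<and> y \<in> C \<and> left_of_chain D x C)"

definition right_of :: "'a diagram \<Rightarrow> 'a \<Rightarrow> 'a \<Rightarrow> bool" where
  "right_of D x y \<longleftrightarrow> incomparable D x y \<and>
     (\<exists>C. maximal_chain D C \<and> y \<in> C \<and> right_of_chain D x C)"

text \<open>
  The last clause of \<open>quasiplanar\<close> makes explicit that ``on the left of'' and ``on the right of''
  are converse relations. It does not follow from the clause before it: draw the pentagon
  \<open>0 \<prec> u \<prec> 1\<close>, \<open>0 \<prec> a \<prec> b \<prec> 1\<close> with \<open>0 = (0,0)\<close>, \<open>u = (-1,1)\<close>, \<open>a = (1,2)\<close>, \<open>b = (-2,5)\<close>,
  \<open>1 = (0,10)\<close>. Every inner element lies on a single maximal chain, so the middle clause holds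
  trivially; but \<open>u\<close> is on the left of the chain through \<open>b\<close> and \<open>b\<close> is on the left of the chain
  through \<open>u\<close>, because the edges \<open>u \<prec> 1\<close> and \<open>a \<prec> b\<close> cross. For this drawing the relation
  ordering \<open>E(Q)\<close> is not antisymmetric and \<open>u\<close>, \<open>b\<close> have no unique leftmost element.
\<close>

definition quasiplanar :: "'a diagram \<Rightarrow> bool" where
  "quasiplanar D \<longleftrightarrow> bounded_diagram D \<and>
     (\<forall>x y. incomparable D x y \<longrightarrow>
        (\<exists>C. maximal_chain D C \<and> y \<in> C \<and> left_of_chain D x C) \<longrightarrow>
        (\<forall>C. maximal_chain D C \<and> y \<in> C \<longrightarrow> left_of_chain D x C)) \<and>
     (\<forall>x y. left_of D x y \<longleftrightarrow> right_of D y x)"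

definition leftmost :: "'a diagram \<Rightarrow> 'a set \<Rightarrow> 'a" where
  "leftmost D A = (THE x. x \<in> A \<and> (\<forall>y \<in> A. y \<noteq> x \<longrightarrow> left_of D x y))"

definition rightmost :: "'a diagram \<Rightarrow> 'a set \<Rightarrow> 'a" where
  "rightmost D A = (THE x. x \<in> A \<and> (\<forall>y \<in> A. y \<noteq> x \<longrightarrow> right_of D x y))"

text \<open>The leftmost maximal chain is the one that is on the left of all maximal chains.\<close>

definition left_boundary_chain :: "'a diagram \<Rightarrow> 'a set \<Rightarrow> bool" where
  "left_boundary_chain D C \<longleftrightarrow> maximal_chain D C \<and>
     (\<forall>C'. maximal_chain D C' \<longrightarrow> (\<forall>x \<in> C. left_of_chain D x C'))"

definition right_boundary_chain :: "'a diagram \<Rightarrow> 'a set \<Rightarrow> bool" where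
  "right_boundary_chain D C \<longleftrightarrow> maximal_chain D C \<and>
     (\<forall>C'. maximal_chain D C' \<longrightarrow> (\<forall>x \<in> C. right_of_chain D x C'))"

definition similar :: "'a diagram \<Rightarrow> 'b diagram \<Rightarrow> bool" where
  "similar D\<^sub>1 D\<^sub>2 \<longleftrightarrow> (\<exists>\<psi>. bij_betw \<psi> (carrier D\<^sub>1) (carrier D\<^sub>2) \<and> order_emb D\<^sub>1 D\<^sub>2 \<psi> \<and>
     (\<forall>x \<in> carrier D\<^sub>1. \<forall>y \<in> carrier D\<^sub>1. left_of D\<^sub>1 x y \<longleftrightarrow> left_of D\<^sub>2 (\<psi> x) (\<psi> y)))"

section \<open>Slim semimodular lattices\<close>

definition join_irreducibles :: "('a, 'b) gorder_scheme \<Rightarrow> 'a set" where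
  "join_irreducibles L = {x \<in> carrier L. \<exists>!y. covers L y x}"

definition meet_irreducibles :: "('a, 'b) gorder_scheme \<Rightarrow> 'a set" where
  "meet_irreducibles L = {x \<in> carrier L. \<exists>!y. covers L x y}"

definition slim :: "('a, 'b) gorder_scheme \<Rightarrow> bool" where
  "slim L \<longleftrightarrow> (\<exists>C\<^sub>1 C\<^sub>2. chain_in L C\<^sub>1 \<and> chain_in L C\<^sub>2 \<and>
     join_irreducibles L - {\<bottom>\<^bsub>L\<^esub>} \<subseteq> C\<^sub>1 \<union> C\<^sub>2)"

definition semimodular :: "('a, 'b) gorder_scheme \<Rightarrow> bool" where
  "semimodular L \<longleftrightarrow> (\<forall>a b. \<forall>c \<in> carrier L. covers L a b \<longrightarrow>
     a \<squnion>\<^bsub>L\<^esub> c = b \<squnion>\<^bsub>L\<^esub> c \<or> covers L (a \<squnion>\<^bsub>L\<^esub> c) (b \<squnion>\<^bsub>L\<^esub> c))"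

text \<open>The locale \<open>lattice\<close> admits an empty carrier, hence the nonemptiness.\<close>

definition planar_lattice_diagram :: "'a diagram \<Rightarrow> bool" where
  "planar_lattice_diagram D \<longleftrightarrow> planar_diagram D \<and> lattice D \<and> carrier D \<noteq> {}"

definition slim_semimodular_diagram :: "'a diagram \<Rightarrow> bool" where
  "slim_semimodular_diagram D \<longleftrightarrow> planar_lattice_diagram D \<and> slim D \<and> semimodular D"

section \<open>The constructions\<close>

text \<open>
  A diagram is determined only up to similarity, so each construction is the relation
  ``\<open>A\<close> is a representative of \<open>\<alpha>(D)\<close>'', etc.; existence is then a matter of proof.
\<close>

text \<open>The new least element of \<open>\<alpha>(D)\<close> is \<open>None\<close>; an element \<open>x\<close> of \<open>D\<close> appears as \<open>Some x\<close>.\<close>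

definition is_alpha :: "'a diagram \<Rightarrow> 'a option diagram \<Rightarrow> bool" where
  "is_alpha D Q \<longleftrightarrow> quasiplanar Q \<and>
     carrier Q = insert None (Some ` insert \<top>\<^bsub>D\<^esub> (meet_irreducibles D)) \<and>
     (\<forall>x \<in> carrier Q. \<forall>y \<in> carrier Q.
        x \<sqsubseteq>\<^bsub>Q\<^esub> y \<longleftrightarrow> x = None \<or> (\<exists>a b. x = Some a \<and> y = Some b \<and> a \<sqsubseteq>\<^bsub>D\<^esub> b)) \<and>
     (\<forall>a b. incomparable Q (Some a) (Some b) \<longrightarrow>
        (left_of Q (Some a) (Some b) \<longleftrightarrow> left_of D a b))"

definition nonzero :: "('a, 'b) gorder_scheme \<Rightarrow> 'a set" where
  "nonzero Q = carrier Q - {\<bottom>\<^bsub>Q\<^esub>}"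

definition E_set :: "'a diagram \<Rightarrow> ('a \<times> 'a) set" where
  "E_set Q = {(x, y). x \<in> nonzero Q \<and> y \<in> nonzero Q \<and> (x = y \<or> left_of Q x y)}"

definition is_beta1 :: "'a diagram \<Rightarrow> ('a \<times> 'a) diagram \<Rightarrow> bool" where
  "is_beta1 Q D \<longleftrightarrow> planar_diagram D \<and> carrier D = E_set Q \<and>
     (\<forall>(x\<^sub>1, y\<^sub>1) \<in> E_set Q. \<forall>(x\<^sub>2, y\<^sub>2) \<in> E_set Q.
        (x\<^sub>1, y\<^sub>1) \<sqsubseteq>\<^bsub>D\<^esub> (x\<^sub>2, y\<^sub>2) \<longleftrightarrow>
          (x\<^sub>1 \<sqsubseteq>\<^bsub>Q\<^esub> x\<^sub>2 \<or> left_of Q x\<^sub>1 x\<^sub>2) \<and> (y\<^sub>1 \<sqsubseteq>\<^bsub>Q\<^esub> y\<^sub>2 \<or> left_of Q y\<^sub>2 y\<^sub>1)) \<and>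
     (\<forall>(x\<^sub>1, y\<^sub>1) \<in> E_set Q. \<forall>(x\<^sub>2, y\<^sub>2) \<in> E_set Q.
        left_of D (x\<^sub>1, y\<^sub>1) (x\<^sub>2, y\<^sub>2) \<longleftrightarrow>
          (x\<^sub>1 \<sqsubset>\<^bsub>Q\<^esub> x\<^sub>2 \<or> left_of Q x\<^sub>1 x\<^sub>2) \<and> (y\<^sub>2 \<sqsubset>\<^bsub>Q\<^esub> y\<^sub>1 \<or> left_of Q y\<^sub>1 y\<^sub>2))"

definition hco_filter :: "'a diagram \<Rightarrow> 'a set \<Rightarrow> bool" where
  "hco_filter Q X \<longleftrightarrow> X \<noteq> {} \<and> X \<subseteq> nonzero Q \<and>
     (\<forall>x \<in> X. \<forall>y \<in> carrier Q. x \<sqsubseteq>\<^bsub>Q\<^esub> y \<longrightarrow> y \<in> X) \<and>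
     (\<forall>x y z. left_of Q x y \<and> left_of Q y z \<and> x \<in> X \<and> z \<in> X \<longrightarrow> y \<in> X)"

definition maximal_elements :: "('a, 'b) gorder_scheme \<Rightarrow> 'a set \<Rightarrow> 'a set" where
  "maximal_elements Q A = {x \<in> A. \<forall>y \<in> A. x \<sqsubseteq>\<^bsub>Q\<^esub> y \<longrightarrow> y = x}"

primrec F_seq :: "'a diagram \<Rightarrow> nat \<Rightarrow> 'a set" where
  "F_seq Q 0 = {\<top>\<^bsub>Q\<^esub>}"
| "F_seq Q (Suc n) =
     (if nonzero Q - F_seq Q n = {} then F_seq Q n
      else insert (leftmost Q (maximal_elements Q (carrier Q - F_seq Q n))) (F_seq Q n))"

primrec G_seq :: "'a diagram \<Rightarrow> nat \<Rightarrow> 'a set" where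
  "G_seq Q 0 = {\<top>\<^bsub>Q\<^esub>}"
| "G_seq Q (Suc n) =
     (if nonzero Q - G_seq Q n = {} then G_seq Q n
      else insert (rightmost Q (maximal_elements Q (carrier Q - G_seq Q n))) (G_seq Q n))"

definition is_beta2 :: "'a diagram \<Rightarrow> 'a set diagram \<Rightarrow> bool" where
  "is_beta2 Q D \<longleftrightarrow> planar_lattice_diagram D \<and> carrier D = {X. hco_filter Q X} \<and>
     (\<forall>X \<in> carrier D. \<forall>Y \<in> carrier D. X \<sqsubseteq>\<^bsub>D\<^esub> Y \<longleftrightarrow> X \<supseteq> Y) \<and>
     left_boundary_chain D (F_seq Q ` {..card (carrier Q) - 2}) \<and>
     right_boundary_chain D (G_seq Q ` {..card (carrier Q) - 2})"

end

theory Submission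
  imports Defs
begin

text \<open>
  The idea is that a quasiplanar diagram is, up to similarity, nothing but a finite set with two
  linear orders that have a common least and a common greatest element, that is, a permutation.
  Read the diagram upwards, and from left to right among incomparable elements: this gives
  \<open>le1\<close> (\<open>x \<le> y\<close> or \<open>x \<lambda> y\<close>). Reading from right to left gives \<open>le2\<close> (\<open>x \<le> y\<close> or \<open>y \<lambda> x\<close>). Then
  \<open>x \<le> y\<close> holds iff \<open>x\<close> precedes \<open>y\<close> in both orders, and \<open>x \<lambda> y\<close> iff \<open>x\<close> precedes \<open>y\<close> in the
  first and follows it in the second. That both relations are linear orders is where the geometry
  of maximal chains is used. The crucial point is that \<open>\<lambda>\<close> has no cycles of length three
  (\<open>no_left_cycle_middle\<close>), which is seen at the height of the middle one of the three elements.
  Planar bounded diagrams are quasiplanar (\<open>planar_quasiplanar\<close>), because the paths of two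
  maximal chains can change sides only at a common vertex.

  Conversely, a finite bounded poset that is embedded into the plane with the componentwise order
  is drawn by rotating the plane by 45 degrees. This drawing is always quasiplanar
  (\<open>grid_quasiplanar\<close>), and it is planar if the poset is a lattice (\<open>grid_planar\<close>). All the
  existence claims of the theorem come from these two facts.

  Both constructions \<open>\<beta>\<^sub>1\<close> and \<open>\<beta>\<^sub>2\<close> draw one and the same lattice. The hco-filters of \<open>Q\<close> are the
  sets \<open>{q. le1 Q x q \<and> le2 Q y q}\<close> of nonzero elements, one for each pair \<open>(x, y)\<close> in \<open>E(Q)\<close>
  (\<open>bij_quadrant\<close>). The predicate \<open>filter_diagram Q B g\<close> says that \<open>B\<close> is a diagram of the
  lattice of hco-filters, \<open>g\<close> telling which filter an element of \<open>B\<close> stands for, and any two such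
  diagrams are similar (\<open>filter_diagrams_similar\<close>). For \<open>\<beta>\<^sub>1\<close> the map \<open>g\<close> sends a pair to its
  filter, for \<open>\<beta>\<^sub>2\<close> it is the identity; there the relation \<open>\<lambda>\<close> has to be recovered from the left
  boundary chain (\<open>beta2_filter_diagram\<close>).

  The lattice of hco-filters under reverse inclusion is semimodular because joins are
  intersections and a covering removes a single point, and it is slim because each filter is the
  intersection of a final segment of the first order and one of the second. Its meet-irreducible
  elements are the principal filters other than \<open>{1}\<close>, so that \<open>\<alpha>\<close> leads back to \<open>Q\<close>
  (\<open>alpha_similar\<close>).

  It remains to see that a diagram \<open>D\<close> of a slim semimodular lattice is itself a diagram of the
  hco-filters of \<open>\<alpha>(D)\<close>: an element \<open>d\<close> stands for the set of all meet-irreducible elements above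
  it, together with the top (\<open>up_filter_diagram\<close>). The difficulty is surjectivity. It rests on a
  uniqueness property of meets of meet-irreducible elements (\<open>unique_meet_complement\<close>), and this
  is the only place where slimness and semimodularity of \<open>D\<close> enter.
\<close>

section \<open>Finite posets\<close>

lemma minimal_of_finite:
  assumes "finite S" "S \<noteq> {}"
    and "\<And>x y z. x \<in> S \<Longrightarrow> y \<in> S \<Longrightarrow> z \<in> S \<Longrightarrow> r x y \<Longrightarrow> r y z \<Longrightarrow> r x z"
    and "\<And>x y. x \<in> S \<Longrightarrow> y \<in> S \<Longrightarrow> r x y \<Longrightarrow> r y x \<Longrightarrow> x = y"
  shows "\<exists>m\<in>S. \<forall>c\<in>S. r c m \<longrightarrow> c = m"
  using assms
proof (induction S rule: finite_ne_induct)
  case (singleton x) show ?case by blast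
next
  case (insert x F)
  have "\<exists>m\<in>F. \<forall>c\<in>F. r c m \<longrightarrow> c = m"
    by (rule insert.IH) (use insert.prems in blast)+
  then obtain m where m: "m \<in> F" "\<forall>c\<in>F. r c m \<longrightarrow> c = m" by blast
  show ?case
  proof (cases "r x m")
    case True
    have "c = x" if c: "c \<in> F" "r c x" for c
    proof -
      have "r c m" using insert.prems(1)[of c x m] c True m(1) by blast
      then have "c = m" using m(2) c(1) by blast
      then show ?thesis using insert.prems(2)[of c x] c True by blast
    qed
    then show ?thesis by blast
  next
    case False then show ?thesis using m by blast
  qed
qed


locale hasse =
  fixes D :: "'a diagram" (structure)
  assumes hasse: "hasse_diagram D"
begin

abbreviation h :: "'a \<Rightarrow> real" where "h x \<equiv> snd (pos D x)"
abbreviation hc :: "'a \<Rightarrow> real" where "hc x \<equiv> fst (pos D x)"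
abbreviation eq_or_covers :: "'a \<Rightarrow> 'a \<Rightarrow> bool" where "eq_or_covers a b \<equiv> a = b \<or> covers D a b"

lemma order: "partial_order D" and fin: "finite (carrier D)" and inj_pos: "inj_on (pos D) (carrier D)"
  using hasse by (auto simp: hasse_diagram_def)

lemma weak_order: "weak_partial_order D"
  using order partial_order.axioms(1) by blast

lemma eq_eq: "(.=) = (=)"
  using order by (rule partial_order.eq_is_equal)

lemma refl: "x \<in> carrier D \<Longrightarrow> x \<sqsubseteq> x"
  using weak_partial_order.le_refl[OF weak_order] .

lemma antisym: "x \<sqsubseteq> y \<Longrightarrow> y \<sqsubseteq> x \<Longrightarrow> x \<in> carrier D \<Longrightarrow> y \<in> carrier D \<Longrightarrow> x = y"
  using weak_partial_order.weak_le_antisym[OF weak_order] eq_eq by metis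

lemma trans: "x \<sqsubseteq> y \<Longrightarrow> y \<sqsubseteq> z \<Longrightarrow> x \<in> carrier D \<Longrightarrow> y \<in> carrier D \<Longrightarrow> z \<in> carrier D \<Longrightarrow> x \<sqsubseteq> z"
  using weak_partial_order.le_trans[OF weak_order] .

lemma lless_iff: "x \<sqsubset> y \<longleftrightarrow> x \<sqsubseteq> y \<and> x \<noteq> y"
  by (simp add: lless_def eq_eq)

lemma covers_iff: "covers D a b \<longleftrightarrow> a \<in> carrier D \<and> b \<in> carrier D \<and> a \<sqsubseteq> b \<and> a \<noteq> b \<and>
    (\<forall>c \<in> carrier D. a \<sqsubseteq> c \<and> c \<sqsubseteq> b \<longrightarrow> c = a \<or> c = b)"
  unfolding covers_def lless_iff by auto

lemma minimal_element:
  assumes S: "S \<subseteq> carrier D" "S \<noteq> {}"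
  shows "\<exists>m\<in>S. \<forall>c\<in>S. c \<sqsubseteq> m \<longrightarrow> c = m"
proof (rule minimal_of_finite[OF finite_subset[OF S(1) fin] S(2)])
  show "x \<sqsubseteq> z" if "x \<in> S" "y \<in> S" "z \<in> S" "x \<sqsubseteq> y" "y \<sqsubseteq> z" for x y z
    using trans[OF that(4,5)] that(1-3) S(1) by blast
  show "x = y" if "x \<in> S" "y \<in> S" "x \<sqsubseteq> y" "y \<sqsubseteq> x" for x y
    using antisym[OF that(3,4)] that(1,2) S(1) by blast
qed

lemma maximal_element:
  assumes S: "S \<subseteq> carrier D" "S \<noteq> {}"
  shows "\<exists>m\<in>S. \<forall>c\<in>S. m \<sqsubseteq> c \<longrightarrow> c = m"
proof (rule minimal_of_finite[where r = "\<lambda>x y. y \<sqsubseteq> x", OF finite_subset[OF S(1) fin] S(2)])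
  show "z \<sqsubseteq> x" if "x \<in> S" "y \<in> S" "z \<in> S" "y \<sqsubseteq> x" "z \<sqsubseteq> y" for x y z
    using trans[OF that(5,4)] that(1-3) S(1) by blast
  show "x = y" if "x \<in> S" "y \<in> S" "y \<sqsubseteq> x" "x \<sqsubseteq> y" for x y
    using antisym[OF that(4,3)] that(1,2) S(1) by blast
qed

lemma cover_above:
  assumes "x \<in> carrier D" "y \<in> carrier D" "x \<sqsubseteq> y" "x \<noteq> y"
  obtains c where "covers D x c" "c \<sqsubseteq> y"
proof -
  let ?S = "{c \<in> carrier D. x \<sqsubseteq> c \<and> x \<noteq> c \<and> c \<sqsubseteq> y}"
  have "?S \<noteq> {}" using assms refl by auto
  then obtain m where m: "m \<in> ?S" "\<forall>c\<in>?S. c \<sqsubseteq> m \<longrightarrow> c = m"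
    using minimal_element[of ?S] by auto
  have "covers D x m"
    unfolding covers_iff using m assms trans[of _ m y] by blast
  then show ?thesis using that m by blast
qed

lemma cover_below:
  assumes "x \<in> carrier D" "y \<in> carrier D" "x \<sqsubseteq> y" "x \<noteq> y"
  obtains c where "covers D c y" "x \<sqsubseteq> c"
proof -
  let ?S = "{c \<in> carrier D. x \<sqsubseteq> c \<and> c \<noteq> y \<and> c \<sqsubseteq> y}"
  have "?S \<noteq> {}" using assms refl by auto
  then obtain m where m: "m \<in> ?S" "\<forall>c\<in>?S. m \<sqsubseteq> c \<longrightarrow> c = m"
    using maximal_element[of ?S] by auto
  have "covers D m y"
    unfolding covers_iff using m assms trans[of x m] by blast
  then show ?thesis using that m by blast
qed

lemma covers_h: "covers D a b \<Longrightarrow> h a < h b"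
  using hasse by (auto simp: hasse_diagram_def)

lemma covers_vertex: "covers D a b \<Longrightarrow> c \<in> carrier D \<Longrightarrow> pos D c \<in> edge D a b \<Longrightarrow> c = a \<or> c = b"
  using hasse by (auto simp: hasse_diagram_def)

lemma h_strict: "x \<in> carrier D \<Longrightarrow> y \<in> carrier D \<Longrightarrow> x \<sqsubseteq> y \<Longrightarrow> x \<noteq> y \<Longrightarrow> h x < h y"
proof (induction "card {z \<in> carrier D. x \<sqsubseteq> z}" arbitrary: x rule: less_induct)
  case less
  obtain c where c: "covers D x c" "c \<sqsubseteq> y" using cover_above less.prems by metis
  then have cc: "c \<in> carrier D" "x \<sqsubseteq> c" "x \<noteq> c" by (auto simp: covers_iff)
  show ?case
  proof (cases "c = y")
    case True then show ?thesis using covers_h c by auto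
  next
    case False
    have "{z \<in> carrier D. c \<sqsubseteq> z} \<subset> {z \<in> carrier D. x \<sqsubseteq> z}"
      using cc less.prems(1) trans[of x c] refl[of x] antisym[of x c] by blast
    then have "card {z \<in> carrier D. c \<sqsubseteq> z} < card {z \<in> carrier D. x \<sqsubseteq> z}"
      using fin by (intro psubset_card_mono) auto
    then have "h c < h y" using less.hyps cc less.prems(2) c(2) False by blast
    then show ?thesis using covers_h[OF c(1)] by auto
  qed
qed

lemma h_mono: "x \<in> carrier D \<Longrightarrow> y \<in> carrier D \<Longrightarrow> x \<sqsubseteq> y \<Longrightarrow> h x \<le> h y"
  using h_strict by fastforce

section \<open>Maximal chains\<close>

lemma mc_carrier: "maximal_chain D C \<Longrightarrow> x \<in> C \<Longrightarrow> x \<in> carrier D"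
  by (auto simp: maximal_chain_def chain_in_def)

lemma mc_total: "maximal_chain D C \<Longrightarrow> x \<in> C \<Longrightarrow> y \<in> C \<Longrightarrow> x \<sqsubseteq> y \<or> y \<sqsubseteq> x"
  by (auto simp: maximal_chain_def chain_in_def)

lemma mc_maximal:
  assumes "maximal_chain D C" "x \<in> carrier D" "\<And>y. y \<in> C \<Longrightarrow> x \<sqsubseteq> y \<or> y \<sqsubseteq> x"
  shows "x \<in> C"
proof -
  have "chain_in D (insert x C)"
    using assms refl unfolding maximal_chain_def chain_in_def by auto
  then show ?thesis using assms unfolding maximal_chain_def by blast
qed

lemma mc_extend:
  assumes "chain_in D K"
  obtains C where "maximal_chain D C" "K \<subseteq> C"
proof -
  let ?S = "{C. chain_in D C \<and> K \<subseteq> C}"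
  have "finite ?S" using fin by (rule_tac finite_subset[of _ "Pow (carrier D)"]) (auto simp: chain_in_def)
  moreover have "K \<in> ?S" using assms by auto
  ultimately obtain C where "C \<in> ?S" "\<forall>C'\<in>?S. C \<subseteq> C' \<longrightarrow> C = C'"
    using finite_has_maximal[of ?S] by blast
  then have "maximal_chain D C" "K \<subseteq> C" unfolding maximal_chain_def by auto
  then show ?thesis using that by blast
qed

lemma mc_through2:
  assumes "x \<in> carrier D" "y \<in> carrier D" "x \<sqsubseteq> y"
  obtains C where "maximal_chain D C" "x \<in> C" "y \<in> C"
proof -
  have "chain_in D {x, y}" using assms refl by (auto simp: chain_in_def)
  then show ?thesis using mc_extend that by (metis insert_subset)
qed

lemma mc_through:
  assumes "x \<in> carrier D"
  obtains C where "maximal_chain D C" "x \<in> C"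
  using mc_through2[OF assms assms refl[OF assms]] by metis

lemma mc_h_le: "maximal_chain D C \<Longrightarrow> x \<in> C \<Longrightarrow> y \<in> C \<Longrightarrow> h x \<le> h y \<Longrightarrow> x \<sqsubseteq> y"
  using mc_total mc_carrier h_strict refl by (metis less_le_not_le)

text \<open>
  If \<open>m\<close> is the next element of \<open>C\<close> after \<open>a\<close>, then an element between \<open>a\<close> and \<open>m\<close> is comparable
  to every element of \<open>C\<close>, and hence belongs to \<open>C\<close> by maximality.
\<close>

lemma mc_step:
  assumes C: "maximal_chain D C" "a \<in> C" "b \<in> C" "a \<sqsubseteq> b" "a \<noteq> b"
  obtains c where "c \<in> C" "covers D a c"
proof -
  let ?S = "{c \<in> C. a \<sqsubseteq> c \<and> a \<noteq> c}"
  have S: "?S \<subseteq> carrier D" "?S \<noteq> {}" using assms mc_carrier by auto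
  then obtain m where m: "m \<in> ?S" "\<forall>c\<in>?S. c \<sqsubseteq> m \<longrightarrow> c = m" using minimal_element[of ?S] by blast
  have "covers D a m" unfolding covers_iff
  proof (intro conjI ballI impI)
    fix c assume c: "c \<in> carrier D" "a \<sqsubseteq> c \<and> c \<sqsubseteq> m"
    have "c \<in> C"
    proof (rule mc_maximal[OF C(1) c(1)])
      fix y assume y: "y \<in> C"
      have "y \<sqsubseteq> a \<or> m \<sqsubseteq> y"
      proof (rule ccontr)
        assume n: "\<not> ?thesis"
        then have "a \<sqsubseteq> y" "a \<noteq> y" "y \<sqsubseteq> m"
          using mc_total[OF C(1) y] C(2) m(1) refl[OF mc_carrier[OF C(1,2)]] by auto
        then show False using m y n S(1) refl by blast
      qed
      then show "c \<sqsubseteq> y \<or> y \<sqsubseteq> c"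
        using c trans[of y a c] trans[of c m y] y m(1) C mc_carrier by blast
    qed
    then show "c = a \<or> c = m" using m c by auto
  qed (use m assms mc_carrier in auto)
  then show ?thesis using that m by blast
qed

end

section \<open>The path of a maximal chain as a function of the height\<close>

locale bounded_hasse = hasse +
  assumes bounded: "bounded_diagram D"
begin

lemma bot: "\<bottom> \<in> carrier D" "x \<in> carrier D \<Longrightarrow> \<bottom> \<sqsubseteq> x"
  and top: "\<top> \<in> carrier D" "x \<in> carrier D \<Longrightarrow> x \<sqsubseteq> \<top>"
proof -
  interpret B: weak_partial_order_bottom D using bounded by (simp add: bounded_diagram_def)
  interpret T: weak_partial_order_top D using bounded by (simp add: bounded_diagram_def)
  show "\<bottom> \<in> carrier D" "x \<in> carrier D \<Longrightarrow> \<bottom> \<sqsubseteq> x" using B.bottom_closed B.bottom_lower by auto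
  show "\<top> \<in> carrier D" "x \<in> carrier D \<Longrightarrow> x \<sqsubseteq> \<top>" using T.top_closed T.top_higher by auto
qed

abbreviation heights :: "real set" where "heights \<equiv> {h \<bottom>..h \<top>}"

lemma h_heights: "x \<in> carrier D \<Longrightarrow> h x \<in> heights"
  using h_mono bot top by auto

lemma mc_bot: "maximal_chain D C \<Longrightarrow> \<bottom> \<in> C" and mc_top: "maximal_chain D C \<Longrightarrow> \<top> \<in> C"
  using mc_maximal[of C] mc_carrier bot top by auto

lemma path_iff: "maximal_chain D C \<Longrightarrow>
    q \<in> chain_path D C \<longleftrightarrow> (\<exists>a\<in>C. \<exists>b\<in>C. eq_or_covers a b \<and> q \<in> edge D a b)"
  unfolding chain_path_def by (auto simp: edge_def image_iff)

text \<open>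
  A vertex is treated as a degenerate edge from \<open>a\<close> to \<open>a\<close>, so that the path of a chain is a
  union of edges without exception.
\<close>

lemma edge_affine:
  assumes "eq_or_covers a b"
  obtains m k where "\<forall>s t. (s, t) \<in> edge D a b \<longleftrightarrow> h a \<le> t \<and> t \<le> h b \<and> s = m * t + k"
proof (cases "a = b")
  case True
  have "(s, t) \<in> edge D a b \<longleftrightarrow> h a \<le> t \<and> t \<le> h b \<and> s = 0 * t + hc a" for s t
    using True by (auto simp: edge_def prod_eq_iff)
  then show ?thesis using that[of 0 "hc a"] by blast
next
  case False
  then have ab: "h a < h b" using assms covers_h by auto
  define m where "m = (hc b - hc a) / (h b - h a)"
  have mm: "m * (h b - h a) = hc b - hc a" using ab by (simp add: m_def)
  have "(s, t) \<in> edge D a b \<longleftrightarrow> h a \<le> t \<and> t \<le> h b \<and> s = m * t + (hc a - m * h a)" for s t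
  proof
    assume "(s, t) \<in> edge D a b"
    then obtain u where u: "0 \<le> u" "u \<le> 1" "s = (1 - u) * hc a + u * hc b" "t = (1 - u) * h a + u * h b"
      by (auto simp: edge_def in_segment prod_eq_iff)
    have t: "t = h a + u * (h b - h a)" using u(4) by (simp add: algebra_simps)
    have "u * (h b - h a) \<ge> 0" using u ab by simp
    moreover have "u * (h b - h a) \<le> 1 * (h b - h a)" by (rule mult_right_mono) (use u ab in auto)
    moreover have "m * t + (hc a - m * h a) = hc a + u * (m * (h b - h a))"
      unfolding t by (simp add: algebra_simps)
    moreover have "s = hc a + u * (hc b - hc a)" using u(3) by (simp add: algebra_simps)
    ultimately show "h a \<le> t \<and> t \<le> h b \<and> s = m * t + (hc a - m * h a)"
      unfolding mm using t by auto
  next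
    assume t: "h a \<le> t \<and> t \<le> h b \<and> s = m * t + (hc a - m * h a)"
    define u where "u = (t - h a) / (h b - h a)"
    have u: "u * (h b - h a) = t - h a" "0 \<le> u" "u \<le> 1" using ab t by (auto simp: u_def)
    have "s = hc a + m * (t - h a)" using t by (simp add: algebra_simps)
    also have "t - h a = u * (h b - h a)" using u by simp
    also have "m * (u * (h b - h a)) = u * (hc b - hc a)" using mm by (metis mult.left_commute)
    finally have "s = (1 - u) * hc a + u * hc b" by (simp add: algebra_simps)
    moreover have "t = (1 - u) * h a + u * h b" using u(1) by (simp add: algebra_simps)
    ultimately show "(s, t) \<in> edge D a b"
      using u by (auto simp: edge_def in_segment prod_eq_iff)
  qed
  then show ?thesis using that[of m "hc a - m * h a"] by blast
qed

lemma edge_at: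
  assumes C: "maximal_chain D C" and t: "t \<in> heights"
  obtains a b where "a \<in> C" "b \<in> C" "eq_or_covers a b" "h a \<le> t" "t \<le> h b"
proof -
  let ?S = "{c \<in> C. h c \<le> t}"
  have S: "?S \<subseteq> carrier D" "?S \<noteq> {}" using t mc_carrier[OF C] mc_bot[OF C] by auto
  then obtain a where a: "a \<in> ?S" "\<forall>c\<in>?S. a \<sqsubseteq> c \<longrightarrow> c = a" using maximal_element[of ?S] by blast
  show ?thesis
  proof (cases "a = \<top>")
    case True then show ?thesis using that[of a a] a t by auto
  next
    case False
    then obtain c where c: "c \<in> C" "covers D a c"
      using mc_step[OF C, of a \<top>] a mc_top[OF C] top S(1) by blast
    have "\<not> h c \<le> t" using a c covers_iff by auto
    then show ?thesis using that[of a c] a c by auto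
  qed
qed

text \<open>
  The edges of a maximal chain occupy intervals of heights which meet at most at their ends, and
  there the two edges share a vertex.
\<close>

lemma path_unique:
  assumes C: "maximal_chain D C" and p: "(s, t) \<in> chain_path D C" and q: "(s', t) \<in> chain_path D C"
  shows "s = s'"
proof -
  obtain a b where ab: "a \<in> C" "b \<in> C" "eq_or_covers a b" "(s, t) \<in> edge D a b"
    using p path_iff[OF C] by blast
  obtain c d where cd: "c \<in> C" "d \<in> C" "eq_or_covers c d" "(s', t) \<in> edge D c d"
    using q path_iff[OF C] by blast
  note car = mc_carrier[OF C ab(1)] mc_carrier[OF C ab(2)] mc_carrier[OF C cd(1)] mc_carrier[OF C cd(2)]
  have key: "b = c" if "b \<sqsubseteq> c" "h b \<ge> t" "h c \<le> t" "b \<in> carrier D" "c \<in> carrier D" for b c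
    using h_strict[OF that(4,5,1)] that by fastforce
  have sep: "a = c \<and> b = d \<or> b \<sqsubseteq> c \<or> d \<sqsubseteq> a"
    using ab cd mc_total[OF C ab(1) cd(1)] mc_total[OF C ab(2) cd(2)] mc_total[OF C ab(2) cd(1)]
      mc_total[OF C ab(1) cd(2)] car
    unfolding covers_iff by blast
  obtain m k where mk: "\<forall>s t. (s, t) \<in> edge D a b \<longleftrightarrow> h a \<le> t \<and> t \<le> h b \<and> s = m * t + k"
    by (rule edge_affine[OF ab(3)])
  obtain m' k' where mk': "\<forall>s t. (s, t) \<in> edge D c d \<longleftrightarrow> h c \<le> t \<and> t \<le> h d \<and> s = m' * t + k'"
    by (rule edge_affine[OF cd(3)])
  have ends: "(hc a, h a) \<in> edge D a b" "(hc b, h b) \<in> edge D a b"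
    "(hc c, h c) \<in> edge D c d" "(hc d, h d) \<in> edge D c d" by (auto simp: edge_def)
  have i: "h a \<le> t" "t \<le> h b" "s = m * t + k" "h c \<le> t" "t \<le> h d" "s' = m' * t + k'"
    using ab(4) cd(4) mk mk' by auto
  consider "a = c \<and> b = d" | "b \<sqsubseteq> c" | "d \<sqsubseteq> a" using sep by blast
  then show ?thesis
  proof cases
    case 1 then show ?thesis using ab(4) cd(4) mk by auto
  next
    case 2
    then have bc: "b = c" using key i car by blast
    then have "t = h b" using i by auto
    then show ?thesis using ends(2,3) bc i mk mk' by metis
  next
    case 3
    then have bc: "d = a" using key i car by blast
    then have "t = h d" using i by auto
    then show ?thesis using ends(1,4) bc i mk mk' by metis
  qed
qed

text \<open>
  The path of a maximal chain is the graph of a function of the height, defined between the heights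
  of the least and of the greatest element.
\<close>

definition path_x :: "'a set \<Rightarrow> real \<Rightarrow> real" where
  "path_x C t = (THE s. (s, t) \<in> chain_path D C)"

lemma path_x_iff:
  assumes C: "maximal_chain D C" and t: "t \<in> heights"
  shows "(s, t) \<in> chain_path D C \<longleftrightarrow> s = path_x C t"
proof -
  obtain a b where ab: "a \<in> C" "b \<in> C" "eq_or_covers a b" "h a \<le> t" "t \<le> h b"
    using edge_at[OF C t] by blast
  obtain m k where mk: "\<forall>s t. (s, t) \<in> edge D a b \<longleftrightarrow> h a \<le> t \<and> t \<le> h b \<and> s = m * t + k"
    by (rule edge_affine[OF ab(3)])
  have "(m * t + k, t) \<in> chain_path D C" using path_iff[OF C] ab mk by blast
  then have "\<exists>!s. (s, t) \<in> chain_path D C" using path_unique[OF C] by blast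
  then show ?thesis unfolding path_x_def using the1_equality theI' by (metis (no_types, lifting))
qed

lemma path_x_affine:
  assumes C: "maximal_chain D C" and ab: "a \<in> C" "b \<in> C" "eq_or_covers a b"
  obtains m k where "\<forall>u. h a \<le> u \<and> u \<le> h b \<longrightarrow> path_x C u = m * u + k \<and> (path_x C u, u) \<in> edge D a b"
proof -
  obtain m k where mk: "\<forall>s t. (s, t) \<in> edge D a b \<longleftrightarrow> h a \<le> t \<and> t \<le> h b \<and> s = m * t + k"
    by (rule edge_affine[OF ab(3)])
  have "path_x C u = m * u + k" if "h a \<le> u" "u \<le> h b" for u
  proof -
    have "u \<in> heights" using that h_heights[OF mc_carrier[OF C ab(1)]] h_heights[OF mc_carrier[OF C ab(2)]] by auto
    moreover have "(m * u + k, u) \<in> chain_path D C" using path_iff[OF C] ab mk that by blast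
    ultimately show ?thesis using path_x_iff[OF C] by auto
  qed
  then show ?thesis using that[of m k] mk by auto
qed

lemma path_x_vertex: "maximal_chain D C \<Longrightarrow> x \<in> C \<Longrightarrow> path_x C (h x) = hc x"
  using path_x_iff[of C "h x" "hc x"] h_heights mc_carrier
  by (auto simp: chain_path_def)

text \<open>
  No edge contains an element of the diagram other than its two endpoints.
\<close>

lemma vertex_on_path:
  assumes C: "maximal_chain D C" and x: "x \<in> carrier D" and e: "path_x C (h x) = hc x"
  shows "x \<in> C"
proof -
  have "pos D x \<in> chain_path D C" using path_x_iff[OF C h_heights[OF x], of "hc x"] e by auto
  then obtain a b where "a \<in> C" "b \<in> C" "eq_or_covers a b" "pos D x \<in> edge D a b"
    using path_iff[OF C] by blast
  moreover have "x = a" if "pos D x \<in> edge D a a" "a \<in> C" for a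
    using that inj_pos x mc_carrier[OF C] by (auto simp: edge_def inj_on_def)
  ultimately show ?thesis using covers_vertex x by blast
qed

lemma left_iff: "maximal_chain D C \<Longrightarrow> x \<in> carrier D \<Longrightarrow>
    left_of_chain D x C \<longleftrightarrow> x \<in> C \<or> hc x < path_x C (h x)"
  unfolding left_of_chain_def using path_x_iff[of C "h x"] h_heights[of x]
  by (metis prod.collapse fst_conv snd_conv)

lemma right_iff: "maximal_chain D C \<Longrightarrow> x \<in> carrier D \<Longrightarrow>
    right_of_chain D x C \<longleftrightarrow> x \<in> C \<or> path_x C (h x) < hc x"
  unfolding right_of_chain_def using path_x_iff[of C "h x"] h_heights[of x]
  by (metis prod.collapse fst_conv snd_conv)

lemma left_or_right: "maximal_chain D C \<Longrightarrow> x \<in> carrier D \<Longrightarrow> left_of_chain D x C \<or> right_of_chain D x C"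
  using left_iff right_iff vertex_on_path by force

end

section \<open>Mirror images\<close>

text \<open>
  Reflecting the plane exchanges left with right, hence the first linear order with the second and
  the sequence of the \<open>F\<^sub>n\<close> with that of the \<open>G\<^sub>n\<close>. In this way one half of the symmetric facts
  follows from the other half.
\<close>

definition mirror :: "'a diagram \<Rightarrow> 'a diagram" where
  "mirror D = D\<lparr>pos := \<lambda>x. (- fst (pos D x), snd (pos D x))\<rparr>"

lemma mirror_simps [simp]:
  "carrier (mirror D) = carrier D" "le (mirror D) = le D" "eq (mirror D) = eq D"
  "pos (mirror D) x = (- fst (pos D x), snd (pos D x))"
  by (simp_all add: mirror_def)

lemma mirror_lless [simp]: "x \<sqsubset>\<^bsub>mirror D\<^esub> y \<longleftrightarrow> x \<sqsubset>\<^bsub>D\<^esub> y"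
  by (simp add: lless_def)

lemma mirror_order_notions [simp]:
  "covers (mirror D) = covers D" "incomparable (mirror D) = incomparable D"
  "chain_in (mirror D) = chain_in D" "maximal_chain (mirror D) = maximal_chain D"
  "least (mirror D) = least D" "greatest (mirror D) = greatest D"
  "maximal_elements (mirror D) = maximal_elements D"
  by (auto simp: covers_def incomparable_def chain_in_def maximal_chain_def least_def greatest_def
      maximal_elements_def fun_eq_iff)

lemma mirror_bot_top [simp]: "\<bottom>\<^bsub>mirror D\<^esub> = \<bottom>\<^bsub>D\<^esub>" "\<top>\<^bsub>mirror D\<^esub> = \<top>\<^bsub>D\<^esub>"
  by (simp_all add: bottom_def top_def)

lemma mirror_edge: "edge (mirror D) a b = (\<lambda>p. (- fst p, snd p)) ` edge D a b"
proof -
  have "linear (\<lambda>p :: real \<times> real. (- fst p, snd p))"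
    by (auto intro!: linearI)
  from closed_segment_linear_image[OF this, of "pos D a" "pos D b"] show ?thesis
    by (simp add: edge_def)
qed

lemma mirror_chain_path: "chain_path (mirror D) C = (\<lambda>p. (- fst p, snd p)) ` chain_path D C"
proof -
  have "{edge (mirror D) a b | a b. a \<in> C \<and> b \<in> C \<and> covers D a b} =
      (`) (\<lambda>p. (- fst p, snd p)) ` {edge D a b | a b. a \<in> C \<and> b \<in> C \<and> covers D a b}"
    by (auto simp: mirror_edge)
  then show ?thesis
    by (simp add: chain_path_def image_Un image_Union image_image)
qed

lemma mirror_left_of_chain: "left_of_chain (mirror D) x C \<longleftrightarrow> right_of_chain D x C"
  and mirror_right_of_chain: "right_of_chain (mirror D) x C \<longleftrightarrow> left_of_chain D x C"
  by (auto simp: left_of_chain_def right_of_chain_def mirror_chain_path)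

lemma mirror_left_of: "left_of (mirror D) = right_of D"
  and mirror_right_of: "right_of (mirror D) = left_of D"
  by (auto simp: left_of_def right_of_def mirror_left_of_chain mirror_right_of_chain fun_eq_iff)

lemma mirror_left_boundary_chain: "left_boundary_chain (mirror D) C \<longleftrightarrow> right_boundary_chain D C"
  by (auto simp: left_boundary_chain_def right_boundary_chain_def mirror_left_of_chain)

lemma mirror_F_seq: "F_seq (mirror D) n = G_seq D n"
  by (induction n) (simp_all add: nonzero_def leftmost_def rightmost_def mirror_left_of)

lemma mirror_weak_partial_order: "weak_partial_order D \<Longrightarrow> weak_partial_order (mirror D)"
  unfolding weak_partial_order_def weak_partial_order_axioms_def equivalence_def mirror_simps .

lemma mirror_hasse:
  assumes "hasse_diagram D"
  shows "hasse_diagram (mirror D)"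
proof -
  have "partial_order (mirror D)"
    using assms mirror_weak_partial_order[of D]
    unfolding hasse_diagram_def partial_order_def partial_order_axioms_def mirror_simps by blast
  moreover have "inj_on (pos (mirror D)) (carrier (mirror D))"
    using assms unfolding hasse_diagram_def inj_on_def by (simp add: prod_eq_iff)
  moreover have "pos (mirror D) c \<in> edge (mirror D) a b \<longleftrightarrow> pos D c \<in> edge D a b" for a b c
    by (auto simp: mirror_edge image_iff prod_eq_iff)
  ultimately show ?thesis
    using assms unfolding hasse_diagram_def mirror_order_notions by simp
qed

lemma mirror_bounded: "bounded_diagram D \<Longrightarrow> bounded_diagram (mirror D)"
  unfolding bounded_diagram_def weak_partial_order_bottom_def weak_partial_order_top_def
    weak_partial_order_bottom_axioms_def weak_partial_order_top_axioms_def mirror_order_notions mirror_simps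
  using mirror_weak_partial_order mirror_hasse by blast

section \<open>Quasiplanar diagrams carry two linear orders\<close>

text \<open>
  The relations \<open>le1\<close> and \<open>le2\<close> extend the order by reading incomparable elements from left to
  right and from right to left, respectively. For a quasiplanar diagram they are linear orders,
  and the order of the diagram is their intersection.
\<close>

definition le1 :: "'a diagram \<Rightarrow> 'a \<Rightarrow> 'a \<Rightarrow> bool" where
  "le1 D x y \<longleftrightarrow> x \<sqsubseteq>\<^bsub>D\<^esub> y \<or> left_of D x y"

definition le2 :: "'a diagram \<Rightarrow> 'a \<Rightarrow> 'a \<Rightarrow> bool" where
  "le2 D x y \<longleftrightarrow> x \<sqsubseteq>\<^bsub>D\<^esub> y \<or> left_of D y x"

context bounded_hasse
begin

text \<open>
  Edges of a quasiplanar diagram may cross, so the mutual position of two paths cannot be traced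
  along intersection points. But between two consecutive heights of vertices of the two chains both
  paths are straight; what happens there is therefore decided at the vertices.
\<close>

lemma sides_by_interpolation:
  assumes C: "maximal_chain D C" and E: "maximal_chain D E"
    and t: "t\<^sub>1 \<le> t" "t \<le> t\<^sub>2" "t\<^sub>1 \<in> h ` (C \<union> E)" "t\<^sub>2 \<in> h ` (C \<union> E)"
    and vert: "\<And>u. u \<in> C \<union> E \<Longrightarrow> t\<^sub>1 \<le> h u \<Longrightarrow> h u \<le> t\<^sub>2 \<Longrightarrow> path_x E (h u) < path_x C (h u)"
  shows "path_x E t < path_x C t"
proof -
  have th: "t \<in> heights"
    using t h_heights mc_carrier[OF C] mc_carrier[OF E] by fastforce
  obtain a b where ab: "a \<in> C" "b \<in> C" "eq_or_covers a b" "h a \<le> t" "t \<le> h b"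
    using edge_at[OF C th] by blast
  obtain c d where cd: "c \<in> E" "d \<in> E" "eq_or_covers c d" "h c \<le> t" "t \<le> h d"
    using edge_at[OF E th] by blast
  obtain m k where mk: "\<forall>u. h a \<le> u \<and> u \<le> h b \<longrightarrow> path_x C u = m * u + k \<and> (path_x C u, u) \<in> edge D a b"
    by (rule path_x_affine[OF C ab(1-3)])
  obtain m' k' where mk': "\<forall>u. h c \<le> u \<and> u \<le> h d \<longrightarrow> path_x E u = m' * u + k' \<and> (path_x E u, u) \<in> edge D c d"
    by (rule path_x_affine[OF E cd(1-3)])
  (* both paths are straight between the heights lo and hi, and each of these is the height of a vertex *)
  define lo where "lo = max t\<^sub>1 (max (h a) (h c))"
  define hi where "hi = min t\<^sub>2 (min (h b) (h d))"
  have "lo \<in> h ` (C \<union> E)" "hi \<in> h ` (C \<union> E)"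
    unfolding lo_def hi_def using t ab cd by (auto simp: max_def min_def)
  moreover have lohi: "lo \<le> t" "t \<le> hi" "t\<^sub>1 \<le> lo" "hi \<le> t\<^sub>2" "h a \<le> lo" "h c \<le> lo" "hi \<le> h b" "hi \<le> h d"
    unfolding lo_def hi_def using t ab cd by auto
  moreover have vert': "path_x E u < path_x C u" if "u \<in> h ` (C \<union> E)" "t\<^sub>1 \<le> u" "u \<le> t\<^sub>2" for u
    using that vert by blast
  ultimately have "path_x E lo < path_x C lo" "path_x E hi < path_x C hi"
    using t by (intro vert'; linarith)+
  then have "m' * lo + k' < m * lo + k" "m' * hi + k' < m * hi + k"
    using mk mk' lohi by auto
  then have e: "0 < (m - m') * lo + (k - k')" "0 < (m - m') * hi + (k - k')"
    by (auto simp: algebra_simps)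
  have "0 < (m - m') * t + (k - k')"
  proof (cases "m \<ge> m'")
    case True
    then have "(m - m') * lo \<le> (m - m') * t" using lohi by (intro mult_left_mono) auto
    then show ?thesis using e by auto
  next
    case False
    then have "(m - m') * hi \<le> (m - m') * t" using lohi by (intro mult_left_mono_neg) auto
    then show ?thesis using e by auto
  qed
  then show ?thesis using mk mk' ab cd by (auto simp: algebra_simps)
qed

end

locale quasiplanar_diagram = bounded_hasse +
  assumes quasiplanar: "quasiplanar D"
begin

lemma left_of_carrier: "left_of D x y \<Longrightarrow> x \<in> carrier D" "left_of D x y \<Longrightarrow> y \<in> carrier D"
  and left_of_incomparable: "left_of D x y \<Longrightarrow> \<not> x \<sqsubseteq> y" "left_of D x y \<Longrightarrow> \<not> y \<sqsubseteq> x"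
  by (auto simp: left_of_def incomparable_def)

lemma left_of_irrefl: "\<not> left_of D x x"
  using left_of_carrier left_of_incomparable refl by blast

lemma left_of_right_of: "left_of D x y \<longleftrightarrow> right_of D y x"
  using quasiplanar by (auto simp: quasiplanar_def)

lemma incomparable_not_mem: "incomparable D x y \<Longrightarrow> maximal_chain D C \<Longrightarrow> y \<in> C \<Longrightarrow> x \<notin> C"
  using mc_total by (auto simp: incomparable_def)

lemma left_of_iff_path_x:
  assumes "incomparable D x y" "maximal_chain D C" "y \<in> C"
  shows "left_of D x y \<longleftrightarrow> hc x < path_x C (h x)"
proof -
  have "left_of D x y \<longleftrightarrow> left_of_chain D x C"
    using quasiplanar assms unfolding quasiplanar_def left_of_def by blast
  then show ?thesis
    using left_iff[OF assms(2)] incomparable_not_mem[OF assms] assms(1)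
    by (auto simp: incomparable_def)
qed

lemma incomparable_sym: "incomparable D x y \<Longrightarrow> incomparable D y x"
  by (auto simp: incomparable_def)

text \<open>
  With \<open>x \<lambda> y\<close> and \<open>y \<lambda> x\<close>, the element \<open>x\<close> would lie on the left of every maximal chain through
  \<open>y\<close> and, as the two sides are converse to each other, on the right of one of them.
\<close>

lemma left_of_asym: "left_of D x y \<Longrightarrow> \<not> left_of D y x"
proof
  assume l: "left_of D x y" "left_of D y x"
  then have inc: "incomparable D x y" by (simp add: left_of_def)
  have "right_of D x y" using l left_of_right_of by blast
  then obtain C where C: "maximal_chain D C" "y \<in> C" "right_of_chain D x C"
    unfolding right_of_def by blast
  then show False
    using l(1) left_of_iff_path_x[OF inc C(1,2)] right_iff[OF C(1)] incomparable_not_mem[OF inc C(1,2)] inc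
    by (auto simp: incomparable_def)
qed

lemma left_of_total:
  assumes "incomparable D x y"
  shows "left_of D x y \<or> left_of D y x"
proof -
  obtain C where C: "maximal_chain D C" "y \<in> C" using mc_through assms by (auto simp: incomparable_def)
  have "left_of_chain D x C \<or> right_of_chain D x C"
    using left_or_right[OF C(1)] assms by (auto simp: incomparable_def)
  then show ?thesis
    using C assms left_of_right_of[of y x] unfolding left_of_def right_of_def by blast
qed

lemma right_of_iff_path_x:
  assumes "incomparable D x y" "maximal_chain D C" "x \<in> C"
  shows "left_of D x y \<longleftrightarrow> path_x C (h y) < hc y"
proof -
  have "y \<in> carrier D" "y \<notin> C"
    using incomparable_not_mem[OF incomparable_sym[OF assms(1)] assms(2,3)] assms
    by (auto simp: incomparable_def)
  then have "path_x C (h y) \<noteq> hc y" using vertex_on_path[OF assms(2)] by blast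
  moreover have "left_of D x y \<longleftrightarrow> \<not> left_of D y x"
    using left_of_asym left_of_total[OF assms(1)] by blast
  ultimately show ?thesis
    using left_of_iff_path_x[OF incomparable_sym[OF assms(1)] assms(2,3)] by auto
qed

text \<open>
  Take a maximal chain that contains both \<open>a\<close> and \<open>b\<close>. On which side of it the element \<open>z\<close> lies
  does not depend on whether the chain is regarded as a chain through \<open>a\<close> or through \<open>b\<close>.
\<close>

lemma left_of_comparable:
  assumes "a \<in> carrier D" "b \<in> carrier D" "a \<sqsubseteq> b \<or> b \<sqsubseteq> a" "incomparable D z a"
  shows "left_of D z b \<Longrightarrow> left_of D z a" and "left_of D b z \<Longrightarrow> left_of D a z"
proof -
  obtain C where C: "maximal_chain D C" "a \<in> C" "b \<in> C"
    using assms mc_through2 by metis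
  show "left_of D z b \<Longrightarrow> left_of D z a"
    using left_of_iff_path_x[OF _ C(1,3), of z] left_of_iff_path_x[OF _ C(1,2), of z] assms(4)
    by (auto simp: left_of_def)
  show "left_of D b z \<Longrightarrow> left_of D a z"
    using right_of_iff_path_x[OF _ C(1,3), of z] right_of_iff_path_x[OF _ C(1,2), of z] incomparable_sym[OF assms(4)]
    by (auto simp: left_of_def)
qed

text \<open>
  By \<open>sides_by_interpolation\<close> only the vertices matter. A vertex \<open>u\<close> of the chain through \<open>x\<close> whose
  height lies between those of \<open>x\<close> and \<open>z\<close> is incomparable to \<open>z\<close>: one of the two ways of being
  comparable contradicts the heights, the other one makes \<open>x\<close> and \<open>z\<close> comparable. Hence \<open>z \<lambda> u\<close>
  follows from \<open>z \<lambda> x\<close>. The vertices of the other chain are treated in the same way.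
\<close>

lemma paths_stay_apart:
  assumes l: "left_of D z x" and C: "maximal_chain D C" "x \<in> C" and E: "maximal_chain D E" "z \<in> E"
    and t: "h x \<le> t \<and> t \<le> h z \<or> h z \<le> t \<and> t \<le> h x"
  shows "path_x E t < path_x C t"
proof (rule sides_by_interpolation[OF C(1) E(1), of "min (h x) (h z)" _ "max (h x) (h z)"])
  note car = left_of_carrier[OF l] and inc = left_of_incomparable[OF l]
  fix u assume u: "u \<in> C \<union> E" "min (h x) (h z) \<le> h u" "h u \<le> max (h x) (h z)"
  have between: "h x \<le> h u \<and> h u \<le> h z \<or> h z \<le> h u \<and> h u \<le> h x" using u by (auto simp: min_def max_def split: if_splits)
  show "path_x E (h u) < path_x C (h u)"
  proof (cases "u \<in> C")
    case True
    have uc: "u \<in> carrier D" using True mc_carrier C by auto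
    have "incomparable D z u"
    proof -
      have "x \<sqsubseteq> u \<and> h u \<le> h z \<or> u \<sqsubseteq> x \<and> h z \<le> h u" using between mc_h_le[OF C(1)] C True by blast
      then show ?thesis unfolding incomparable_def using car inc uc h_strict[of z u] h_strict[of u z]
          trans[of x u z] trans[of z u x] by fastforce
    qed
    then have i: "incomparable D z u" .
    then have "left_of D z u"
      using left_of_comparable(1)[OF uc car(2) mc_total[OF C(1) True C(2)] i l] by blast
    then show ?thesis
      using right_of_iff_path_x[OF i E] path_x_vertex[OF C(1) True] by auto
  next
    case False
    then have True: "u \<in> E" using u by auto
    have uc: "u \<in> carrier D" using True mc_carrier E by auto
    have i: "incomparable D x u"
    proof -
      have "z \<sqsubseteq> u \<and> h u \<le> h x \<or> u \<sqsubseteq> z \<and> h x \<le> h u" using between mc_h_le[OF E(1)] E True by blast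
      then show ?thesis unfolding incomparable_def using car inc uc h_strict[of x u] h_strict[of u x]
          trans[of z u x] trans[of x u z] by fastforce
    qed
    then have "left_of D u x"
      using left_of_comparable(2)[OF uc car(1) mc_total[OF E(1) True E(2)] i l] by blast
    then show ?thesis
      using left_of_iff_path_x[OF incomparable_sym[OF i] C] path_x_vertex[OF E(1) True] by auto
  qed
qed (use t C E in \<open>auto simp: min_def max_def\<close>)

text \<open>
  At the height of \<open>y\<close>, a chain through \<open>x\<close> passes on the left of \<open>y\<close> and a chain through \<open>z\<close>
  passes on its right. As \<open>z \<lambda> x\<close>, the two paths are in the opposite position at this height.
\<close>

lemma no_left_cycle_middle:
  assumes "left_of D x y" "left_of D y z" "left_of D z x"
    and "h x \<le> h y \<and> h y \<le> h z \<or> h z \<le> h y \<and> h y \<le> h x"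
  shows False
proof -
  obtain C where C: "maximal_chain D C" "x \<in> C" using mc_through left_of_carrier assms by metis
  obtain E where E: "maximal_chain D E" "z \<in> E" using mc_through left_of_carrier assms by metis
  have "path_x E (h y) < path_x C (h y)" using paths_stay_apart[OF assms(3) C E] assms(4) by blast
  moreover have "path_x C (h y) < hc y" using right_of_iff_path_x[OF _ C, of y] assms(1) by (simp add: left_of_def)
  moreover have "hc y < path_x E (h y)" using left_of_iff_path_x[OF _ E, of y] assms(2) by (simp add: left_of_def)
  ultimately show False by auto
qed

text \<open>
  If \<open>x\<close> and \<open>z\<close> were comparable, then they would lie on the same side of \<open>y\<close>. If \<open>z \<lambda> x\<close>, then the
  three elements form a cycle, and one of them has a height between those of the two others.
\<close>

lemma left_of_trans:
  assumes "left_of D x y" "left_of D y z"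
  shows "left_of D x z"
proof -
  note car = left_of_carrier[OF assms(1)] left_of_carrier[OF assms(2)]
  have "incomparable D x z"
  proof (rule ccontr)
    assume "\<not> ?thesis"
    then have cmp: "x \<sqsubseteq> z \<or> z \<sqsubseteq> x" using car by (auto simp: incomparable_def)
    have "left_of D x y \<Longrightarrow> left_of D z y"
      using left_of_comparable(2)[of z x y] car cmp assms(2) by (auto simp: left_of_def)
    then show False using assms left_of_asym by blast
  qed
  moreover have "\<not> left_of D z x"
  proof
    assume c: "left_of D z x"
    show False
      using no_left_cycle_middle[OF assms c] no_left_cycle_middle[OF assms(2) c assms(1)]
        no_left_cycle_middle[OF c assms] by linarith
  qed
  ultimately show ?thesis using left_of_total by blast
qed

lemma mirror_left_of_converse: "left_of (mirror D) x y \<longleftrightarrow> left_of D y x"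
  using left_of_right_of by (simp add: mirror_left_of)

lemma quasiplanar_mirror: "quasiplanar (mirror D)"
  unfolding quasiplanar_def mirror_left_of mirror_right_of mirror_left_of_chain mirror_order_notions
proof (intro conjI allI impI)
  fix x y C
  assume i: "incomparable D x y" and ex: "\<exists>C. maximal_chain D C \<and> y \<in> C \<and> right_of_chain D x C"
    and C: "maximal_chain D C \<and> y \<in> C"
  then have "left_of D y x" using left_of_right_of by (auto simp: right_of_def)
  then have "\<not> left_of D x y" using left_of_asym by blast
  then have "\<not> left_of_chain D x C" using i C by (auto simp: left_of_def)
  then show "right_of_chain D x C" using left_or_right C i by (auto simp: incomparable_def)
qed (use bounded mirror_bounded left_of_right_of in auto)

lemma le1_refl: "x \<in> carrier D \<Longrightarrow> le1 D x x"
  using refl by (simp add: le1_def)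

lemma le1_antisym: "le1 D x y \<Longrightarrow> le1 D y x \<Longrightarrow> x \<in> carrier D \<Longrightarrow> y \<in> carrier D \<Longrightarrow> x = y"
  using antisym left_of_asym left_of_incomparable unfolding le1_def by blast

lemma le1_total: "x \<in> carrier D \<Longrightarrow> y \<in> carrier D \<Longrightarrow> le1 D x y \<or> le1 D y x"
  using left_of_total unfolding le1_def incomparable_def by blast

lemma le1_trans:
  assumes "le1 D x y" "le1 D y z" "x \<in> carrier D" "y \<in> carrier D" "z \<in> carrier D"
  shows "le1 D x z"
proof -
  consider "x \<sqsubseteq> y" "y \<sqsubseteq> z" | "left_of D x y" "left_of D y z"
    | "x \<sqsubseteq> y" "left_of D y z" | "left_of D x y" "y \<sqsubseteq> z"
    using assms by (auto simp: le1_def)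
  then show ?thesis
  proof cases
    case 1 then show ?thesis using trans assms by (auto simp: le1_def)
  next
    case 2 then show ?thesis using left_of_trans by (auto simp: le1_def)
  next
    case 3
    then have "\<not> z \<sqsubseteq> x" using trans[of z x y] assms left_of_incomparable by blast
    then show ?thesis
      using left_of_comparable(2)[of x y z] 3 assms by (auto simp: le1_def incomparable_def)
  next
    case 4
    then have "\<not> z \<sqsubseteq> x" using trans[of y z x] assms left_of_incomparable by blast
    then show ?thesis
      using left_of_comparable(1)[of z y x] 4 assms by (auto simp: le1_def incomparable_def)
  qed
qed

end

lemma quasiplanar_diagramI: "quasiplanar D \<Longrightarrow> quasiplanar_diagram D"
  by (simp add: quasiplanar_def quasiplanar_diagram_def quasiplanar_diagram_axioms_def
      bounded_hasse_def bounded_hasse_axioms_def hasse_def bounded_diagram_def)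

context quasiplanar_diagram
begin

lemma le1_mirror: "le1 (mirror D) = le2 D" and le2_mirror: "le2 (mirror D) = le1 D"
  by (simp_all add: le1_def le2_def mirror_left_of_converse fun_eq_iff)

lemma mirror_diagram: "quasiplanar_diagram (mirror D)"
  using quasiplanar_diagramI quasiplanar_mirror by blast

lemmas le2_refl = quasiplanar_diagram.le1_refl[OF mirror_diagram, unfolded le1_mirror mirror_simps]
  and le2_antisym = quasiplanar_diagram.le1_antisym[OF mirror_diagram, unfolded le1_mirror mirror_simps]
  and le2_total = quasiplanar_diagram.le1_total[OF mirror_diagram, unfolded le1_mirror mirror_simps]
  and le2_trans = quasiplanar_diagram.le1_trans[OF mirror_diagram, unfolded le1_mirror mirror_simps]

lemma le_iff: "x \<in> carrier D \<Longrightarrow> y \<in> carrier D \<Longrightarrow> x \<sqsubseteq> y \<longleftrightarrow> le1 D x y \<and> le2 D x y"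
  using left_of_asym by (auto simp: le1_def le2_def)

lemma left_of_iff: "x \<in> carrier D \<Longrightarrow> y \<in> carrier D \<Longrightarrow>
    left_of D x y \<longleftrightarrow> le1 D x y \<and> le2 D y x \<and> x \<noteq> y"
  using antisym left_of_irrefl by (auto simp: le1_def le2_def)

end

section \<open>Planar bounded diagrams are quasiplanar\<close>

context bounded_hasse
begin

lemma path_heights: "maximal_chain D C \<Longrightarrow> q \<in> chain_path D C \<Longrightarrow> snd q \<in> heights"
proof -
  assume C: "maximal_chain D C" and q: "q \<in> chain_path D C"
  obtain a b where ab: "a \<in> C" "b \<in> C" "eq_or_covers a b" "q \<in> edge D a b"
    using path_iff[OF C] q by blast
  obtain m k where "\<forall>s t. (s, t) \<in> edge D a b \<longleftrightarrow> h a \<le> t \<and> t \<le> h b \<and> s = m * t + k"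
    by (rule edge_affine[OF ab(3)])
  then have "h a \<le> snd q \<and> snd q \<le> h b" using ab(4) by (metis prod.collapse)
  then show ?thesis using h_heights[OF mc_carrier[OF C ab(1)]] h_heights[OF mc_carrier[OF C ab(2)]] by auto
qed

text \<open>
  The path is compact, and the height is an injective continuous function on it; its inverse is
  therefore continuous.
\<close>

lemma continuous_on_path_x:
  assumes C: "maximal_chain D C"
  shows "continuous_on heights (path_x C)"
proof -
  have fC: "finite C" using mc_carrier[OF C] fin by (meson finite_subset subsetI)
  have "{edge D a b | a b. a \<in> C \<and> b \<in> C \<and> covers D a b} \<subseteq> (\<lambda>(a, b). edge D a b) ` (C \<times> C)" by auto
  then have "finite {edge D a b | a b. a \<in> C \<and> b \<in> C \<and> covers D a b}"
    using fC by (meson finite_SigmaI finite_imageI finite_subset)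
  then have "compact (\<Union> {edge D a b | a b. a \<in> C \<and> b \<in> C \<and> covers D a b})"
    by (intro compact_Union) (auto simp: edge_def)
  then have "compact (chain_path D C)"
    unfolding chain_path_def by (rule compact_Un[OF finite_imp_compact[OF finite_imageI[OF fC]]])
  moreover have inv: "\<forall>q\<in>chain_path D C. (path_x C (snd q), snd q) = q"
    using path_x_iff[OF C path_heights[OF C]] by (metis prod.collapse)
  ultimately have "continuous_on (snd ` chain_path D C) (\<lambda>t. (path_x C t, t))"
    by (intro continuous_on_inv) (auto intro!: continuous_intros)
  moreover have "heights \<subseteq> snd ` chain_path D C"
    using path_x_iff[OF C] by force
  ultimately have "continuous_on heights (\<lambda>t. fst (path_x C t, t))"
    by (intro continuous_on_fst) (rule continuous_on_subset)
  then show ?thesis by simp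
qed

lemma path_x_on_edge:
  assumes C: "maximal_chain D C" and t: "t \<in> heights"
  obtains a b where "a \<in> C" "b \<in> C" "eq_or_covers a b" "h a \<le> t" "t \<le> h b" "(path_x C t, t) \<in> edge D a b"
proof -
  obtain a b where ab: "a \<in> C" "b \<in> C" "eq_or_covers a b" "h a \<le> t" "t \<le> h b"
    by (rule edge_at[OF C t])
  obtain m k where "\<forall>u. h a \<le> u \<and> u \<le> h b \<longrightarrow> path_x C u = m * u + k \<and> (path_x C u, u) \<in> edge D a b"
    by (rule path_x_affine[OF C ab(1-3)])
  then show ?thesis using that ab by blast
qed

end

locale planar_bounded = bounded_hasse +
  assumes planar: "planar_diagram D"
begin

lemma edges_meet:
  assumes "covers D a b" "covers D c d" "(a, b) \<noteq> (c, d)" "p \<in> edge D a b" "p \<in> edge D c d"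
  shows "p \<in> {pos D a, pos D b} \<inter> {pos D c, pos D d}"
  using planar assms unfolding planar_diagram_def by blast

text \<open>
  By the intermediate value theorem the paths meet, and in a planar diagram two different edges
  meet only at common endpoints. If the paths run along the same edge where they meet, then the
  lower end of that edge is a common vertex, and it is not below the height \<open>t\<^sub>1\<close>.
\<close>

lemma paths_cross_at_vertex:
  assumes C: "maximal_chain D C" and E: "maximal_chain D E"
    and t: "t\<^sub>1 \<le> t\<^sub>2" "t\<^sub>1 \<in> heights" "t\<^sub>2 \<in> heights"
    and before: "path_x C t\<^sub>1 < path_x E t\<^sub>1" and after: "path_x E t\<^sub>2 < path_x C t\<^sub>2"
  shows "\<exists>w \<in> C \<inter> E. t\<^sub>1 \<le> h w \<and> h w \<le> t\<^sub>2"
proof -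
  have sub: "{t\<^sub>1..t\<^sub>2} \<subseteq> heights" using t by auto
  have "continuous_on {t\<^sub>1..t\<^sub>2} (\<lambda>t. path_x C t - path_x E t)"
    by (intro continuous_on_diff continuous_on_subset[OF continuous_on_path_x sub] C E)
  then obtain s where s: "t\<^sub>1 \<le> s" "s \<le> t\<^sub>2" "path_x C s - path_x E s = 0"
    using IVT'[of "\<lambda>t. path_x C t - path_x E t" t\<^sub>1 0 t\<^sub>2] before after t by auto
  then have eq: "path_x C s = path_x E s" and sh: "s \<in> heights" using sub by auto
  obtain a b where ab: "a \<in> C" "b \<in> C" "eq_or_covers a b" "h a \<le> s" "s \<le> h b" "(path_x C s, s) \<in> edge D a b"
    by (rule path_x_on_edge[OF C sh])
  obtain c d where cd: "c \<in> E" "d \<in> E" "eq_or_covers c d" "h c \<le> s" "s \<le> h d" "(path_x E s, s) \<in> edge D c d"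
    by (rule path_x_on_edge[OF E sh])
  note car = mc_carrier[OF C ab(1)] mc_carrier[OF C ab(2)] mc_carrier[OF E cd(1)] mc_carrier[OF E cd(2)]
  have vertexC: ?thesis if "w \<in> C" "pos D w = (path_x C s, s)" for w
  proof -
    have w: "h w = s" "hc w = path_x C s" using that by auto
    then have "w \<in> E" using vertex_on_path[OF E mc_carrier[OF C that(1)]] eq by auto
    then show ?thesis using that s w by (intro bexI[of _ w]) auto
  qed
  have vertexE: ?thesis if "w \<in> E" "pos D w = (path_x C s, s)" for w
  proof -
    have w: "h w = s" "hc w = path_x C s" using that by auto
    then have "w \<in> C" using vertex_on_path[OF C mc_carrier[OF E that(1)]] by auto
    then show ?thesis using that s w by (intro bexI[of _ w]) auto
  qed
  consider "a = b" | "c = d" | "covers D a b" "covers D c d" using ab cd by blast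
  then show ?thesis
  proof cases
    case 1 then show ?thesis using vertexC[OF ab(1)] ab(6) by (simp add: edge_def)
  next
    case 2 then show ?thesis using vertexE[OF cd(1)] cd(6) eq by (simp add: edge_def)
  next
    case 3
    show ?thesis
    proof (cases "(a, b) = (c, d)")
      case False
      then show ?thesis using edges_meet[OF 3 False ab(6)] cd(6) eq vertexC ab(1,2) by auto
    next
      case True
      obtain m k where mk: "\<forall>u. h a \<le> u \<and> u \<le> h b \<longrightarrow> path_x C u = m * u + k \<and> (path_x C u, u) \<in> edge D a b"
        by (rule path_x_affine[OF C ab(1-3)])
      obtain m' k' where mk': "\<forall>u. h c \<le> u \<and> u \<le> h d \<longrightarrow> path_x E u = m' * u + k' \<and> (path_x E u, u) \<in> edge D c d"
        by (rule path_x_affine[OF E cd(1-3)])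
      have same: "path_x C u = path_x E u" if "h a \<le> u" "u \<le> h b" for u
      proof -
        have "(path_x C u, u) \<in> edge D a b" "(path_x E u, u) \<in> edge D a b" using mk mk' True that by auto
        moreover obtain m k where "\<forall>s t. (s, t) \<in> edge D a b \<longleftrightarrow> h a \<le> t \<and> t \<le> h b \<and> s = m * t + k"
          by (rule edge_affine[OF ab(3)])
        ultimately show ?thesis by metis
      qed
      have "t\<^sub>1 \<le> h a"
      proof (rule ccontr)
        assume "\<not> t\<^sub>1 \<le> h a"
        then have "path_x C t\<^sub>1 = path_x E t\<^sub>1" using same[of t\<^sub>1] ab(5) s(1) by linarith
        then show False using before by simp
      qed
      then show ?thesis using ab cd s True by auto
    qed
  qed
qed

text \<open>
  Otherwise the two paths change sides between the heights of \<open>x\<close> and \<open>y\<close>. They then have a common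
  vertex there, and through this vertex \<open>x\<close> and \<open>y\<close> are comparable.
\<close>

lemma sides_swap:
  assumes i: "incomparable D x y" and C: "maximal_chain D C" "y \<in> C" and E: "maximal_chain D E" "x \<in> E"
  shows "left_of_chain D x C \<longleftrightarrow> right_of_chain D y E"
proof -
  have car: "x \<in> carrier D" "y \<in> carrier D" using i by (auto simp: incomparable_def)
  have out: "x \<notin> C" "y \<notin> E" using i mc_total[OF C(1) _ C(2)] mc_total[OF E(1) _ E(2)]
    by (auto simp: incomparable_def)
  have ne: "path_x C (h x) \<noteq> hc x" "path_x E (h y) \<noteq> hc y"
    using vertex_on_path out C E car by blast+
  have no: False if w: "w \<in> C \<inter> E" and b: "h x \<le> h w \<and> h w \<le> h y \<or> h y \<le> h w \<and> h w \<le> h x" for w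
  proof -
    have "w \<in> carrier D" "x \<sqsubseteq> w \<and> w \<sqsubseteq> y \<or> y \<sqsubseteq> w \<and> w \<sqsubseteq> x"
      using w b mc_carrier C E mc_h_le by blast+
    then show False using trans[of x w y] trans[of y w x] i car by (auto simp: incomparable_def)
  qed
  have hh: "h x \<in> heights" "h y \<in> heights" using h_heights car by auto
  have xE: "path_x E (h x) = hc x" and yC: "path_x C (h y) = hc y" using path_x_vertex C E by auto
  have "hc x < path_x C (h x) \<longleftrightarrow> path_x E (h y) < hc y"
  proof (cases "h x \<le> h y")
    case True
    show ?thesis
      using paths_cross_at_vertex[OF C(1) E(1) True hh] paths_cross_at_vertex[OF E(1) C(1) True hh]
        no ne xE yC by (smt (verit) Int_commute)
  next
    case False
    then have "h y \<le> h x" by simp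
    from paths_cross_at_vertex[OF C(1) E(1) this hh(2,1)] paths_cross_at_vertex[OF E(1) C(1) this hh(2,1)]
    show ?thesis using no ne xE yC by (smt (verit) Int_commute)
  qed
  then show ?thesis using left_iff[OF C(1) car(1)] right_iff[OF E(1) car(2)] out by blast
qed

lemma planar_quasiplanar: "quasiplanar D"
  unfolding quasiplanar_def
proof (intro conjI allI impI)
  fix x y C
  assume i: "incomparable D x y" and ex: "\<exists>C. maximal_chain D C \<and> y \<in> C \<and> left_of_chain D x C"
    and C: "maximal_chain D C \<and> y \<in> C"
  obtain E where E: "maximal_chain D E" "x \<in> E" using mc_through i by (metis incomparable_def)
  show "left_of_chain D x C" using ex C sides_swap[OF i _ _ E] by blast
next
  fix x y
  have "left_of D x y \<longleftrightarrow> right_of D y x" if i: "incomparable D x y"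
  proof -
    obtain E where E: "maximal_chain D E" "x \<in> E" using mc_through i by (metis incomparable_def)
    obtain C where C: "maximal_chain D C" "y \<in> C" using mc_through i by (metis incomparable_def)
    have "incomparable D y x" using i by (auto simp: incomparable_def)
    then show ?thesis
      unfolding left_of_def right_of_def using i sides_swap[OF i] E C by blast
  qed
  then show "left_of D x y = right_of D y x"
    unfolding left_of_def right_of_def incomparable_def by blast
qed (rule bounded)

end

lemma lattice_bounded:
  assumes "hasse_diagram D" "lattice D" "carrier D \<noteq> {}"
  shows "bounded_diagram D"
proof -
  interpret hasse D using assms by unfold_locales
  interpret L: lattice D by fact
  obtain t where t: "t \<in> carrier D" "\<forall>c\<in>carrier D. t \<sqsubseteq>\<^bsub>D\<^esub> c \<longrightarrow> c = t"
    using maximal_element[of "carrier D"] assms by auto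
  have top: "x \<sqsubseteq>\<^bsub>D\<^esub> t" if "x \<in> carrier D" for x
    using t that L.join_closed L.join_left L.join_right by metis
  obtain b where b: "b \<in> carrier D" "\<forall>c\<in>carrier D. c \<sqsubseteq>\<^bsub>D\<^esub> b \<longrightarrow> c = b"
    using minimal_element[of "carrier D"] assms by auto
  have bot: "b \<sqsubseteq>\<^bsub>D\<^esub> x" if "x \<in> carrier D" for x
    using b that L.meet_closed L.meet_left L.meet_right by metis
  show ?thesis unfolding bounded_diagram_def weak_partial_order_bottom_def weak_partial_order_top_def
      weak_partial_order_bottom_axioms_def weak_partial_order_top_axioms_def
    using hasse weak_order b(1) t(1) bot top unfolding least_def greatest_def by blast
qed

lemma planar_lattice_quasiplanar:
  assumes "planar_lattice_diagram D"
  shows "quasiplanar_diagram D"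
proof -
  have "hasse_diagram D" "bounded_diagram D"
    using assms lattice_bounded by (auto simp: planar_lattice_diagram_def planar_diagram_def)
  then interpret planar_bounded D
    using assms by unfold_locales (auto simp: planar_lattice_diagram_def)
  show ?thesis using planar_quasiplanar by (rule quasiplanar_diagramI)
qed

section \<open>Drawing a poset from an embedding into the plane\<close>

text \<open>
  The componentwise order, seen after a rotation by 45 degrees: the elements above \<open>x\<close> are those in
  the upward cone at \<open>x\<close> whose sides have slopes \<open>1\<close> and \<open>-1\<close>.
\<close>

definition grid :: "'a set \<Rightarrow> ('a \<Rightarrow> real \<times> real) \<Rightarrow> 'a diagram" where
  "grid P f = \<lparr>carrier = P, eq = (=),
     le = \<lambda>x y. fst (f x) \<le> fst (f y) \<and> snd (f x) \<le> snd (f y),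
     pos = \<lambda>x. (fst (f x) - snd (f x), fst (f x) + snd (f x))\<rparr>"

lemma grid_simps [simp]:
  "carrier (grid P f) = P" "eq (grid P f) = (=)"
  "x \<sqsubseteq>\<^bsub>grid P f\<^esub> y \<longleftrightarrow> fst (f x) \<le> fst (f y) \<and> snd (f x) \<le> snd (f y)"
  "pos (grid P f) x = (fst (f x) - snd (f x), fst (f x) + snd (f x))"
  by (simp_all add: grid_def)

text \<open>
  The sum and the difference of the two coordinates of a point of the drawing are twice the
  coordinates that it had before the rotation.
\<close>

lemma grid_edge_between:
  assumes "q \<in> edge (grid P f) a b" "a \<sqsubseteq>\<^bsub>grid P f\<^esub> b"
  shows "2 * fst (f a) \<le> snd q + fst q" "snd q + fst q \<le> 2 * fst (f b)"
    and "2 * snd (f a) \<le> snd q - fst q" "snd q - fst q \<le> 2 * snd (f b)"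
proof -
  obtain u where u: "0 \<le> u" "u \<le> 1"
    and q1: "fst q = (1 - u) * (fst (f a) - snd (f a)) + u * (fst (f b) - snd (f b))"
    and q2: "snd q = (1 - u) * (fst (f a) + snd (f a)) + u * (fst (f b) + snd (f b))"
    using assms(1) by (auto simp: edge_def in_segment prod_eq_iff)
  have s: "snd q + fst q = 2 * fst (f a) + 2 * (u * (fst (f b) - fst (f a)))"
    "snd q - fst q = 2 * snd (f a) + 2 * (u * (snd (f b) - snd (f a)))"
    unfolding q1 q2 by (simp_all add: algebra_simps)
  have n: "0 \<le> fst (f b) - fst (f a)" "0 \<le> snd (f b) - snd (f a)" using assms(2) by auto
  have "0 \<le> u * (fst (f b) - fst (f a))" "u * (fst (f b) - fst (f a)) \<le> fst (f b) - fst (f a)"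
    "0 \<le> u * (snd (f b) - snd (f a))" "u * (snd (f b) - snd (f a)) \<le> snd (f b) - snd (f a)"
    using mult_nonneg_nonneg[OF u(1) n(1)] mult_right_mono[OF u(2) n(1)]
      mult_nonneg_nonneg[OF u(1) n(2)] mult_right_mono[OF u(2) n(2)] by auto
  then show "2 * fst (f a) \<le> snd q + fst q" "snd q + fst q \<le> 2 * fst (f b)"
    "2 * snd (f a) \<le> snd q - fst q" "snd q - fst q \<le> 2 * snd (f b)"
    unfolding s by auto
qed

lemma grid_hasse:
  assumes "finite P" "inj_on f P"
  shows "hasse_diagram (grid P f)"
proof -
  have ne: "f x \<noteq> f y" if "x \<in> P" "y \<in> P" "x \<noteq> y" for x y using that assms by (auto simp: inj_on_def)
  have po: "partial_order (grid P f)"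
  proof unfold_locales
    fix x y assume "x \<sqsubseteq>\<^bsub>grid P f\<^esub> y" "y \<sqsubseteq>\<^bsub>grid P f\<^esub> x" "x \<in> carrier (grid P f)" "y \<in> carrier (grid P f)"
    then show "x .=\<^bsub>grid P f\<^esub> y" using ne[of x y] by (auto simp: prod_eq_iff)
  qed auto
  have less: "x \<sqsubset>\<^bsub>grid P f\<^esub> y \<longleftrightarrow> x \<sqsubseteq>\<^bsub>grid P f\<^esub> y \<and> x \<noteq> y" for x y by (simp add: lless_def)
  have h: "snd (pos (grid P f) a) < snd (pos (grid P f) b)" if "covers (grid P f) a b" for a b
    using that ne[of a b] unfolding covers_def less by (auto simp: prod_eq_iff)
  have v: "c = a \<or> c = b" if "covers (grid P f) a b" "c \<in> P" "pos (grid P f) c \<in> edge (grid P f) a b" for a b c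
  proof -
    have ab: "a \<sqsubseteq>\<^bsub>grid P f\<^esub> b" using that(1) unfolding covers_def less by auto
    have "a \<sqsubseteq>\<^bsub>grid P f\<^esub> c" "c \<sqsubseteq>\<^bsub>grid P f\<^esub> b"
      using grid_edge_between[OF that(3) ab] by auto
    then show ?thesis using that(1,2) unfolding covers_def less by auto
  qed
  have "inj_on (pos (grid P f)) P"
  proof (rule inj_onI)
    fix x y assume "x \<in> P" "y \<in> P" "pos (grid P f) x = pos (grid P f) y"
    then show "x = y" using ne[of x y] by (auto simp: prod_eq_iff)
  qed
  then show ?thesis unfolding hasse_diagram_def using po h v assms(1) by auto
qed

text \<open>
  The path of a maximal chain through \<open>y\<close> stays inside the double cone at \<open>y\<close>. An element that is
  incomparable to \<open>y\<close> lies strictly outside of this double cone, so it is on the same side of all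
  of these paths.
\<close>

lemma grid_quasiplanar:
  assumes "finite P" "inj_on f P" and bd: "bounded_diagram (grid P f)"
  shows "quasiplanar (grid P f)"
    and "x \<in> P \<Longrightarrow> y \<in> P \<Longrightarrow>
      left_of (grid P f) x y \<longleftrightarrow> fst (f x) < fst (f y) \<and> snd (f y) < snd (f x)"
proof -
  let ?G = "grid P f"
  interpret bounded_hasse ?G
    using grid_hasse[OF assms(1,2)] bd by unfold_locales
  have inc: "incomparable ?G x y \<longleftrightarrow> x \<in> P \<and> y \<in> P \<and>
      (fst (f x) < fst (f y) \<and> snd (f y) < snd (f x) \<or> fst (f y) < fst (f x) \<and> snd (f x) < snd (f y))" for x y
    unfolding incomparable_def by auto
  have cone: "(snd q + fst q \<ge> 2 * fst (f y) \<and> snd q - fst q \<ge> 2 * snd (f y)) \<or>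
      (snd q + fst q \<le> 2 * fst (f y) \<and> snd q - fst q \<le> 2 * snd (f y))"
    if C: "maximal_chain ?G C" "y \<in> C" and q: "q \<in> chain_path ?G C" for C y q
  proof -
    obtain a b where ab: "a \<in> C" "b \<in> C" "eq_or_covers a b" "q \<in> edge ?G a b"
      using q path_iff[OF C(1)] by blast
    have car: "a \<in> P" "b \<in> P" "y \<in> P" using mc_carrier[OF C(1)] ab C by auto
    have le: "a \<sqsubseteq>\<^bsub>?G\<^esub> b" using ab(3) car refl by (auto simp: covers_iff)
    have "y \<sqsubseteq>\<^bsub>?G\<^esub> a \<or> b \<sqsubseteq>\<^bsub>?G\<^esub> y"
      using ab(3) mc_total[OF C(1) ab(1) C(2)] mc_total[OF C(1) ab(2) C(2)] car
      unfolding covers_iff by auto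
    then show ?thesis using grid_edge_between[OF ab(4) le] by auto
  qed
  have at: "\<exists>q\<in>chain_path ?G C. snd q = h x" if "maximal_chain ?G C" "x \<in> P" for C x
    using path_x_iff[OF that(1) h_heights, of x] that by (metis grid_simps(1) snd_conv)
  have out: "x \<notin> C" if "incomparable ?G x y" "maximal_chain ?G C" "y \<in> C" for C x y
    using that mc_total unfolding incomparable_def by blast
  have L: "left_of_chain ?G x C \<longleftrightarrow> fst (f x) < fst (f y)"
    and R: "right_of_chain ?G x C \<longleftrightarrow> fst (f y) < fst (f x)"
    if i: "incomparable ?G x y" and C: "maximal_chain ?G C" "y \<in> C" for C x y
  proof -
    have xP: "x \<in> P" using i inc by auto
    have side: "(hc x < fst q \<longleftrightarrow> fst (f x) < fst (f y)) \<and> (fst q < hc x \<longleftrightarrow> fst (f y) < fst (f x))"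
      if "q \<in> chain_path ?G C" "snd q = h x" for q
      using cone[OF C that(1)] that(2) i unfolding inc by (auto simp: algebra_simps)
    show "left_of_chain ?G x C \<longleftrightarrow> fst (f x) < fst (f y)"
      using side at[OF C(1) xP] out[OF i C] unfolding left_of_chain_def by blast
    show "right_of_chain ?G x C \<longleftrightarrow> fst (f y) < fst (f x)"
      using side at[OF C(1) xP] out[OF i C] unfolding right_of_chain_def by blast
  qed
  have l: "left_of ?G x y \<longleftrightarrow> incomparable ?G x y \<and> fst (f x) < fst (f y)" for x y
  proof -
    have "\<exists>C. maximal_chain ?G C \<and> y \<in> C" if "incomparable ?G x y"
      using mc_through[of y] that unfolding incomparable_def by metis
    then show ?thesis using L unfolding left_of_def by blast
  qed
  have r: "right_of ?G x y \<longleftrightarrow> incomparable ?G x y \<and> fst (f y) < fst (f x)" for x y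
  proof -
    have "\<exists>C. maximal_chain ?G C \<and> y \<in> C" if "incomparable ?G x y"
      using mc_through[of y] that unfolding incomparable_def by metis
    then show ?thesis using R unfolding right_of_def by blast
  qed
  show "quasiplanar ?G" unfolding quasiplanar_def
  proof (intro conjI allI impI)
    show "left_of ?G x y = right_of ?G y x" for x y unfolding l r inc by auto
  qed (use bd L in blast)+
  show "x \<in> P \<Longrightarrow> y \<in> P \<Longrightarrow>
      left_of ?G x y \<longleftrightarrow> fst (f x) < fst (f y) \<and> snd (f y) < snd (f x)"
    unfolding l inc by auto
qed

lemma segments_from_a_point:
  fixes a b d p :: "'v :: real_vector"
  assumes "p \<in> closed_segment a b" "p \<in> closed_segment a d" "p \<noteq> a"
  shows "b \<in> closed_segment a d \<or> d \<in> closed_segment a b"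
proof -
  obtain s where s: "0 \<le> s" "s \<le> 1" "p = (1 - s) *\<^sub>R a + s *\<^sub>R b" using assms(1) by (auto simp: in_segment)
  obtain t where t: "0 \<le> t" "t \<le> 1" "p = (1 - t) *\<^sub>R a + t *\<^sub>R d" using assms(2) by (auto simp: in_segment)
  have pos: "0 < s" "0 < t" using s t assms(3) by (auto simp: less_le)
  have "p - a = s *\<^sub>R (b - a)" unfolding s(3) by (simp add: scaleR_diff_left scaleR_diff_right)
  moreover have "p - a = t *\<^sub>R (d - a)" unfolding t(3) by (simp add: scaleR_diff_left scaleR_diff_right)
  ultimately have e: "s *\<^sub>R (b - a) = t *\<^sub>R (d - a)" by simp
  show ?thesis
  proof (cases "s \<le> t")
    case True
    have "(1 / t) *\<^sub>R (t *\<^sub>R (d - a)) = (1 / t) *\<^sub>R (s *\<^sub>R (b - a))" by (simp only: e)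
    then have "d - a = (s / t) *\<^sub>R (b - a)" using pos by simp
    then have "d = (1 - s / t) *\<^sub>R a + (s / t) *\<^sub>R b" by (simp add: algebra_simps)
    then show ?thesis using True pos by (auto simp: in_segment intro!: exI[of _ "s / t"])
  next
    case False
    have "(1 / s) *\<^sub>R (s *\<^sub>R (b - a)) = (1 / s) *\<^sub>R (t *\<^sub>R (d - a))" by (simp only: e)
    then have "b - a = (t / s) *\<^sub>R (d - a)" using pos by simp
    then have "b = (1 - t / s) *\<^sub>R a + (t / s) *\<^sub>R d" by (simp add: algebra_simps)
    then show ?thesis using False pos by (auto simp: in_segment intro!: exI[of _ "t / s"])
  qed
qed

text \<open>
  Let the edges from \<open>a\<close> to \<open>b\<close> and from \<open>c\<close> to \<open>d\<close> have a common point. Then \<open>a\<close> and \<open>c\<close> are below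
  both \<open>b\<close> and \<open>d\<close>, and so is the join of \<open>a\<close> and \<open>c\<close>. As \<open>b\<close> covers \<open>a\<close> and \<open>d\<close> covers \<open>c\<close>, this
  join is one of \<open>a\<close>, \<open>b\<close> and also one of \<open>c\<close>, \<open>d\<close>. So the edges have a common endpoint. They cannot
  have a second common point, since then they would overlap and one of them would run through an
  endpoint of the other.
\<close>

lemma grid_planar:
  assumes "finite P" "inj_on f P" and lat: "lattice (grid P f)"
  shows "planar_diagram (grid P f)"
proof -
  let ?G = "grid P f"
  interpret hasse ?G using grid_hasse[OF assms(1,2)] by unfold_locales
  interpret L: lattice ?G by (rule lat)
  have fork: "b = d" if "covers ?G a b" "covers ?G a d" "p \<in> edge ?G a b" "p \<in> edge ?G a d" "p \<noteq> pos ?G a" for a b d p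
    using segments_from_a_point[OF that(3,4,5)[unfolded edge_def]] covers_vertex[OF that(1), of d]
      covers_vertex[OF that(2), of b] that(1,2) unfolding covers_iff edge_def by auto
  have fork': "b = d" if "covers ?G b a" "covers ?G d a" "p \<in> edge ?G b a" "p \<in> edge ?G d a" "p \<noteq> pos ?G a" for a b d p
    using segments_from_a_point[of p "pos ?G a" "pos ?G b" "pos ?G d"] covers_vertex[OF that(1), of d]
      covers_vertex[OF that(2), of b] that
    unfolding covers_iff edge_def by (auto simp: closed_segment_commute)
  have "p \<in> {pos ?G a, pos ?G b} \<inter> {pos ?G c, pos ?G d}"
    if ab: "covers ?G a b" and cd: "covers ?G c d" and ne: "(a, b) \<noteq> (c, d)"
      and p: "p \<in> edge ?G a b" "p \<in> edge ?G c d" for a b c d p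
  proof -
    have car: "a \<in> P" "b \<in> P" "c \<in> P" "d \<in> P" and le: "a \<sqsubseteq>\<^bsub>?G\<^esub> b" "c \<sqsubseteq>\<^bsub>?G\<^esub> d"
      using ab cd by (auto simp: covers_iff)
    note b1 = grid_edge_between[OF p(1) le(1)] and b2 = grid_edge_between[OF p(2) le(2)]
    have cross: "a \<sqsubseteq>\<^bsub>?G\<^esub> d" "c \<sqsubseteq>\<^bsub>?G\<^esub> b" using b1 b2 by auto
    define j where "j = a \<squnion>\<^bsub>?G\<^esub> c"
    have j: "j \<in> P" "a \<sqsubseteq>\<^bsub>?G\<^esub> j" "c \<sqsubseteq>\<^bsub>?G\<^esub> j" "j \<sqsubseteq>\<^bsub>?G\<^esub> b" "j \<sqsubseteq>\<^bsub>?G\<^esub> d"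
      unfolding j_def using L.join_closed[of a c] L.join_left[of a c] L.join_right[of a c]
        L.join_le[of a b c] L.join_le[of a d c] car le cross by (auto simp del: grid_simps(3))
    have "j = a \<or> j = b" "j = c \<or> j = d" using ab cd j car unfolding covers_iff by (auto simp del: grid_simps(3))
    then consider "a = c" | "b = d" | "a = d" | "b = c" by auto
    then show ?thesis
    proof cases
      case 1
      then show ?thesis using fork[of a b d p] ab cd p ne by auto
    next
      case 2
      then show ?thesis using fork'[of a b c p] ab cd p ne by auto
    next
      case 3
      then have "p = pos ?G a" using b1 b2 by (auto simp: prod_eq_iff)
      then show ?thesis using 3 by auto
    next
      case 4
      then have "p = pos ?G b" using b1 b2 by (auto simp: prod_eq_iff)
      then show ?thesis using 4 by auto
    qed
  qed
  then show ?thesis unfolding planar_diagram_def using hasse by blast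
qed

section \<open>Horizontally convex filters\<close>

text \<open>
  With the two linear orders as coordinates, this is the set of nonzero elements in the quadrant
  whose corner is given by \<open>x\<close> in the first order and \<open>y\<close> in the second.
\<close>

definition quadrant :: "'a diagram \<Rightarrow> 'a \<Rightarrow> 'a \<Rightarrow> 'a set" where
  "quadrant Q x y = {q \<in> nonzero Q. le1 Q x q \<and> le2 Q y q}"

text \<open>
  The witnesses may be taken to be the least element of \<open>X\<close> in the first order and the least
  element of \<open>Y\<close> in the second. For the filters that belong to two pairs in \<open>E(Q)\<close> the relation is
  thus the one that the construction by pairs prescribes (\<open>filter_left_quadrant\<close>).
\<close>

definition filter_left :: "'a diagram \<Rightarrow> 'a set \<Rightarrow> 'a set \<Rightarrow> bool" where
  "filter_left Q X Y \<longleftrightarrow> (\<exists>x\<in>X. \<forall>y\<in>Y. le1 Q x y \<and> x \<noteq> y) \<and> (\<exists>y\<in>Y. \<forall>x\<in>X. le2 Q y x \<and> y \<noteq> x)"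

lemma least_of_total:
  assumes "finite S" "S \<noteq> {}"
    and "\<And>x. x \<in> S \<Longrightarrow> r x x"
    and "\<And>x y. x \<in> S \<Longrightarrow> y \<in> S \<Longrightarrow> r x y \<or> r y x"
    and "\<And>x y z. x \<in> S \<Longrightarrow> y \<in> S \<Longrightarrow> z \<in> S \<Longrightarrow> r x y \<Longrightarrow> r y z \<Longrightarrow> r x z"
  shows "\<exists>x\<in>S. \<forall>y\<in>S. r x y"
  using assms
proof (induction S rule: finite_ne_induct)
  case (singleton x)
  from singleton.prems(1)[of x] show ?case by blast
next
  case (insert a F)
  have "\<exists>x\<in>F. \<forall>y\<in>F. r x y"
    by (rule insert.IH) (use insert.prems in blast)+
  then obtain x where x: "x \<in> F" "\<forall>y\<in>F. r x y" by blast
  show ?case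
  proof (cases "r x a")
    case True
    then show ?thesis using x insert.prems(1) by blast
  next
    case False
    then have "r a x" using insert.prems(2) x by blast
    then have "\<forall>y\<in>insert a F. r a y" using insert.prems(1) insert.prems(3)[of a x] x by blast
    then show ?thesis by blast
  qed
qed

lemma (in quasiplanar_diagram) hco_filter_mirror: "hco_filter (mirror D) = hco_filter D"
  unfolding hco_filter_def fun_eq_iff nonzero_def mirror_left_of_converse mirror_simps mirror_bot_top by blast

locale nontrivial_quasiplanar = quasiplanar_diagram +
  assumes card_ge2: "card (carrier D) \<ge> 2"

lemma nontrivial_mirror: "nontrivial_quasiplanar D \<Longrightarrow> nontrivial_quasiplanar (mirror D)"
  unfolding nontrivial_quasiplanar_def nontrivial_quasiplanar_axioms_def
  by (simp add: quasiplanar_diagram.mirror_diagram)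

context nontrivial_quasiplanar
begin

lemmas mirror_nontrivial = nontrivial_mirror[OF nontrivial_quasiplanar_axioms]

lemma nonzero_iff: "x \<in> nonzero D \<longleftrightarrow> x \<in> carrier D \<and> x \<noteq> \<bottom>"
  by (auto simp: nonzero_def)

lemma nonzero_carrier: "x \<in> nonzero D \<Longrightarrow> x \<in> carrier D"
  by (simp add: nonzero_iff)

lemma finite_nonzero: "finite (nonzero D)"
  using fin by (simp add: nonzero_def)

lemma above_nonzero: "x \<in> nonzero D \<Longrightarrow> y \<in> carrier D \<Longrightarrow> x \<sqsubseteq> y \<Longrightarrow> y \<in> nonzero D"
  using antisym bot nonzero_iff by metis

lemma left_of_nonzero: "left_of D x y \<Longrightarrow> x \<in> nonzero D" "left_of D x y \<Longrightarrow> y \<in> nonzero D"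
  using bot left_of_carrier left_of_incomparable nonzero_iff by metis+

lemma nonzero_nonempty: "nonzero D \<noteq> {}"
proof
  assume "nonzero D = {}"
  then have "carrier D \<subseteq> {\<bottom>}" by (auto simp: nonzero_def)
  then have "card (carrier D) \<le> 1" using card_mono[of "{\<bottom>}"] by simp
  then show False using card_ge2 by simp
qed

lemma top_nonzero: "\<top> \<in> nonzero D"
  using nonzero_nonempty above_nonzero top nonzero_carrier by blast

lemma card_nonzero: "card (nonzero D) = card (carrier D) - 1"
  unfolding nonzero_def by (rule card_Diff_singleton[OF bot(1)])

lemma least1:
  assumes S: "S \<subseteq> nonzero D" "S \<noteq> {}"
  shows "\<exists>x\<in>S. \<forall>y\<in>S. le1 D x y"
proof -
  have car: "x \<in> carrier D" if "x \<in> S" for x using that S nonzero_carrier by blast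
  show ?thesis
  proof (rule least_of_total[OF finite_subset[OF S(1) finite_nonzero] S(2)])
    show "le1 D x x" if "x \<in> S" for x using le1_refl[OF car[OF that]] .
    show "le1 D x y \<or> le1 D y x" if "x \<in> S" "y \<in> S" for x y
      using le1_total[OF car[OF that(1)] car[OF that(2)]] by blast
    show "le1 D x z" if "x \<in> S" "y \<in> S" "z \<in> S" "le1 D x y" "le1 D y z" for x y z
      using le1_trans[OF that(4,5)] car that(1-3) by blast
  qed
qed

lemma least2:
  assumes "S \<subseteq> nonzero D" "S \<noteq> {}"
  shows "\<exists>x\<in>S. \<forall>y\<in>S. le2 D x y"
  using nontrivial_quasiplanar.least1[OF mirror_nontrivial, of S] assms
  unfolding le1_mirror nonzero_def mirror_simps mirror_bot_top by blast

lemma greatest2: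
  assumes S: "S \<subseteq> carrier D" "S \<noteq> {}"
  shows "\<exists>x\<in>S. \<forall>y\<in>S. le2 D y x"
proof -
  have car: "x \<in> carrier D" if "x \<in> S" for x using that S by blast
  show ?thesis
  proof (rule least_of_total[where r = "\<lambda>x y. le2 D y x", OF finite_subset[OF S(1) fin] S(2)])
    show "le2 D x x" if "x \<in> S" for x using le2_refl[OF car[OF that]] .
    show "le2 D y x \<or> le2 D x y" if "x \<in> S" "y \<in> S" for x y
      using le2_total[OF car[OF that(1)] car[OF that(2)]] by blast
    show "le2 D z x" if "x \<in> S" "y \<in> S" "z \<in> S" "le2 D y x" "le2 D z y" for x y z
      using le2_trans[OF that(5,4)] car that(1-3) by blast
  qed
qed

lemma E_set_iff: "(x, y) \<in> E_set D \<longleftrightarrow> x \<in> nonzero D \<and> y \<in> nonzero D \<and> le1 D x y \<and> le2 D y x"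
  unfolding E_set_def using left_of_iff[of x y] nonzero_carrier le1_refl le2_refl by auto

lemma hcoI:
  assumes "X \<noteq> {}" "X \<subseteq> nonzero D"
    and "\<And>x y. x \<in> X \<Longrightarrow> y \<in> carrier D \<Longrightarrow> x \<sqsubseteq> y \<Longrightarrow> y \<in> X"
    and "\<And>x y z. left_of D x y \<Longrightarrow> left_of D y z \<Longrightarrow> x \<in> X \<Longrightarrow> z \<in> X \<Longrightarrow> y \<in> X"
  shows "hco_filter D X"
  unfolding hco_filter_def by (intro conjI ballI allI impI) (use assms in \<open>blast+\<close>)

lemma hco_subset: "hco_filter D X \<Longrightarrow> X \<subseteq> nonzero D"
  and hco_nonempty: "hco_filter D X \<Longrightarrow> X \<noteq> {}"
  and hco_up: "hco_filter D X \<Longrightarrow> x \<in> X \<Longrightarrow> y \<in> carrier D \<Longrightarrow> x \<sqsubseteq> y \<Longrightarrow> y \<in> X"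
  and hco_convex: "hco_filter D X \<Longrightarrow> left_of D x y \<Longrightarrow> left_of D y z \<Longrightarrow> x \<in> X \<Longrightarrow> z \<in> X \<Longrightarrow> y \<in> X"
  unfolding hco_filter_def by blast+

lemma hco_carrier: "hco_filter D X \<Longrightarrow> q \<in> X \<Longrightarrow> q \<in> carrier D"
  using hco_subset nonzero_carrier by blast

lemma hco_top:
  assumes "hco_filter D X" shows "\<top> \<in> X"
proof -
  obtain x where x: "x \<in> X" using hco_nonempty[OF assms] by blast
  show ?thesis by (rule hco_up[OF assms x top(1) top(2)[OF hco_carrier[OF assms x]]])
qed

lemma hco_Int:
  assumes "hco_filter D X" "hco_filter D Y"
  shows "hco_filter D (X \<inter> Y)"
proof (rule hcoI)
  show "X \<inter> Y \<noteq> {}" using hco_top[OF assms(1)] hco_top[OF assms(2)] by blast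
  show "X \<inter> Y \<subseteq> nonzero D" using hco_subset[OF assms(1)] by blast
  show "y \<in> X \<inter> Y" if "x \<in> X \<inter> Y" "y \<in> carrier D" "x \<sqsubseteq> y" for x y
    using hco_up[OF assms(1) _ that(2,3)] hco_up[OF assms(2) _ that(2,3)] that(1) by blast
  show "y \<in> X \<inter> Y" if "left_of D x y" "left_of D y z" "x \<in> X \<inter> Y" "z \<in> X \<inter> Y" for x y z
    using hco_convex[OF assms(1) that(1,2)] hco_convex[OF assms(2) that(1,2)] that(3,4) by blast
qed

lemma quadrant_hco:
  assumes "x \<in> nonzero D" "y \<in> nonzero D"
  shows "hco_filter D (quadrant D x y)"
proof (rule hcoI)
  note car = nonzero_carrier[OF assms(1)] nonzero_carrier[OF assms(2)]
  have "\<top> \<in> quadrant D x y" using top_nonzero top(2)[OF car(1)] top(2)[OF car(2)] by (simp add: quadrant_def le1_def le2_def)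
  then show "quadrant D x y \<noteq> {}" by blast
  show "quadrant D x y \<subseteq> nonzero D" by (auto simp: quadrant_def)
  show "q' \<in> quadrant D x y" if "q \<in> quadrant D x y" "q' \<in> carrier D" "q \<sqsubseteq> q'" for q q'
  proof -
    have q: "q \<in> nonzero D" "le1 D x q" "le2 D y q" using that(1) by (simp_all add: quadrant_def)
    have "le1 D q q'" "le2 D q q'" using that(3) by (simp_all add: le1_def le2_def)
    then have "le1 D x q'" "le2 D y q'"
      using le1_trans[OF q(2) _ car(1) nonzero_carrier[OF q(1)] that(2)]
        le2_trans[OF q(3) _ car(2) nonzero_carrier[OF q(1)] that(2)] by blast+
    then show ?thesis using above_nonzero[OF q(1) that(2,3)] by (simp add: quadrant_def)
  qed
  show "b \<in> quadrant D x y" if l: "left_of D a b" "left_of D b c" and "a \<in> quadrant D x y" "c \<in> quadrant D x y" for a b c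
  proof -
    have ac: "le1 D x a" "le2 D y c" using that by (simp_all add: quadrant_def)
    have "le1 D a b" "le2 D c b" using l by (simp_all add: le1_def le2_def)
    then have "le1 D x b" "le2 D y b"
      using le1_trans[OF ac(1) _ car(1)] le2_trans[OF ac(2) _ car(2)]
        left_of_carrier[OF l(1)] left_of_carrier[OF l(2)] by blast+
    then show ?thesis using left_of_nonzero(2)[OF l(1)] by (simp add: quadrant_def)
  qed
qed

text \<open>
  Let \<open>x\<close> and \<open>y\<close> be the least elements of \<open>X\<close> in the two orders. An element of the quadrant is above
  \<open>x\<close>, or above \<open>y\<close>, or horizontally between \<open>x\<close> and \<open>y\<close>; in each case it belongs to \<open>X\<close>.
\<close>

lemma hco_quadrant:
  assumes "hco_filter D X"
  obtains x y where "(x, y) \<in> E_set D" "x \<in> X" "y \<in> X" "X = quadrant D x y"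
proof -
  have X: "X \<subseteq> nonzero D" "X \<noteq> {}" by (rule hco_subset[OF assms], rule hco_nonempty[OF assms])
  obtain x where x: "x \<in> X" "\<forall>q\<in>X. le1 D x q" using least1[OF X] by blast
  obtain y where y: "y \<in> X" "\<forall>q\<in>X. le2 D y q" using least2[OF X] by blast
  have "q \<in> X" if "q \<in> quadrant D x y" for q
  proof -
    have q: "q \<in> carrier D" "le1 D x q" "le2 D y q" using that nonzero_carrier by (auto simp: quadrant_def)
    then consider "x \<sqsubseteq> q" | "y \<sqsubseteq> q" | "left_of D x q" "left_of D q y" by (auto simp: le1_def le2_def)
    then show ?thesis
    proof cases
      case 1 then show ?thesis by (rule hco_up[OF assms x(1) q(1)])
    next
      case 2 then show ?thesis by (rule hco_up[OF assms y(1) q(1)])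
    next
      case 3 then show ?thesis using hco_convex[OF assms _ _ x(1) y(1)] by blast
    qed
  qed
  moreover have "q \<in> quadrant D x y" if "q \<in> X" for q
    using that x(2) y(2) X(1) by (auto simp: quadrant_def)
  ultimately have "X = quadrant D x y" by blast
  moreover have "(x, y) \<in> E_set D" using x y X by (auto simp: E_set_iff)
  ultimately show ?thesis using that x y by blast
qed

lemma quadrant_mem: "(x, y) \<in> E_set D \<Longrightarrow> x \<in> quadrant D x y" "(x, y) \<in> E_set D \<Longrightarrow> y \<in> quadrant D x y"
  using le1_refl le2_refl nonzero_carrier by (auto simp: E_set_iff quadrant_def)

lemma quadrant_mono:
  assumes "x \<in> carrier D" "y \<in> carrier D" "x' \<in> carrier D" "y' \<in> carrier D" "le1 D x' x" "le2 D y' y"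
  shows "quadrant D x y \<subseteq> quadrant D x' y'"
  unfolding quadrant_def using le1_trans[OF assms(5)] le2_trans[OF assms(6)] assms nonzero_carrier by blast

lemma E_set_carrier: "(x, y) \<in> E_set D \<Longrightarrow> x \<in> carrier D" "(x, y) \<in> E_set D \<Longrightarrow> y \<in> carrier D"
  using nonzero_carrier by (auto simp: E_set_iff)

lemma quadrant_subset_iff:
  assumes "(x, y) \<in> E_set D" "(x', y') \<in> E_set D"
  shows "quadrant D x y \<subseteq> quadrant D x' y' \<longleftrightarrow> le1 D x' x \<and> le2 D y' y"
proof
  show "quadrant D x y \<subseteq> quadrant D x' y' \<Longrightarrow> le1 D x' x \<and> le2 D y' y"
    using quadrant_mem[OF assms(1)] by (auto simp: quadrant_def)
  show "le1 D x' x \<and> le2 D y' y \<Longrightarrow> quadrant D x y \<subseteq> quadrant D x' y'"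
    using quadrant_mono E_set_carrier[OF assms(1)] E_set_carrier[OF assms(2)] by blast
qed

lemma bij_quadrant: "bij_betw (\<lambda>(x, y). quadrant D x y) (E_set D) (Collect (hco_filter D))"
proof (rule bij_betw_imageI)
  show "inj_on (\<lambda>(x, y). quadrant D x y) (E_set D)"
  proof (rule inj_onI, clarify)
    fix x y x' y' assume a: "(x, y) \<in> E_set D" "(x', y') \<in> E_set D" "quadrant D x y = quadrant D x' y'"
    then show "x = x' \<and> y = y'"
      using quadrant_subset_iff[OF a(1,2)] quadrant_subset_iff[OF a(2,1)] E_set_carrier le1_antisym le2_antisym
      by (metis order_refl)
  qed
  show "(\<lambda>(x, y). quadrant D x y) ` E_set D = Collect (hco_filter D)"
  proof (intro equalityI subsetI)
    fix X assume "X \<in> (\<lambda>(x, y). quadrant D x y) ` E_set D"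
    then show "X \<in> Collect (hco_filter D)" using quadrant_hco by (auto simp: E_set_iff)
  next
    fix X assume "X \<in> Collect (hco_filter D)"
    then have "hco_filter D X" by simp
    then obtain x y where "(x, y) \<in> E_set D" "X = quadrant D x y" by (rule hco_quadrant)
    then show "X \<in> (\<lambda>(x, y). quadrant D x y) ` E_set D" by (auto intro!: image_eqI[of _ _ "(x, y)"])
  qed
qed

lemma filter_left_quadrant:
  assumes "(x, y) \<in> E_set D" "(x', y') \<in> E_set D"
  shows "filter_left D (quadrant D x y) (quadrant D x' y') \<longleftrightarrow> (le1 D x x' \<and> x \<noteq> x') \<and> (le2 D y' y \<and> y \<noteq> y')"
proof -
  note car = E_set_carrier[OF assms(1)] E_set_carrier[OF assms(2)]
  have "(\<exists>a\<in>quadrant D x y. \<forall>b\<in>quadrant D x' y'. le1 D a b \<and> a \<noteq> b) \<longleftrightarrow> le1 D x x' \<and> x \<noteq> x'"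
  proof
    assume "\<exists>a\<in>quadrant D x y. \<forall>b\<in>quadrant D x' y'. le1 D a b \<and> a \<noteq> b"
    then obtain a where a': "a \<in> quadrant D x y" "le1 D a x'" "a \<noteq> x'"
      using quadrant_mem(1)[OF assms(2)] by blast
    then have a: "a \<in> carrier D" "le1 D x a" "le1 D a x'" "a \<noteq> x'"
      by (simp_all add: quadrant_def nonzero_carrier)
    then show "le1 D x x' \<and> x \<noteq> x'" using le1_trans[OF a(2,3)] le1_antisym car by blast
  next
    assume l: "le1 D x x' \<and> x \<noteq> x'"
    have "le1 D x b \<and> x \<noteq> b" if "b \<in> quadrant D x' y'" for b
      using that l le1_trans[of x x' b] le1_antisym[of x x'] car nonzero_carrier by (auto simp: quadrant_def)
    then show "\<exists>a\<in>quadrant D x y. \<forall>b\<in>quadrant D x' y'. le1 D a b \<and> a \<noteq> b" using quadrant_mem[OF assms(1)] by blast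
  qed
  moreover have "(\<exists>b\<in>quadrant D x' y'. \<forall>a\<in>quadrant D x y. le2 D b a \<and> b \<noteq> a) \<longleftrightarrow> le2 D y' y \<and> y \<noteq> y'"
  proof
    assume "\<exists>b\<in>quadrant D x' y'. \<forall>a\<in>quadrant D x y. le2 D b a \<and> b \<noteq> a"
    then obtain a where a': "a \<in> quadrant D x' y'" "le2 D a y" "a \<noteq> y"
      using quadrant_mem(2)[OF assms(1)] by blast
    then have a: "a \<in> carrier D" "le2 D y' a" "le2 D a y" "a \<noteq> y"
      by (simp_all add: quadrant_def nonzero_carrier)
    then show "le2 D y' y \<and> y \<noteq> y'" using le2_trans[OF a(2,3)] le2_antisym car by blast
  next
    assume l: "le2 D y' y \<and> y \<noteq> y'"
    have "le2 D y' b \<and> y' \<noteq> b" if "b \<in> quadrant D x y" for b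
      using that l le2_trans[of y' y b] le2_antisym[of y y'] car nonzero_carrier by (auto simp: quadrant_def)
    then show "\<exists>b\<in>quadrant D x' y'. \<forall>a\<in>quadrant D x y. le2 D b a \<and> b \<noteq> a" using quadrant_mem[OF assms(2)] by blast
  qed
  ultimately show ?thesis by (simp add: filter_left_def)
qed

lemma filter_left_total:
  assumes "hco_filter D X" "hco_filter D Y" "\<not> X \<subseteq> Y" "\<not> Y \<subseteq> X"
  shows "filter_left D X Y \<or> filter_left D Y X"
proof -
  obtain x y where X: "(x, y) \<in> E_set D" "X = quadrant D x y" by (rule hco_quadrant[OF assms(1)])
  obtain x' y' where Y: "(x', y') \<in> E_set D" "Y = quadrant D x' y'" by (rule hco_quadrant[OF assms(2)])
  have n: "\<not> (le1 D x' x \<and> le2 D y' y)" "\<not> (le1 D x x' \<and> le2 D y y')"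
    using assms(3,4) quadrant_subset_iff[OF X(1) Y(1)] quadrant_subset_iff[OF Y(1) X(1)] X Y by auto
  have t: "le1 D x x' \<or> le1 D x' x" "le2 D y y' \<or> le2 D y' y" "le1 D x x" "le2 D y y"
    using le1_total le2_total le1_refl le2_refl E_set_carrier[OF X(1)] E_set_carrier[OF Y(1)] by blast+
  show ?thesis unfolding X(2) Y(2) filter_left_quadrant[OF X(1) Y(1)] filter_left_quadrant[OF Y(1) X(1)]
    using n t by blast
qed

lemma filter_left_not_subset:
  assumes "filter_left D X Y" shows "\<not> X \<subseteq> Y" "\<not> Y \<subseteq> X"
  using assms unfolding filter_left_def by blast+

lemma hco_hull:
  assumes "hco_filter D X" "hco_filter D Y"
  obtains H where "hco_filter D H" "X \<subseteq> H" "Y \<subseteq> H"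
    "\<forall>Z. hco_filter D Z \<and> X \<subseteq> Z \<and> Y \<subseteq> Z \<longrightarrow> H \<subseteq> Z"
proof -
  have U: "X \<union> Y \<subseteq> nonzero D" "X \<union> Y \<noteq> {}" using hco_subset[OF assms(1)] hco_subset[OF assms(2)] hco_nonempty[OF assms(1)] by blast+
  obtain x where x: "x \<in> X \<union> Y" "\<forall>q\<in>X \<union> Y. le1 D x q" using least1[OF U] by blast
  obtain y where y: "y \<in> X \<union> Y" "\<forall>q\<in>X \<union> Y. le2 D y q" using least2[OF U] by blast
  show ?thesis
  proof (rule that[of "quadrant D x y"])
    show "hco_filter D (quadrant D x y)" using quadrant_hco x(1) y(1) U(1) by blast
    show "X \<subseteq> quadrant D x y" "Y \<subseteq> quadrant D x y" using x(2) y(2) U(1) by (auto simp: quadrant_def)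
    show "\<forall>Z. hco_filter D Z \<and> X \<subseteq> Z \<and> Y \<subseteq> Z \<longrightarrow> quadrant D x y \<subseteq> Z"
    proof (intro allI impI)
      fix Z assume Z: "hco_filter D Z \<and> X \<subseteq> Z \<and> Y \<subseteq> Z"
      obtain a b where ab: "(a, b) \<in> E_set D" "Z = quadrant D a b" using hco_quadrant Z by metis
      have "x \<in> quadrant D a b" "y \<in> quadrant D a b" using x(1) y(1) Z ab(2) by blast+
      then have "le1 D a x" "le2 D b y" by (simp_all add: quadrant_def)
      moreover have "x \<in> carrier D" "y \<in> carrier D" using x(1) y(1) U(1) nonzero_carrier by blast+
      ultimately show "quadrant D x y \<subseteq> Z" using quadrant_mono[of x y a b] E_set_carrier[OF ab(1)] ab(2) by blast
    qed
  qed
qed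

text \<open>
  The least element in the first order is neither above nor to the right of another element of \<open>X\<close>,
  so neither of the two closure properties can produce it.
\<close>

lemma hco_remove_least1:
  assumes X: "hco_filter D X" and x: "x \<in> X" "\<forall>q\<in>X. le1 D x q" and ne: "X \<noteq> {x}"
  shows "hco_filter D (X - {x})"
proof (rule hcoI)
  note car = hco_carrier[OF X]
  show "X - {x} \<noteq> {}" using ne x(1) by blast
  show "X - {x} \<subseteq> nonzero D" using hco_subset[OF X] by blast
  show "q' \<in> X - {x}" if "q \<in> X - {x}" "q' \<in> carrier D" "q \<sqsubseteq> q'" for q q'
  proof -
    have "le1 D x q" "le1 D q q'" using x that by (simp_all add: le1_def)
    then have "q' \<noteq> x" using le1_antisym[of x q] car[of q] car[OF x(1)] that(1) by blast
    then show ?thesis using hco_up[OF X _ that(2,3)] that(1) by blast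
  qed
  show "b \<in> X - {x}" if l: "left_of D a b" "left_of D b c" and "a \<in> X - {x}" "c \<in> X - {x}" for a b c
  proof -
    have m: "b \<in> X" using hco_convex[OF X l] that(3,4) by blast
    have "le1 D a b" "le1 D x a" using l x that by (simp_all add: le1_def)
    then have "b \<noteq> x" using le1_antisym[of x a] car[of a] car[OF x(1)] that(3) by blast
    then show ?thesis using m by blast
  qed
qed

lemma hco_remove_least2:
  assumes "hco_filter D X" "y \<in> X" "\<forall>q\<in>X. le2 D y q" "X \<noteq> {y}"
  shows "hco_filter D (X - {y})"
  using nontrivial_quasiplanar.hco_remove_least1[OF mirror_nontrivial, of X y] assms
  unfolding le1_mirror hco_filter_mirror by blast

lemma hco_quadrant_least:
  assumes "(x, y) \<in> E_set D" "q \<in> quadrant D x y"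
  shows "le1 D x q" "le2 D y q"
  using assms by (auto simp: quadrant_def)

text \<open>
  The hco-filters form a convex geometry: the least elements of \<open>X\<close> in the two orders determine \<open>X\<close>,
  so one of them is missing in a smaller filter \<open>Y\<close>, and that one may be removed.
\<close>

lemma hco_remove_point:
  assumes X: "hco_filter D X" and Y: "hco_filter D Y" "Y \<subset> X"
  shows "\<exists>p\<in>X - Y. hco_filter D (X - {p})"
proof -
  obtain x y where e: "(x, y) \<in> E_set D" "x \<in> X" "y \<in> X" "X = quadrant D x y" by (rule hco_quadrant[OF X])
  obtain a b where ab: "(a, b) \<in> E_set D" "Y = quadrant D a b" by (rule hco_quadrant[OF Y(1)])
  have "\<not> (x \<in> Y \<and> y \<in> Y)"
    using Y(2) e ab quadrant_subset_iff[OF e(1) ab(1)] hco_quadrant_least[OF ab(1)] by blast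
  then consider "x \<notin> Y" | "y \<notin> Y" by blast
  then show ?thesis
  proof cases
    case 1
    then have "X \<noteq> {x}" using Y hco_top[OF Y(1)] by blast
    then show ?thesis using hco_remove_least1[OF X e(2)] hco_quadrant_least(1)[OF e(1)] e 1 by blast
  next
    case 2
    then have "X \<noteq> {y}" using Y hco_top[OF Y(1)] by blast
    then show ?thesis using hco_remove_least2[OF X e(3)] hco_quadrant_least(2)[OF e(1)] e 2 by blast
  qed
qed

end

section \<open>The lattice of horizontally convex filters\<close>

text \<open>
  Both constructions \<open>\<beta>\<^sub>1(Q)\<close> and \<open>\<beta>\<^sub>2(Q)\<close>, and also a slim semimodular diagram \<open>D\<close> with \<open>Q = \<alpha>(D)\<close>,
  have the lattice of hco-filters of \<open>Q\<close> under reverse inclusion as their underlying order. The map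
  \<open>g\<close> identifies their elements with filters. The predicate \<open>filter_diagram\<close> includes the relation
  \<open>\<lambda>\<close> in this description.
\<close>

definition filter_model :: "'b diagram \<Rightarrow> 'a diagram \<Rightarrow> ('a \<Rightarrow> 'b set) \<Rightarrow> bool" where
  "filter_model Q B g \<longleftrightarrow> bij_betw g (carrier B) (Collect (hco_filter Q)) \<and>
     (\<forall>a\<in>carrier B. \<forall>b\<in>carrier B. a \<sqsubseteq>\<^bsub>B\<^esub> b \<longleftrightarrow> g b \<subseteq> g a)"

definition filter_diagram :: "'b diagram \<Rightarrow> 'a diagram \<Rightarrow> ('a \<Rightarrow> 'b set) \<Rightarrow> bool" where
  "filter_diagram Q B g \<longleftrightarrow> filter_model Q B g \<and>
     (\<forall>a\<in>carrier B. \<forall>b\<in>carrier B. left_of B a b \<longleftrightarrow> filter_left Q (g a) (g b))"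

locale filter_lattice = Q: nontrivial_quasiplanar Q + hasse B
  for Q :: "'b diagram" and B :: "'a diagram" and g :: "'a \<Rightarrow> 'b set" +
  assumes model: "filter_model Q B g"
begin

lemma g_hco: "a \<in> carrier B \<Longrightarrow> hco_filter Q (g a)"
  using model by (auto simp: filter_model_def bij_betw_def)

lemma g_surj: "hco_filter Q X \<Longrightarrow> (\<And>a. a \<in> carrier B \<Longrightarrow> g a = X \<Longrightarrow> thesis) \<Longrightarrow> thesis"
  using model unfolding filter_model_def bij_betw_def by (metis imageE mem_Collect_eq)

lemma g_inj: "a \<in> carrier B \<Longrightarrow> b \<in> carrier B \<Longrightarrow> g a = g b \<Longrightarrow> a = b"
  using model by (auto simp: filter_model_def bij_betw_def inj_on_def)

lemma g_le: "a \<in> carrier B \<Longrightarrow> b \<in> carrier B \<Longrightarrow> a \<sqsubseteq>\<^bsub>B\<^esub> b \<longleftrightarrow> g b \<subseteq> g a"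
  using model by (auto simp: filter_model_def)

lemma sup_exists:
  assumes "a \<in> carrier B" "b \<in> carrier B"
  obtains j where "j \<in> carrier B" "g j = g a \<inter> g b"
  using g_surj[OF Q.hco_Int[OF g_hco[OF assms(1)] g_hco[OF assms(2)]]] by blast

lemma lattice: "lattice B"
proof -
  interpret po: partial_order B by (rule order)
  show ?thesis
  proof unfold_locales
    fix a b assume ab: "a \<in> carrier B" "b \<in> carrier B"
    obtain j where j: "j \<in> carrier B" "g j = g a \<inter> g b" by (rule sup_exists[OF ab])
    have "Upper B {a, b} = {u \<in> carrier B. g u \<subseteq> g a \<and> g u \<subseteq> g b}"
      unfolding Upper_def using ab g_le by auto
    then have "least B j (Upper B {a, b})"
      unfolding least_def using j by (auto simp: g_le)
    then show "\<exists>s. least B s (Upper B {a, b})" by blast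
    obtain H where H: "hco_filter Q H" "g a \<subseteq> H" "g b \<subseteq> H"
      "\<forall>Z. hco_filter Q Z \<and> g a \<subseteq> Z \<and> g b \<subseteq> Z \<longrightarrow> H \<subseteq> Z"
      by (rule Q.hco_hull[OF g_hco[OF ab(1)] g_hco[OF ab(2)]])
    obtain m where m: "m \<in> carrier B" "g m = H" by (rule g_surj[OF H(1)])
    have "Lower B {a, b} = {u \<in> carrier B. g a \<subseteq> g u \<and> g b \<subseteq> g u}"
      unfolding Lower_def using ab g_le by auto
    then have "greatest B m (Lower B {a, b})"
      unfolding greatest_def using m H(2-4) g_hco g_le by simp
    then show "\<exists>s. greatest B s (Lower B {a, b})" by blast
  qed
qed

lemma carrier_nonempty: "carrier B \<noteq> {}"
  using g_surj[OF Q.quadrant_hco[OF Q.top_nonzero Q.top_nonzero]] by blast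

lemma g_join:
  assumes "a \<in> carrier B" "b \<in> carrier B"
  shows "a \<squnion>\<^bsub>B\<^esub> b \<in> carrier B" "g (a \<squnion>\<^bsub>B\<^esub> b) = g a \<inter> g b"
proof -
  interpret L: lattice B by (rule lattice)
  show c: "a \<squnion>\<^bsub>B\<^esub> b \<in> carrier B" using L.join_closed assms by blast
  obtain j where j: "j \<in> carrier B" "g j = g a \<inter> g b" by (rule sup_exists[OF assms])
  have "a \<squnion>\<^bsub>B\<^esub> b \<sqsubseteq>\<^bsub>B\<^esub> j" using L.join_le[OF _ _ assms j(1)] j assms by (auto simp: g_le)
  moreover have "g (a \<squnion>\<^bsub>B\<^esub> b) \<subseteq> g a" "g (a \<squnion>\<^bsub>B\<^esub> b) \<subseteq> g b"
    using L.join_left[OF assms] L.join_right[OF assms] c assms by (auto simp: g_le)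
  ultimately show "g (a \<squnion>\<^bsub>B\<^esub> b) = g a \<inter> g b" using j c g_le by blast
qed

lemma covers_remove_point: "covers B a b \<Longrightarrow> \<exists>p\<in>g a. g b = g a - {p}"
proof -
  assume c: "covers B a b"
  then have car: "a \<in> carrier B" "b \<in> carrier B" "g b \<subset> g a"
    using g_le g_inj unfolding covers_iff by blast+
  obtain p where p: "p \<in> g a - g b" "hco_filter Q (g a - {p})"
    using Q.hco_remove_point[OF g_hco g_hco] car by blast
  obtain e where e: "e \<in> carrier B" "g e = g a - {p}" by (rule g_surj[OF p(2)])
  have "a \<sqsubseteq>\<^bsub>B\<^esub> e" "e \<sqsubseteq>\<^bsub>B\<^esub> b"
    using g_le[OF car(1) e(1)] g_le[OF e(1) car(2)] e(2) p(1) car(3) by blast+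
  then have "e = a \<or> e = b" using c e(1) unfolding covers_iff by blast
  then show ?thesis using e p by blast
qed

lemma remove_point_covers:
  assumes "a \<in> carrier B" "b \<in> carrier B" "p \<in> g a" "g b = g a - {p}"
  shows "covers B a b"
  unfolding covers_iff
proof (intro conjI ballI impI)
  fix c assume c: "c \<in> carrier B" "a \<sqsubseteq>\<^bsub>B\<^esub> c \<and> c \<sqsubseteq>\<^bsub>B\<^esub> b"
  then have "g a - {p} \<subseteq> g c" "g c \<subseteq> g a" using assms g_le by auto
  then have "g c = g a \<or> g c = g b" using assms by blast
  then show "c = a \<or> c = b" using g_inj c assms by blast
qed (use assms g_le in auto)

text \<open>
  Joining with \<open>c\<close> is intersecting with \<open>g c\<close>. Two filters that differ by one point have
  intersections with \<open>g c\<close> that are equal or differ by this point.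
\<close>

lemma semimodular: "semimodular B"
  unfolding semimodular_def
proof (intro allI ballI impI)
  fix a b c assume c: "c \<in> carrier B" and ab: "covers B a b"
  have car: "a \<in> carrier B" "b \<in> carrier B" using ab by (auto simp: covers_iff)
  obtain p where p: "p \<in> g a" "g b = g a - {p}" using covers_remove_point[OF ab] by blast
  note ja = g_join[OF car(1) c] and jb = g_join[OF car(2) c]
  show "a \<squnion>\<^bsub>B\<^esub> c = b \<squnion>\<^bsub>B\<^esub> c \<or> covers B (a \<squnion>\<^bsub>B\<^esub> c) (b \<squnion>\<^bsub>B\<^esub> c)"
  proof (cases "p \<in> g c")
    case True
    then have "covers B (a \<squnion>\<^bsub>B\<^esub> c) (b \<squnion>\<^bsub>B\<^esub> c)"
      using remove_point_covers[OF ja(1) jb(1), of p] ja jb p by auto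
    then show ?thesis by blast
  next
    case False
    then have "g (a \<squnion>\<^bsub>B\<^esub> c) = g (b \<squnion>\<^bsub>B\<^esub> c)" using ja jb p by auto
    then show ?thesis using g_inj ja jb by blast
  qed
qed

text \<open>
  A filter is the intersection of a final segment of the first order and a final segment of the
  second, so an element of the lattice is the join of an element of \<open>C1\<close> and one of \<open>C2\<close>. If it is
  join-irreducible, it equals one of these two. Final segments of a linear order form a chain.
\<close>

lemma slim: "slim B"
proof -
  (* with x0 and y0 least in the two orders, quadrants with one of them as a corner are final segments *)
  obtain x0 where x0: "x0 \<in> nonzero Q" "\<forall>q\<in>nonzero Q. le1 Q x0 q"
    using Q.least1[of "nonzero Q"] Q.nonzero_nonempty by blast
  obtain y0 where y0: "y0 \<in> nonzero Q" "\<forall>q\<in>nonzero Q. le2 Q y0 q"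
    using Q.least2[of "nonzero Q"] Q.nonzero_nonempty by blast
  define C1 where "C1 = {a \<in> carrier B. \<exists>x\<in>nonzero Q. g a = quadrant Q x y0}"
  define C2 where "C2 = {a \<in> carrier B. \<exists>y\<in>nonzero Q. g a = quadrant Q x0 y}"
  have "chain_in B C1" unfolding chain_in_def
  proof (intro conjI ballI)
    fix a b assume a: "a \<in> C1" and b: "b \<in> C1"
    obtain x where x: "x \<in> nonzero Q" "g a = quadrant Q x y0" "a \<in> carrier B" using a by (auto simp: C1_def)
    obtain x' where x': "x' \<in> nonzero Q" "g b = quadrant Q x' y0" "b \<in> carrier B" using b by (auto simp: C1_def)
    have "le1 Q x x' \<or> le1 Q x' x" "le2 Q y0 y0"
      using Q.le1_total Q.le2_refl x x' y0 Q.nonzero_carrier by blast+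
    then show "a \<sqsubseteq>\<^bsub>B\<^esub> b \<or> b \<sqsubseteq>\<^bsub>B\<^esub> a"
      using g_le x x' Q.quadrant_mono[of x y0 x' y0] Q.quadrant_mono[of x' y0 x y0] y0 Q.nonzero_carrier by auto
  qed (auto simp: C1_def)
  moreover have "chain_in B C2" unfolding chain_in_def
  proof (intro conjI ballI)
    fix a b assume a: "a \<in> C2" and b: "b \<in> C2"
    obtain y where y: "y \<in> nonzero Q" "g a = quadrant Q x0 y" "a \<in> carrier B" using a by (auto simp: C2_def)
    obtain y' where y': "y' \<in> nonzero Q" "g b = quadrant Q x0 y'" "b \<in> carrier B" using b by (auto simp: C2_def)
    have "le2 Q y y' \<or> le2 Q y' y" "le1 Q x0 x0"
      using Q.le2_total Q.le1_refl y y' x0 Q.nonzero_carrier by blast+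
    then show "a \<sqsubseteq>\<^bsub>B\<^esub> b \<or> b \<sqsubseteq>\<^bsub>B\<^esub> a"
      using g_le y y' Q.quadrant_mono[of x0 y x0 y'] Q.quadrant_mono[of x0 y' x0 y] x0 Q.nonzero_carrier by auto
  qed (auto simp: C2_def)
  moreover have "a \<in> C1 \<union> C2" if ji: "a \<in> join_irreducibles B" for a
  proof (rule ccontr)
    assume n: "a \<notin> C1 \<union> C2"
    obtain c where c: "a \<in> carrier B" "covers B c a" "\<forall>c'. covers B c' a \<longrightarrow> c' = c"
      using ji unfolding join_irreducibles_def by blast
    obtain x y where xy: "(x, y) \<in> E_set Q" "g a = quadrant Q x y" by (rule Q.hco_quadrant[OF g_hco[OF c(1)]])
    have N: "x \<in> nonzero Q" "y \<in> nonzero Q" using xy by (auto simp: Q.E_set_iff)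
    obtain a1 where a1: "a1 \<in> carrier B" "g a1 = quadrant Q x y0" by (rule g_surj[OF Q.quadrant_hco[OF N(1) y0(1)]])
    obtain a2 where a2: "a2 \<in> carrier B" "g a2 = quadrant Q x0 y" by (rule g_surj[OF Q.quadrant_hco[OF x0(1) N(2)]])
    have int: "g a = g a1 \<inter> g a2" unfolding xy a1 a2 using x0 y0 by (auto simp: quadrant_def)
    have "a1 \<noteq> a" "a2 \<noteq> a" using n a1 a2 N by (auto simp: C1_def C2_def)
    moreover have "a1 \<sqsubseteq>\<^bsub>B\<^esub> a" "a2 \<sqsubseteq>\<^bsub>B\<^esub> a" using int a1 a2 c g_le by auto
    ultimately have "a1 \<sqsubseteq>\<^bsub>B\<^esub> c" "a2 \<sqsubseteq>\<^bsub>B\<^esub> c"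
      using cover_below[OF a1(1) c(1)] cover_below[OF a2(1) c(1)] c(3) by metis+
    moreover have cB: "c \<in> carrier B" using c(2) by (simp add: covers_iff)
    ultimately have "g c \<subseteq> g a" using int g_le[OF a1(1) cB] g_le[OF a2(1) cB] by blast
    then have "a \<sqsubseteq>\<^bsub>B\<^esub> c" using g_le[OF c(1) cB] by blast
    then show False using c antisym unfolding covers_iff by blast
  qed
  ultimately show ?thesis unfolding slim_def by blast
qed

end

lemma filter_model_slim_semimodular:
  assumes "nontrivial_quasiplanar Q" "planar_diagram B" "filter_model Q B g"
  shows "slim_semimodular_diagram B"
proof -
  interpret Q: nontrivial_quasiplanar Q by fact
  interpret filter_lattice Q B g
    using assms by unfold_locales (auto simp: planar_diagram_def)
  show ?thesis using assms(2) lattice carrier_nonempty slim semimodular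
    by (simp add: slim_semimodular_diagram_def planar_lattice_diagram_def)
qed

lemma filter_diagrams_similar:
  assumes "filter_diagram Q B g" "filter_diagram Q B' g'" "hasse_diagram B" "hasse_diagram B'"
  shows "similar B B'"
proof -
  have wpo: "weak_partial_order B" "weak_partial_order B'"
    using assms(3,4) hasse.weak_order hasse.intro by blast+
  define \<psi> where "\<psi> a = inv_into (carrier B') g' (g a)" for a
  have g: "bij_betw g (carrier B) (Collect (hco_filter Q))" and g': "bij_betw g' (carrier B') (Collect (hco_filter Q))"
    using assms by (auto simp: filter_diagram_def filter_model_def)
  have "bij_betw \<psi> (carrier B) (carrier B')"
    using bij_betw_trans[OF g bij_betw_inv_into[OF g']] by (simp add: \<psi>_def[abs_def] comp_def)
  moreover have "\<psi> a \<in> carrier B'" "g' (\<psi> a) = g a" if "a \<in> carrier B" for a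
  proof -
    have "g a \<in> g' ` carrier B'" using that g g' by (auto simp: bij_betw_def)
    then show "\<psi> a \<in> carrier B'" "g' (\<psi> a) = g a"
      unfolding \<psi>_def by (rule inv_into_into, rule f_inv_into_f)
  qed
  ultimately show ?thesis
    using assms(1,2) wpo unfolding similar_def filter_diagram_def filter_model_def order_emb_def
    by (intro exI[of _ \<psi>]) simp
qed

section \<open>Drawing the lattice of filters\<close>

context quasiplanar_diagram
begin

definition rank1 :: "'a \<Rightarrow> real" where
  "rank1 x = real (card {z \<in> carrier D. le1 D z x})"

definition rank2 :: "'a \<Rightarrow> real" where
  "rank2 x = real (card {z \<in> carrier D. le2 D z x})"

lemma rank1_le_iff:
  assumes "x \<in> carrier D" "y \<in> carrier D"
  shows "rank1 x \<le> rank1 y \<longleftrightarrow> le1 D x y"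
proof
  assume le: "le1 D x y"
  have "{z \<in> carrier D. le1 D z x} \<subseteq> {z \<in> carrier D. le1 D z y}"
    using le1_trans[OF _ le _ assms] by blast
  then show "rank1 x \<le> rank1 y" unfolding rank1_def using fin by (simp add: card_mono)
next
  assume r: "rank1 x \<le> rank1 y"
  show "le1 D x y"
  proof (rule ccontr)
    assume n: "\<not> le1 D x y"
    then have le: "le1 D y x" using le1_total[OF assms] by blast
    have "{z \<in> carrier D. le1 D z y} \<subset> {z \<in> carrier D. le1 D z x}"
      using le1_trans[OF _ le _ assms(2,1)] n le1_refl[OF assms(1)] assms(1) by blast
    then have "rank1 y < rank1 x" unfolding rank1_def using fin by (simp add: psubset_card_mono)
    then show False using r by simp
  qed
qed

lemma rank2_le_iff:
  assumes "x \<in> carrier D" "y \<in> carrier D"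
  shows "rank2 x \<le> rank2 y \<longleftrightarrow> le2 D x y"
  using quasiplanar_diagram.rank1_le_iff[OF mirror_diagram, of x y] assms
  unfolding quasiplanar_diagram.rank1_def[OF mirror_diagram] rank2_def le1_mirror mirror_simps .

lemma rank1_less_iff:
  assumes "x \<in> carrier D" "y \<in> carrier D"
  shows "rank1 x < rank1 y \<longleftrightarrow> le1 D x y \<and> x \<noteq> y"
  using rank1_le_iff[OF assms] rank1_le_iff[OF assms(2,1)] le1_antisym le1_refl le1_total assms
  by (metis linorder_not_le)

lemma rank2_less_iff:
  assumes "x \<in> carrier D" "y \<in> carrier D"
  shows "rank2 x < rank2 y \<longleftrightarrow> le2 D x y \<and> x \<noteq> y"
  using rank2_le_iff[OF assms] rank2_le_iff[OF assms(2,1)] le2_antisym le2_refl le2_total assms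
  by (metis linorder_not_le)

end

context nontrivial_quasiplanar
begin

lemma finite_hco: "finite (Collect (hco_filter D))"
proof (rule finite_subset)
  show "Collect (hco_filter D) \<subseteq> Pow (nonzero D)" using hco_subset by blast
  show "finite (Pow (nonzero D))" using finite_nonzero by simp
qed

lemma Min_rank_quadrant:
  assumes e: "(x, y) \<in> E_set D"
  shows "Min (rank1 ` quadrant D x y) = rank1 x" "Min (rank2 ` quadrant D x y) = rank2 y"
proof -
  have f: "finite (quadrant D x y)" unfolding quadrant_def using finite_nonzero by simp
  show "Min (rank1 ` quadrant D x y) = rank1 x"
  proof (rule Min_eqI)
    fix r assume "r \<in> rank1 ` quadrant D x y"
    then obtain q where q: "q \<in> quadrant D x y" "r = rank1 q" by blast
    have "q \<in> carrier D" "le1 D x q" using q(1) nonzero_carrier by (simp_all add: quadrant_def)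
    then show "rank1 x \<le> r" using rank1_le_iff E_set_carrier[OF e] q(2) by simp
  qed (use f quadrant_mem[OF e] in blast)+
  show "Min (rank2 ` quadrant D x y) = rank2 y"
  proof (rule Min_eqI)
    fix r assume "r \<in> rank2 ` quadrant D x y"
    then obtain q where q: "q \<in> quadrant D x y" "r = rank2 q" by blast
    have "q \<in> carrier D" "le2 D y q" using q(1) nonzero_carrier by (simp_all add: quadrant_def)
    then show "rank2 y \<le> r" using rank2_le_iff E_set_carrier[OF e] q(2) by simp
  qed (use f quadrant_mem[OF e] in blast)+
qed

text \<open>
  The coordinates of a filter are the rank of its least element in the first order and the rank of
  its least element in the second.
\<close>

lemma draw_filters:
  fixes g :: "'b \<Rightarrow> 'a set"
  assumes bij: "bij_betw g P (Collect (hco_filter D))"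
  obtains B where "carrier B = P" "planar_diagram B" "quasiplanar B" "filter_diagram D B g"
proof -
  define f where "f a = (Min (rank1 ` g a), Min (rank2 ` g a))" for a
  have quadrant: "\<exists>x y. (x, y) \<in> E_set D \<and> g a = quadrant D x y \<and> f a = (rank1 x, rank2 y)" if "a \<in> P" for a
  proof -
    have "hco_filter D (g a)" using bij that by (auto simp: bij_betw_def)
    then obtain x y where e: "(x, y) \<in> E_set D" "g a = quadrant D x y" using hco_quadrant by metis
    then show ?thesis using Min_rank_quadrant[OF e(1)] unfolding f_def by auto
  qed
  have le: "fst (f a) \<le> fst (f b) \<and> snd (f a) \<le> snd (f b) \<longleftrightarrow> g b \<subseteq> g a"
    and less: "fst (f a) < fst (f b) \<and> snd (f b) < snd (f a) \<longleftrightarrow> filter_left D (g a) (g b)"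
    if ab: "a \<in> P" "b \<in> P" for a b
  proof -
    obtain x y where a: "(x, y) \<in> E_set D" "g a = quadrant D x y" "f a = (rank1 x, rank2 y)" using quadrant[OF ab(1)] by blast
    obtain x' y' where b: "(x', y') \<in> E_set D" "g b = quadrant D x' y'" "f b = (rank1 x', rank2 y')" using quadrant[OF ab(2)] by blast
    note car = E_set_carrier[OF a(1)] E_set_carrier[OF b(1)]
    show "fst (f a) \<le> fst (f b) \<and> snd (f a) \<le> snd (f b) \<longleftrightarrow> g b \<subseteq> g a"
      unfolding a b quadrant_subset_iff[OF b(1) a(1)] fst_conv snd_conv
      by (simp only: rank1_le_iff[OF car(1,3)] rank2_le_iff[OF car(2,4)])
    show "fst (f a) < fst (f b) \<and> snd (f b) < snd (f a) \<longleftrightarrow> filter_left D (g a) (g b)"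
      unfolding a b filter_left_quadrant[OF a(1) b(1)] fst_conv snd_conv
      by (auto simp only: rank1_less_iff[OF car(1,3)] rank2_less_iff[OF car(4,2)])
  qed
  have fP: "finite P" using bij_betw_finite[OF bij] finite_hco by blast
  have inj: "inj_on f P"
  proof (rule inj_onI)
    fix a b assume ab: "a \<in> P" "b \<in> P" "f a = f b"
    then have "g a = g b" using le[OF ab(1,2)] le[OF ab(2,1)] by auto
    then show "a = b" using bij ab by (auto simp: bij_betw_def inj_on_def)
  qed
  have model: "filter_model D (grid P f) g"
    using bij le by (simp add: filter_model_def)
  interpret G: filter_lattice D "grid P f" g
    by unfold_locales (rule grid_hasse[OF fP inj], rule model)
  have bd: "bounded_diagram (grid P f)"
    by (rule lattice_bounded[OF G.hasse G.lattice G.carrier_nonempty])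
  have "filter_diagram D (grid P f) g"
    unfolding filter_diagram_def using model grid_quasiplanar(2)[OF fP inj bd] less by simp
  then show ?thesis
    using that[of "grid P f"] grid_planar[OF fP inj G.lattice] grid_quasiplanar(1)[OF fP inj bd] by simp
qed

section \<open>The construction by pairs\<close>

lemma E_order_iff:
  assumes "(x1, y1) \<in> E_set D" "(x2, y2) \<in> E_set D"
  shows "(x1 \<sqsubseteq> x2 \<or> left_of D x1 x2) \<and> (y1 \<sqsubseteq> y2 \<or> left_of D y2 y1) \<longleftrightarrow> quadrant D x2 y2 \<subseteq> quadrant D x1 y1"
  unfolding quadrant_subset_iff[OF assms(2,1)] by (simp add: le1_def le2_def)

lemma E_left_iff:
  assumes "(x1, y1) \<in> E_set D" "(x2, y2) \<in> E_set D"
  shows "(x1 \<sqsubset> x2 \<or> left_of D x1 x2) \<and> (y2 \<sqsubset> y1 \<or> left_of D y1 y2) \<longleftrightarrow>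
    filter_left D (quadrant D x1 y1) (quadrant D x2 y2)"
  unfolding filter_left_quadrant[OF assms] lless_iff le1_def le2_def using left_of_irrefl by blast

lemma is_beta1_iff:
  "is_beta1 D B \<longleftrightarrow> planar_diagram B \<and> carrier B = E_set D \<and> filter_diagram D B (\<lambda>(x, y). quadrant D x y)"
proof -
  have "(\<forall>(x1, y1) \<in> E_set D. \<forall>(x2, y2) \<in> E_set D.
        (x1, y1) \<sqsubseteq>\<^bsub>B\<^esub> (x2, y2) \<longleftrightarrow> (x1 \<sqsubseteq> x2 \<or> left_of D x1 x2) \<and> (y1 \<sqsubseteq> y2 \<or> left_of D y2 y1)) \<longleftrightarrow>
      (\<forall>a\<in>E_set D. \<forall>b\<in>E_set D. a \<sqsubseteq>\<^bsub>B\<^esub> b \<longleftrightarrow> (case b of (x, y) \<Rightarrow> quadrant D x y) \<subseteq> (case a of (x, y) \<Rightarrow> quadrant D x y))"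
    by (rule ball_cong[OF HOL.refl], clarify, rule ball_cong[OF HOL.refl], clarify)
      (simp only: prod.case E_order_iff)
  moreover have "(\<forall>(x1, y1) \<in> E_set D. \<forall>(x2, y2) \<in> E_set D.
        left_of B (x1, y1) (x2, y2) \<longleftrightarrow> (x1 \<sqsubset> x2 \<or> left_of D x1 x2) \<and> (y2 \<sqsubset> y1 \<or> left_of D y1 y2)) \<longleftrightarrow>
      (\<forall>a\<in>E_set D. \<forall>b\<in>E_set D. left_of B a b \<longleftrightarrow>
        filter_left D (case a of (x, y) \<Rightarrow> quadrant D x y) (case b of (x, y) \<Rightarrow> quadrant D x y))"
    by (rule ball_cong[OF HOL.refl], clarify, rule ball_cong[OF HOL.refl], clarify)
      (simp only: prod.case E_left_iff)
  ultimately have *: "carrier B = E_set D \<Longrightarrow> ?thesis"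
    unfolding is_beta1_def filter_diagram_def filter_model_def by (simp only: bij_quadrant simp_thms)
  show ?thesis
  proof (cases "carrier B = E_set D")
    case False
    then have "\<not> is_beta1 D B" unfolding is_beta1_def by blast
    then show ?thesis using False by blast
  qed (rule *)
qed

lemma beta1_exists: "\<exists>B. is_beta1 D B"
  using draw_filters[OF bij_quadrant] is_beta1_iff by metis

section \<open>The construction by filters\<close>

text \<open>
  Among the elements that are still missing, the leftmost maximal one is the greatest in the second
  order. So the sets \<open>F\<^sub>n\<close> are exactly the final segments of the second order.
\<close>

lemma final_segment_step:
  assumes F: "F \<subseteq> nonzero D" "\<And>p q. p \<in> F \<Longrightarrow> q \<in> nonzero D \<Longrightarrow> le2 D p q \<Longrightarrow> q \<in> F"
    and ne: "nonzero D - F \<noteq> {}"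
  defines "m \<equiv> leftmost D (maximal_elements D (carrier D - F))"
  shows "m \<in> nonzero D - F" "\<And>q. q \<in> nonzero D \<Longrightarrow> le2 D m q \<Longrightarrow> q \<in> insert m F"
proof -
  let ?R = "carrier D - F"
  have R: "?R \<subseteq> carrier D" "?R \<noteq> {}" using ne nonzero_carrier by blast+
  obtain k where k: "k \<in> ?R" "\<forall>y\<in>?R. le2 D y k" using greatest2[OF R] by blast
  have kmax: "k \<in> maximal_elements D ?R"
  proof -
    have "y = k" if y: "y \<in> ?R" "k \<sqsubseteq> y" for y
    proof -
      have "le2 D k y" using y(2) by (simp add: le2_def)
      moreover have "le2 D y k" using k(2) y(1) by blast
      ultimately show ?thesis using le2_antisym[of y k] y(1) k(1) by blast
    qed
    then show ?thesis unfolding maximal_elements_def using k(1) by blast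
  qed
  have left: "left_of D k y" if "y \<in> maximal_elements D ?R" "y \<noteq> k" for y
  proof -
    have y: "y \<in> ?R" "\<not> y \<sqsubseteq> k" using that k(1) unfolding maximal_elements_def by blast+
    have "le2 D y k" using k(2) y(1) by blast
    then show ?thesis using y(2) by (simp add: le2_def)
  qed
  have "m = k" unfolding m_def leftmost_def
  proof (rule the_equality)
    show "k \<in> maximal_elements D ?R \<and> (\<forall>y\<in>maximal_elements D ?R. y \<noteq> k \<longrightarrow> left_of D k y)"
      using kmax left by blast
    show "x = k" if "x \<in> maximal_elements D ?R \<and> (\<forall>y\<in>maximal_elements D ?R. y \<noteq> x \<longrightarrow> left_of D x y)" for x
    proof (rule ccontr)
      assume ne: "x \<noteq> k"
      then have "left_of D k x" using left[of x] that by blast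
      moreover have "left_of D x k" using that kmax not_sym[OF ne] by blast
      ultimately show False using left_of_asym by blast
    qed
  qed
  obtain r where r: "r \<in> nonzero D" "r \<in> ?R" using ne nonzero_carrier by blast
  have "k \<noteq> \<bottom>"
  proof
    assume "k = \<bottom>"
    then have "le2 D r \<bottom>" "le2 D \<bottom> r" using k(2) r bot(2) by (auto simp: le2_def)
    then show False using le2_antisym r bot(1) nonzero_iff by blast
  qed
  then show "m \<in> nonzero D - F" using k(1) \<open>m = k\<close> nonzero_iff by blast
  show "q \<in> insert m F" if q: "q \<in> nonzero D" "le2 D m q" for q
  proof (rule ccontr)
    assume n: "q \<notin> insert m F"
    then have "le2 D q k" using k(2) nonzero_carrier[OF q(1)] by blast
    then have "q = k" using le2_antisym[of q k] q(2) \<open>m = k\<close> k(1) nonzero_carrier[OF q(1)] by blast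
    then show False using n \<open>m = k\<close> by blast
  qed
qed

lemma F_seq_segment:
  "n < card (nonzero D) \<Longrightarrow> F_seq D n \<subseteq> nonzero D \<and> card (F_seq D n) = Suc n \<and>
     (\<forall>p\<in>F_seq D n. \<forall>q\<in>nonzero D. le2 D p q \<longrightarrow> q \<in> F_seq D n)"
proof (induction n)
  case 0
  have "q = \<top>" if "q \<in> nonzero D" "le2 D \<top> q" for q
  proof -
    have "le2 D q \<top>" using top(2) that nonzero_carrier by (simp add: le2_def)
    then show ?thesis using le2_antisym that top(1) nonzero_carrier by blast
  qed
  then show ?case using top_nonzero by auto
next
  case (Suc n)
  let ?F = "F_seq D n"
  have IH: "?F \<subseteq> nonzero D" "card ?F = Suc n" "\<forall>p\<in>?F. \<forall>q\<in>nonzero D. le2 D p q \<longrightarrow> q \<in> ?F"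
    using Suc by auto
  have "?F \<noteq> nonzero D" using IH(2) Suc.prems by auto
  then have ne: "nonzero D - ?F \<noteq> {}" using IH(1) by blast
  let ?m = "leftmost D (maximal_elements D (carrier D - ?F))"
  have F: "F_seq D (Suc n) = insert ?m ?F" using ne by simp
  have m: "?m \<in> nonzero D - ?F" "\<And>q. q \<in> nonzero D \<Longrightarrow> le2 D ?m q \<Longrightarrow> q \<in> insert ?m ?F"
    using final_segment_step[OF IH(1) _ ne] IH(3) by blast+
  have "finite ?F" using IH(1) finite_nonzero finite_subset by blast
  then have "card (insert ?m ?F) = Suc (Suc n)" using m(1) IH(2) by simp
  moreover have "insert ?m ?F \<subseteq> nonzero D" using m(1) IH(1) by blast
  moreover have "\<forall>p\<in>insert ?m ?F. \<forall>q\<in>nonzero D. le2 D p q \<longrightarrow> q \<in> insert ?m ?F"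
    using m(2) IH(3) by blast
  ultimately show ?case unfolding F by blast
qed

definition seg2 :: "'a \<Rightarrow> 'a set" where
  "seg2 y = {q \<in> nonzero D. le2 D y q}"

lemma seg2_hco: "y \<in> nonzero D \<Longrightarrow> hco_filter D (seg2 y)"
proof -
  assume y: "y \<in> nonzero D"
  obtain x0 where x0: "x0 \<in> nonzero D" "\<forall>q\<in>nonzero D. le1 D x0 q"
    using least1[of "nonzero D"] nonzero_nonempty by blast
  have "seg2 y = quadrant D x0 y" using x0(2) by (auto simp: seg2_def quadrant_def)
  then show ?thesis using quadrant_hco[OF x0(1) y] by simp
qed

lemma seg2_nested:
  assumes "y \<in> nonzero D" "z \<in> nonzero D"
  shows "seg2 y \<subseteq> seg2 z \<or> seg2 z \<subseteq> seg2 y"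
proof -
  note car = nonzero_carrier[OF assms(1)] nonzero_carrier[OF assms(2)]
  have "seg2 b \<subseteq> seg2 a" if "le2 D a b" "a \<in> carrier D" "b \<in> carrier D" for a b
    using le2_trans[OF that(1) _ that(2,3)] nonzero_carrier unfolding seg2_def by blast
  then show ?thesis using le2_total[OF car] car by blast
qed

lemma F_seq_range: "F_seq D ` {..card (carrier D) - 2} = seg2 ` nonzero D"
proof -
  have c: "n \<le> card (carrier D) - 2 \<longleftrightarrow> n < card (nonzero D)" for n
    using card_nonzero card_ge2 by auto
  have seg: "\<exists>y\<in>nonzero D. S = seg2 y"
    if S: "S \<subseteq> nonzero D" "S \<noteq> {}" "\<forall>p\<in>S. \<forall>q\<in>nonzero D. le2 D p q \<longrightarrow> q \<in> S" for S
  proof -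
    obtain y where y: "y \<in> S" "\<forall>q\<in>S. le2 D y q" using least2[OF S(1,2)] by blast
    then have "S = seg2 y" using S(1,3) unfolding seg2_def by blast
    then show ?thesis using y S(1) by blast
  qed
  have "F_seq D n \<in> seg2 ` nonzero D" if "n < card (nonzero D)" for n
  proof -
    note F = F_seq_segment[OF that]
    have "F_seq D n \<noteq> {}" using F by auto
    then show ?thesis using seg[OF conjunct1[OF F] _ conjunct2[OF conjunct2[OF F]]] by blast
  qed
  moreover have "seg2 y \<in> F_seq D ` {..<card (nonzero D)}" if y: "y \<in> nonzero D" for y
  proof -
    have S: "seg2 y \<subseteq> nonzero D" "seg2 y \<noteq> {}"
      using hco_subset[OF seg2_hco[OF y]] hco_nonempty[OF seg2_hco[OF y]] by blast+
    have fS: "finite (seg2 y)" using S(1) finite_nonzero finite_subset by blast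
    define k where "k = card (seg2 y) - 1"
    have k: "card (seg2 y) = Suc k" using S(2) fS by (simp add: k_def card_gt_0_iff)
    have "card (seg2 y) \<le> card (nonzero D)" using card_mono[OF finite_nonzero S(1)] .
    then have kN: "k < card (nonzero D)" using k by simp
    note F = F_seq_segment[OF kN]
    have "F_seq D k \<noteq> {}" using F by auto
    then obtain z where z: "z \<in> nonzero D" "F_seq D k = seg2 z"
      using seg[OF conjunct1[OF F] _ conjunct2[OF conjunct2[OF F]]] by blast
    have "seg2 y \<subseteq> seg2 z \<or> seg2 z \<subseteq> seg2 y" by (rule seg2_nested[OF y z(1)])
    moreover have "finite (seg2 z)" "card (seg2 z) = card (seg2 y)"
      using conjunct1[OF F] conjunct1[OF conjunct2[OF F]] z(2) k finite_subset[OF _ finite_nonzero] by simp_all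
    ultimately have "seg2 y = seg2 z" using card_subset_eq fS by metis
    then show ?thesis using z kN by auto
  qed
  moreover have "{..card (carrier D) - 2} = {..<card (nonzero D)}" using c by blast
  ultimately show ?thesis by auto
qed

lemma quadrant_seg2: "(x, y) \<in> E_set D \<Longrightarrow> quadrant D x y \<subseteq> seg2 y"
  by (auto simp: quadrant_def seg2_def)

end

lemma filter_diagram_mirror:
  assumes "quasiplanar_diagram Q" "quasiplanar_diagram B" "filter_diagram Q B g"
  shows "filter_diagram (mirror Q) (mirror B) g"
proof -
  interpret Q: quasiplanar_diagram Q by fact
  interpret B: quasiplanar_diagram B by fact
  have "filter_left (mirror Q) X Y \<longleftrightarrow> filter_left Q Y X" for X Y
    unfolding filter_left_def Q.le1_mirror Q.le2_mirror by blast
  then show ?thesis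
    using assms(3) unfolding filter_diagram_def filter_model_def Q.hco_filter_mirror
      B.mirror_left_of_converse mirror_simps by blast
qed

text \<open>
  The final segments of the second order form a chain. It is maximal: if a filter \<open>Z\<close> is not the
  final segment that starts at its least element, then that segment has an element \<open>q\<close> outside of
  \<open>Z\<close>, and the final segment starting at \<open>q\<close> is incomparable to \<open>Z\<close>. It is the leftmost maximal
  chain because a filter on the left of a final segment would be contained in it.
\<close>

lemma filters_left_boundary:
  assumes "nontrivial_quasiplanar Q" "quasiplanar_diagram B" "filter_diagram Q B (\<lambda>X. X)"
  shows "left_boundary_chain B (F_seq Q ` {..card (carrier Q) - 2})"
proof -
  interpret Q: nontrivial_quasiplanar Q by fact
  interpret B: quasiplanar_diagram B by fact
  interpret M: filter_lattice Q B "\<lambda>X. X"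
    using assms(3) by unfold_locales (simp add: filter_diagram_def)
  let ?L = "Q.seg2 ` nonzero Q"
  have mem: "X \<in> carrier B \<longleftrightarrow> hco_filter Q X" for X
    using M.g_hco M.g_surj by metis
  have seg: "Q.seg2 y \<in> carrier B" if "y \<in> nonzero Q" for y using Q.seg2_hco[OF that] mem by blast
  have chain: "chain_in B ?L" unfolding chain_in_def
  proof (intro conjI ballI)
    fix X Y assume "X \<in> ?L" "Y \<in> ?L"
    then obtain y z where yz: "y \<in> nonzero Q" "X = Q.seg2 y" "z \<in> nonzero Q" "Y = Q.seg2 z" by blast
    have "X \<subseteq> Y \<or> Y \<subseteq> X" unfolding yz(2,4) by (rule Q.seg2_nested[OF yz(1,3)])
    then show "X \<sqsubseteq>\<^bsub>B\<^esub> Y \<or> Y \<sqsubseteq>\<^bsub>B\<^esub> X" using M.g_le seg yz by blast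
  qed (use seg in blast)
  have "Z \<in> ?L" if Z: "Z \<in> carrier B" "\<And>X. X \<in> ?L \<Longrightarrow> X \<subseteq> Z \<or> Z \<subseteq> X" for Z
  proof -
    obtain x y where e: "(x, y) \<in> E_set Q" "x \<in> Z" "y \<in> Z" "Z = quadrant Q x y"
      using Q.hco_quadrant Z(1) mem by metis
    have y: "y \<in> nonzero Q" using e(1) by (simp add: Q.E_set_iff)
    have "q \<in> Z" if q: "q \<in> Q.seg2 y" for q
    proof (rule ccontr)
      assume n: "q \<notin> Z"
      have qN: "q \<in> nonzero Q" "le2 Q y q" using q by (auto simp: Q.seg2_def)
      have "q \<in> Q.seg2 q" using qN Q.le2_refl Q.nonzero_carrier by (auto simp: Q.seg2_def)
      then have "Z \<subseteq> Q.seg2 q" using Z(2)[of "Q.seg2 q"] qN n by blast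
      then have "le2 Q q y" using e(3) by (auto simp: Q.seg2_def)
      then have "q = y" using Q.le2_antisym qN y Q.nonzero_carrier by blast
      then show False using n e(3) by simp
    qed
    then have "Z = Q.seg2 y" using Q.quadrant_seg2[OF e(1)] e(4) by blast
    then show ?thesis using y by blast
  qed
  note complete = this
  have "C' = ?L" if C': "chain_in B C'" "?L \<subseteq> C'" for C'
  proof (intro equalityI subsetI that(2)[THEN subsetD])
    fix Z assume Z: "Z \<in> C'"
    have ZB: "Z \<in> carrier B" using C'(1) Z unfolding chain_in_def by blast
    show "Z \<in> ?L"
    proof (rule complete[OF ZB])
      fix X assume X: "X \<in> ?L"
      have XB: "X \<in> carrier B" using X seg by blast
      have "X \<sqsubseteq>\<^bsub>B\<^esub> Z \<or> Z \<sqsubseteq>\<^bsub>B\<^esub> X" using C' X Z unfolding chain_in_def by blast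
      then show "X \<subseteq> Z \<or> Z \<subseteq> X" using M.g_le[OF XB ZB] M.g_le[OF ZB XB] by blast
    qed
  qed
  then have max: "maximal_chain B ?L"
    unfolding maximal_chain_def using chain by blast
  have "left_of_chain B X C" if C: "maximal_chain B C" and X: "X \<in> ?L" for X C
  proof (cases "X \<in> C")
    case True then show ?thesis by (simp add: left_of_chain_def)
  next
    case False
    obtain y where y: "y \<in> nonzero Q" "X = Q.seg2 y" using X by blast
    have XB: "X \<in> carrier B" using y seg by blast
    obtain Z where Z: "Z \<in> C" "\<not> X \<sqsubseteq>\<^bsub>B\<^esub> Z" "\<not> Z \<sqsubseteq>\<^bsub>B\<^esub> X" using B.mc_maximal[OF C XB] False by blast
    have ZB: "Z \<in> carrier B" using B.mc_carrier[OF C Z(1)] .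
    have i: "incomparable B X Z" using Z XB ZB by (simp add: incomparable_def)
    have "\<not> left_of B Z X"
    proof
      assume "left_of B Z X"
      then have "filter_left Q Z X" using assms(3) XB ZB by (simp add: filter_diagram_def)
      then obtain q where q: "q \<in> X" "\<forall>z\<in>Z. le2 Q q z" unfolding filter_left_def by blast
      have "z \<in> X" if "z \<in> Z" for z
      proof -
        have "z \<in> nonzero Q" using Q.hco_subset ZB mem that by blast
        then show ?thesis using q that y Q.le2_trans[of y q z] Q.nonzero_carrier by (auto simp: Q.seg2_def)
      qed
      then show False using Z(2) M.g_le[OF XB ZB] by blast
    qed
    then have "left_of B X Z" using B.left_of_total[OF i] by blast
    then show ?thesis using B.left_of_iff_path_x[OF i C Z(1)] B.left_iff[OF C XB] by blast
  qed
  then show ?thesis unfolding Q.F_seq_range left_boundary_chain_def using max by blast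
qed

lemma beta2_exists:
  assumes "nontrivial_quasiplanar Q"
  shows "\<exists>B. is_beta2 Q B"
proof -
  interpret Q: nontrivial_quasiplanar Q by fact
  have "bij_betw (\<lambda>X. X) (Collect (hco_filter Q)) (Collect (hco_filter Q))" by (simp add: bij_betw_def)
  then obtain B where B: "carrier B = Collect (hco_filter Q)" "planar_diagram B" "quasiplanar B" "filter_diagram Q B (\<lambda>X. X)"
    by (rule Q.draw_filters)
  have BQ: "quasiplanar_diagram B" by (rule quasiplanar_diagramI[OF B(3)])
  have "slim_semimodular_diagram B"
    using filter_model_slim_semimodular[OF assms B(2)] B(4) by (auto simp: filter_diagram_def)
  moreover have "left_boundary_chain B (F_seq Q ` {..card (carrier Q) - 2})"
    by (rule filters_left_boundary[OF assms BQ B(4)])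
  moreover have "left_boundary_chain (mirror B) (F_seq (mirror Q) ` {..card (carrier (mirror Q)) - 2})"
    by (intro filters_left_boundary nontrivial_mirror assms filter_diagram_mirror Q.quasiplanar_diagram_axioms
        BQ B(4) quasiplanar_diagram.mirror_diagram[OF BQ])
  ultimately have "is_beta2 Q B"
    using B unfolding is_beta2_def mirror_left_boundary_chain mirror_F_seq mirror_simps
    by (simp add: slim_semimodular_diagram_def filter_diagram_def filter_model_def)
  then show ?thesis by blast
qed

text \<open>
  The left boundary chain determines \<open>\<lambda>\<close>. Let \<open>X\<close> and \<open>Y\<close> be incomparable filters, where the least
  element of \<open>X\<close> in the second order comes after that of \<open>Y\<close>, and let \<open>F\<close> be the final segment with
  the same least element as \<open>X\<close>. Then \<open>F\<close> is on the boundary, below \<open>X\<close>, and incomparable to \<open>Y\<close>.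
  So \<open>F \<lambda> Y\<close>. In the second order of the diagram \<open>B\<close>, therefore, \<open>Y\<close> precedes \<open>F\<close> and \<open>F\<close> precedes
  \<open>X\<close>, which leaves only \<open>X \<lambda> Y\<close>.
\<close>

lemma beta2_filter_diagram:
  assumes "nontrivial_quasiplanar Q" "is_beta2 Q B"
  shows "filter_diagram Q B (\<lambda>X. X)"
proof -
  interpret Q: nontrivial_quasiplanar Q by fact
  interpret B: quasiplanar_diagram B
    using assms(2) by (simp add: is_beta2_def planar_lattice_quasiplanar)
  have mem: "X \<in> carrier B \<longleftrightarrow> hco_filter Q X" for X using assms(2) by (simp add: is_beta2_def)
  have le: "X \<sqsubseteq>\<^bsub>B\<^esub> Y \<longleftrightarrow> Y \<subseteq> X" if "X \<in> carrier B" "Y \<in> carrier B" for X Y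
    using assms(2) that by (simp add: is_beta2_def)
  have bd: "left_boundary_chain B (Q.seg2 ` nonzero Q)"
    using assms(2) Q.F_seq_range by (simp add: is_beta2_def)
  have forward: "left_of B X Y" if XY: "X \<in> carrier B" "Y \<in> carrier B" and l: "filter_left Q X Y" for X Y
  proof -
    obtain x1 y1 where X: "(x1, y1) \<in> E_set Q" "X = quadrant Q x1 y1" using Q.hco_quadrant XY(1) mem by metis
    obtain x2 y2 where Y: "(x2, y2) \<in> E_set Q" "Y = quadrant Q x2 y2" using Q.hco_quadrant XY(2) mem by metis
    note car = Q.E_set_carrier[OF X(1)] Q.E_set_carrier[OF Y(1)]
    have yy: "le2 Q y2 y1" "y1 \<noteq> y2" using l Q.filter_left_quadrant[OF X(1) Y(1)] X Y by auto
    have N: "y1 \<in> nonzero Q" using X(1) by (simp add: Q.E_set_iff)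
    let ?F = "Q.seg2 y1"
    have FB: "?F \<in> carrier B" using mem Q.seg2_hco[OF N] by blast
    have XF: "X \<subseteq> ?F" using Q.quadrant_seg2[OF X(1)] X(2) by simp
    have "\<not> le2 Q y1 y2" using yy Q.le2_antisym car by blast
    then have "\<not> Y \<subseteq> ?F" using Q.quadrant_mem(2)[OF Y(1)] Y(2) by (auto simp: Q.seg2_def)
    moreover have "\<not> ?F \<subseteq> Y" using XF Q.filter_left_not_subset[OF l] by blast
    ultimately have i: "incomparable B ?F Y" using le FB XY by (simp add: incomparable_def)
    obtain C where C: "maximal_chain B C" "Y \<in> C" by (rule B.mc_through[OF XY(2)])
    have "left_of_chain B ?F C" using bd C N unfolding left_boundary_chain_def by blast
    then have "left_of B ?F Y" using i C unfolding left_of_def by blast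
    then have "le2 B Y ?F" by (simp add: le2_def)
    moreover have "le2 B ?F X" using le[OF FB XY(1)] XF by (simp add: le2_def)
    ultimately have "le2 B Y X" using B.le2_trans XY FB by blast
    moreover have "\<not> Y \<sqsubseteq>\<^bsub>B\<^esub> X" using le XY Q.filter_left_not_subset[OF l] by blast
    ultimately show ?thesis by (simp add: le2_def)
  qed
  have "left_of B X Y \<longleftrightarrow> filter_left Q X Y" if XY: "X \<in> carrier B" "Y \<in> carrier B" for X Y
  proof
    assume l: "left_of B X Y"
    then have "\<not> X \<subseteq> Y" "\<not> Y \<subseteq> X" using B.left_of_incomparable[OF l] le XY by blast+
    then have "filter_left Q X Y \<or> filter_left Q Y X" using Q.filter_left_total XY mem by blast
    then show "filter_left Q X Y" using forward XY l B.left_of_asym by blast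
  qed (rule forward[OF XY])
  then show ?thesis
    unfolding filter_diagram_def filter_model_def using mem le by (simp add: bij_betw_def set_eq_iff)
qed

section \<open>Meet-irreducible filters\<close>

context filter_lattice
begin

lemma bounded_B: "bounded_diagram B"
  by (rule lattice_bounded[OF hasse lattice carrier_nonempty])

lemma diagonal_E: "x \<in> nonzero Q \<Longrightarrow> (x, x) \<in> E_set Q"
  using Q.le1_refl Q.le2_refl Q.nonzero_carrier by (simp add: Q.E_set_iff)

lemma quadrant_diagonal:
  assumes x: "x \<in> nonzero Q"
  shows "q \<in> quadrant Q x x \<longleftrightarrow> q \<in> carrier Q \<and> x \<sqsubseteq>\<^bsub>Q\<^esub> q"
  using Q.le_iff[OF Q.nonzero_carrier[OF x], of q] Q.above_nonzero[OF x, of q] Q.nonzero_carrier[of q]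
  unfolding quadrant_def by blast

lemma g_top: "g \<top>\<^bsub>B\<^esub> = quadrant Q \<top>\<^bsub>Q\<^esub> \<top>\<^bsub>Q\<^esub>"
proof -
  interpret BB: bounded_hasse B using bounded_B by unfold_locales
  have hco: "hco_filter Q (quadrant Q \<top>\<^bsub>Q\<^esub> \<top>\<^bsub>Q\<^esub>)" by (rule Q.quadrant_hco[OF Q.top_nonzero Q.top_nonzero])
  obtain t where t: "t \<in> carrier B" "g t = quadrant Q \<top>\<^bsub>Q\<^esub> \<top>\<^bsub>Q\<^esub>" by (rule g_surj[OF hco])
  have "quadrant Q \<top>\<^bsub>Q\<^esub> \<top>\<^bsub>Q\<^esub> \<subseteq> g a" if "a \<in> carrier B" for a
  proof
    fix q assume "q \<in> quadrant Q \<top>\<^bsub>Q\<^esub> \<top>\<^bsub>Q\<^esub>"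
    then have "q \<in> carrier Q" "\<top>\<^bsub>Q\<^esub> \<sqsubseteq>\<^bsub>Q\<^esub> q" using quadrant_diagonal[OF Q.top_nonzero] by blast+
    then show "q \<in> g a" using Q.hco_up[OF g_hco[OF that] Q.hco_top[OF g_hco[OF that]]] by blast
  qed
  then have "\<top>\<^bsub>B\<^esub> \<sqsubseteq>\<^bsub>B\<^esub> t" using g_le[OF BB.top(1) t(1)] t(2) BB.top(1) by blast
  then have "\<top>\<^bsub>B\<^esub> = t" using antisym BB.top t(1) by blast
  then show ?thesis using t by simp
qed

text \<open>
  If the least elements of a filter in the two orders are different, then each of them can be
  removed, which gives two upper covers. From a principal filter only the generator can be removed,
  and the result is a filter unless the generator is the greatest element.
\<close>

lemma meet_irreducible_iff:
  assumes b: "b \<in> carrier B"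
  shows "b \<in> insert \<top>\<^bsub>B\<^esub> (meet_irreducibles B) \<longleftrightarrow> (\<exists>x\<in>nonzero Q. g b = quadrant Q x x)"
proof -
  interpret BB: bounded_hasse B using bounded_B by unfold_locales
  show ?thesis
  proof
    assume mi: "b \<in> insert \<top>\<^bsub>B\<^esub> (meet_irreducibles B)"
    show "\<exists>x\<in>nonzero Q. g b = quadrant Q x x"
    proof (cases "b = \<top>\<^bsub>B\<^esub>")
      case True then show ?thesis using g_top Q.top_nonzero by blast
    next
      case False
      obtain u where u: "\<And>c. covers B b c \<Longrightarrow> c = u"
        using mi False unfolding meet_irreducibles_def by blast
      have cov: "g u = g b - {p}" if p: "p \<in> g b" "hco_filter Q (g b - {p})" for p
      proof -
        obtain c where c: "c \<in> carrier B" "g c = g b - {p}" by (rule g_surj[OF p(2)])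
        then show ?thesis using u[OF remove_point_covers[OF b c(1) p(1) c(2)]] by simp
      qed
      obtain x y where e: "(x, y) \<in> E_set Q" "x \<in> g b" "y \<in> g b" "g b = quadrant Q x y" by (rule Q.hco_quadrant[OF g_hco[OF b]])
      have "x = y"
      proof (rule ccontr)
        assume ne: "x \<noteq> y"
        then have "g b \<noteq> {x}" "g b \<noteq> {y}" using e by auto
        then have "hco_filter Q (g b - {x})" "hco_filter Q (g b - {y})"
          using Q.hco_remove_least1[OF g_hco[OF b] e(2)] Q.hco_remove_least2[OF g_hco[OF b] e(3)]
            Q.hco_quadrant_least[OF e(1)] e(4) by blast+
        then have "g b - {x} = g b - {y}" using cov e(2,3) by metis
        then show False using ne e(2) by blast
      qed
      then show ?thesis using e by (auto simp: Q.E_set_iff)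
    qed
  next
    assume "\<exists>x\<in>nonzero Q. g b = quadrant Q x x"
    then obtain x where x: "x \<in> nonzero Q" "g b = quadrant Q x x" by blast
    show "b \<in> insert \<top>\<^bsub>B\<^esub> (meet_irreducibles B)"
    proof (cases "x = \<top>\<^bsub>Q\<^esub>")
      case True
      then have "b = \<top>\<^bsub>B\<^esub>" using g_inj[OF b BB.top(1)] g_top x by simp
      then show ?thesis by blast
    next
      case False
      have xg: "x \<in> g b" using Q.quadrant_mem[OF diagonal_E[OF x(1)]] x(2) by simp
      have "\<top>\<^bsub>Q\<^esub> \<in> g b" using Q.hco_top[OF g_hco[OF b]] .
      then have "g b \<noteq> {x}" using False by auto
      then have "hco_filter Q (g b - {x})"
        using Q.hco_remove_least1[OF g_hco[OF b] xg] Q.hco_quadrant_least[OF diagonal_E[OF x(1)]] x(2) by blast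
      then obtain c where c: "c \<in> carrier B" "g c = g b - {x}" by (rule g_surj)
      have "c' = c" if c': "covers B b c'" for c'
      proof -
        have c'B: "c' \<in> carrier B" using c' by (simp add: covers_iff)
        obtain p where p: "p \<in> g b" "g c' = g b - {p}" using covers_remove_point[OF c'] by blast
        have "p = x"
        proof (rule ccontr)
          assume "p \<noteq> x"
          then have "x \<in> g c'" using p xg by blast
          moreover have "p \<in> carrier Q" "x \<sqsubseteq>\<^bsub>Q\<^esub> p" using p(1) x quadrant_diagonal by auto
          ultimately have "p \<in> g c'" using Q.hco_up[OF g_hco[OF c'B]] by blast
          then show False using p by simp
        qed
        then show ?thesis using g_inj[OF c'B c(1)] p c by simp
      qed
      then have "\<exists>!c. covers B b c" using remove_point_covers[OF b c(1) xg c(2)] by blast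
      then show ?thesis using b by (simp add: meet_irreducibles_def)
    qed
  qed
qed

end

lemma alpha_similar:
  assumes Q: "nontrivial_quasiplanar Q" and BQ: "quasiplanar_diagram B" and m: "filter_diagram Q B g" and al: "is_alpha B A"
  shows "similar A Q"
proof -
  interpret Q: nontrivial_quasiplanar Q by fact
  interpret BB: quasiplanar_diagram B by fact
  interpret A: quasiplanar_diagram A using al by (simp add: is_alpha_def quasiplanar_diagramI)
  interpret M: filter_lattice Q B g using m by unfold_locales (simp add: filter_diagram_def)
  let ?M = "insert \<top>\<^bsub>B\<^esub> (meet_irreducibles B)"
  have MB: "b \<in> carrier B" if "b \<in> ?M" for b using that BB.top(1) by (auto simp: meet_irreducibles_def)
  have carA: "carrier A = insert None (Some ` ?M)" using al by (simp add: is_alpha_def)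
  have leA: "u \<sqsubseteq>\<^bsub>A\<^esub> v \<longleftrightarrow> u = None \<or> (\<exists>a b. u = Some a \<and> v = Some b \<and> a \<sqsubseteq>\<^bsub>B\<^esub> b)"
    if "u \<in> carrier A" "v \<in> carrier A" for u v using al that unfolding is_alpha_def by blast
  have "\<forall>b\<in>?M. \<exists>x. x \<in> nonzero Q \<and> g b = quadrant Q x x" using M.meet_irreducible_iff MB by blast
  then obtain k where k: "\<And>b. b \<in> ?M \<Longrightarrow> k b \<in> nonzero Q" "\<And>b. b \<in> ?M \<Longrightarrow> g b = quadrant Q (k b) (k b)"
    by metis
  have klower: "a \<sqsubseteq>\<^bsub>B\<^esub> b \<longleftrightarrow> k a \<sqsubseteq>\<^bsub>Q\<^esub> k b" if "a \<in> ?M" "b \<in> ?M" for a b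
    unfolding M.g_le[OF MB MB, OF that] k(2)[OF that(1)] k(2)[OF that(2)]
      Q.quadrant_subset_iff[OF M.diagonal_E M.diagonal_E, OF k(1) k(1), OF that(2,1)]
    using Q.le_iff[OF Q.nonzero_carrier[OF k(1)[OF that(1)]] Q.nonzero_carrier[OF k(1)[OF that(2)]]] by blast
  have kleft: "left_of B a b \<longleftrightarrow> left_of Q (k a) (k b)" if "a \<in> ?M" "b \<in> ?M" for a b
  proof -
    have "left_of B a b \<longleftrightarrow> filter_left Q (g a) (g b)" using m MB that by (simp add: filter_diagram_def)
    then show ?thesis
      unfolding k(2)[OF that(1)] k(2)[OF that(2)]
        Q.filter_left_quadrant[OF M.diagonal_E M.diagonal_E, OF k(1) k(1), OF that]
      using Q.left_of_iff[OF Q.nonzero_carrier[OF k(1)[OF that(1)]] Q.nonzero_carrier[OF k(1)[OF that(2)]]] by blast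
  qed
  define \<psi> where "\<psi> u = (case u of None \<Rightarrow> \<bottom>\<^bsub>Q\<^esub> | Some b \<Rightarrow> k b)" for u
  have psi: "\<psi> None = \<bottom>\<^bsub>Q\<^esub>" "\<psi> (Some b) = k b" for b by (simp_all add: \<psi>_def)
  have inj: "inj_on k ?M"
  proof (rule inj_onI)
    fix a b assume ab: "a \<in> ?M" "b \<in> ?M" "k a = k b"
    then have "g a = g b" using k(2) by metis
    then show "a = b" using M.g_inj[OF MB[OF ab(1)] MB[OF ab(2)]] by blast
  qed
  have surj: "k ` ?M = nonzero Q"
  proof (intro equalityI subsetI)
    fix x assume x: "x \<in> nonzero Q"
    obtain b where b: "b \<in> carrier B" "g b = quadrant Q x x" by (rule M.g_surj[OF Q.quadrant_hco[OF x x]])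
    then have bM: "b \<in> ?M" using M.meet_irreducible_iff x by blast
    then have eq: "quadrant Q x x = quadrant Q (k b) (k b)" using k(2) b by metis
    have "le1 Q (k b) x" "le1 Q x (k b)"
      using Q.quadrant_subset_iff[OF M.diagonal_E M.diagonal_E, OF x k(1)[OF bM]]
        Q.quadrant_subset_iff[OF M.diagonal_E M.diagonal_E, OF k(1)[OF bM] x] eq by blast+
    then have "x = k b"
      using Q.le1_antisym[OF _ _ Q.nonzero_carrier[OF x] Q.nonzero_carrier[OF k(1)[OF bM]]] by blast
    then show "x \<in> k ` ?M" using bM by blast
  qed (use k(1) in blast)
  have "bij_betw \<psi> (carrier A) (carrier Q)"
    unfolding bij_betw_def
  proof
    show "inj_on \<psi> (carrier A)"
    proof (rule inj_onI)
      fix u v assume uv: "u \<in> carrier A" "v \<in> carrier A" "\<psi> u = \<psi> v"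
      then show "u = v"
        using k(1) Q.nonzero_iff inj unfolding carA by (cases u; cases v) (auto simp: psi inj_on_def)
    qed
    have "\<psi> ` carrier A = insert \<bottom>\<^bsub>Q\<^esub> (k ` ?M)" unfolding carA image_insert image_image psi ..
    then show "\<psi> ` carrier A = carrier Q" unfolding surj using Q.bot(1) by (auto simp: nonzero_def)
  qed
  moreover have "\<psi> u \<sqsubseteq>\<^bsub>Q\<^esub> \<psi> v \<longleftrightarrow> u \<sqsubseteq>\<^bsub>A\<^esub> v" if uv: "u \<in> carrier A" "v \<in> carrier A" for u v
  proof (cases u)
    case None
    have "\<psi> v \<in> carrier Q" using uv(2) k(1) Q.nonzero_carrier Q.bot(1) unfolding carA by (auto simp: psi)
    then show ?thesis using None Q.bot(2) leA[OF uv] by (simp add: psi)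
  next
    case (Some a)
    then have a: "a \<in> ?M" using uv carA by auto
    show ?thesis
    proof (cases v)
      case None
      have "\<not> k a \<sqsubseteq>\<^bsub>Q\<^esub> \<bottom>\<^bsub>Q\<^esub>" using Q.antisym[of "k a" "\<bottom>\<^bsub>Q\<^esub>"] Q.bot k(1)[OF a] Q.nonzero_iff by blast
      then show ?thesis using None Some leA[OF uv] by (simp add: psi)
    next
      case (Some b)
      then have b: "b \<in> ?M" using uv carA by auto
      show ?thesis unfolding leA[OF uv] using klower[OF a b] Some \<open>u = Some a\<close> by (simp add: psi)
    qed
  qed
  moreover have "left_of A u v \<longleftrightarrow> left_of Q (\<psi> u) (\<psi> v)" if uv: "u \<in> carrier A" "v \<in> carrier A" for u v
  proof -
    have n: "left_of A u v \<Longrightarrow> u \<noteq> None \<and> v \<noteq> None"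
      using A.left_of_incomparable[of u v] leA[OF uv] leA[OF uv(2,1)] by auto
    have nQ: "left_of Q (\<psi> u) (\<psi> v) \<Longrightarrow> u \<noteq> None \<and> v \<noteq> None"
      using Q.left_of_nonzero[of "\<psi> u" "\<psi> v"] Q.nonzero_iff by (cases u; cases v) (auto simp: psi)
    have "left_of A (Some a) (Some b) \<longleftrightarrow> left_of Q (k a) (k b)" if ab: "Some a \<in> carrier A" "Some b \<in> carrier A" for a b
    proof -
      have M: "a \<in> ?M" "b \<in> ?M" using ab unfolding carA by auto
      have inc: "incomparable A (Some a) (Some b) \<longleftrightarrow> incomparable B a b"
        unfolding incomparable_def using ab MB[OF M(1)] MB[OF M(2)] leA[OF ab] leA[OF ab(2,1)] by auto
      show ?thesis
      proof (cases "incomparable B a b")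
        case True
        then have "left_of A (Some a) (Some b) \<longleftrightarrow> left_of B a b" using al inc unfolding is_alpha_def by blast
        then show ?thesis using kleft[OF M] by simp
      next
        case False
        then show ?thesis using inc kleft[OF M] by (auto simp: left_of_def)
      qed
    qed
    then show ?thesis using n nQ uv by (cases u; cases v) (auto simp: psi)
  qed
  ultimately show ?thesis
    unfolding similar_def order_emb_def using A.weak_order Q.weak_order by blast
qed

section \<open>Slim semimodular lattices\<close>

locale slim_semimodular_lattice = bounded_hasse +
  assumes lat: "lattice D" and slm: "slim D" and semi: "semimodular D"
begin

lemma semilattices: "weak_lower_semilattice D" "weak_upper_semilattice D"
proof -
  interpret L: lattice D by (rule lat)
  show "weak_lower_semilattice D" "weak_upper_semilattice D" by unfold_locales
qed

lemmas meet = weak_lower_semilattice.meet_closed[OF semilattices(1)]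
    weak_lower_semilattice.meet_left[OF semilattices(1)]
    weak_lower_semilattice.meet_right[OF semilattices(1)]
    weak_lower_semilattice.meet_le[OF semilattices(1)]
  and join = weak_upper_semilattice.join_closed[OF semilattices(2)]
    weak_upper_semilattice.join_left[OF semilattices(2)]
    weak_upper_semilattice.join_right[OF semilattices(2)]
    weak_upper_semilattice.join_le[OF semilattices(2)]

text \<open>
  A minimal element \<open>j\<close> among those below \<open>x\<close> but not below \<open>y\<close> has all its lower covers below \<open>y\<close>. If
  there were two of them, then \<open>j\<close> would be their join, and hence below \<open>y\<close>.
\<close>

lemma join_irreducible_below:
  assumes "x \<in> carrier D" "y \<in> carrier D" "\<not> x \<sqsubseteq> y"
  obtains j where "j \<in> join_irreducibles D - {\<bottom>}" "j \<in> carrier D" "j \<sqsubseteq> x" "\<not> j \<sqsubseteq> y"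
proof -
  let ?S = "{z \<in> carrier D. z \<sqsubseteq> x \<and> \<not> z \<sqsubseteq> y}"
  have S: "?S \<subseteq> carrier D" "?S \<noteq> {}" using assms refl by blast+
  obtain j where j: "j \<in> ?S" "\<forall>c\<in>?S. c \<sqsubseteq> j \<longrightarrow> c = j" using minimal_element[OF S] by blast
  have jc: "j \<in> carrier D" "j \<sqsubseteq> x" "\<not> j \<sqsubseteq> y" using j(1) by blast+
  have jb: "j \<noteq> \<bottom>" using jc(3) bot(2)[OF assms(2)] by blast
  obtain c where c: "covers D c j" by (rule cover_below[OF bot(1) jc(1) bot(2)[OF jc(1)] jb[symmetric]])
  have below: "d \<sqsubseteq> y" if "covers D d j" for d
  proof (rule ccontr)
    assume n: "\<not> d \<sqsubseteq> y"
    have d: "d \<in> carrier D" "d \<sqsubseteq> j" "d \<noteq> j" using that by (simp_all add: covers_iff)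
    have "d \<sqsubseteq> x" by (rule trans[OF d(2) jc(2) d(1) jc(1) assms(1)])
    then show False using j(2) d n by blast
  qed
  have "d = c" if d: "covers D d j" for d
  proof (rule ccontr)
    assume ne: "d \<noteq> c"
    have car: "c \<in> carrier D" "d \<in> carrier D" "c \<sqsubseteq> j" "d \<sqsubseteq> j" "c \<noteq> j" "d \<noteq> j"
      using c d by (simp_all add: covers_iff)
    have s: "c \<squnion> d \<in> carrier D" "c \<sqsubseteq> c \<squnion> d" "d \<sqsubseteq> c \<squnion> d" "c \<squnion> d \<sqsubseteq> j"
      using join(1-3)[OF car(1,2)] join(4)[OF car(3,4,1,2) jc(1)] by blast+
    have "c \<squnion> d = c \<or> c \<squnion> d = j" "c \<squnion> d = d \<or> c \<squnion> d = j"
      using c d s unfolding covers_iff by blast+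
    then have "c \<squnion> d = j" using ne by auto
    moreover have "c \<squnion> d \<sqsubseteq> y" by (rule join(4)[OF below[OF c] below[OF d] car(1,2) assms(2)])
    ultimately show False using jc(3) by simp
  qed
  then have "j \<in> join_irreducibles D" using c jc(1) unfolding join_irreducibles_def by blast
  then show ?thesis using that[of j] jb jc by blast
qed

text \<open>
  This is dual to \<open>join_irreducible_below\<close>. It says that each element is the meet of the
  meet-irreducible elements above it.
\<close>

lemma meet_irreducible_above:
  assumes "x \<in> carrier D" "y \<in> carrier D" "\<not> x \<sqsubseteq> y"
  obtains m where "m \<in> meet_irreducibles D" "m \<in> carrier D" "y \<sqsubseteq> m" "\<not> x \<sqsubseteq> m"
proof -
  let ?S = "{z \<in> carrier D. y \<sqsubseteq> z \<and> \<not> x \<sqsubseteq> z}"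
  have S: "?S \<subseteq> carrier D" "?S \<noteq> {}" using assms refl by blast+
  obtain m where m: "m \<in> ?S" "\<forall>c\<in>?S. m \<sqsubseteq> c \<longrightarrow> c = m" using maximal_element[OF S] by blast
  have mc: "m \<in> carrier D" "y \<sqsubseteq> m" "\<not> x \<sqsubseteq> m" using m(1) by blast+
  have mt: "m \<noteq> \<top>" using mc(3) top(2)[OF assms(1)] by blast
  obtain c where c: "covers D m c" by (rule cover_above[OF mc(1) top(1) top(2)[OF mc(1)] mt])
  have above: "x \<sqsubseteq> d" if "covers D m d" for d
  proof (rule ccontr)
    assume n: "\<not> x \<sqsubseteq> d"
    have d: "d \<in> carrier D" "m \<sqsubseteq> d" "d \<noteq> m" using that by (auto simp: covers_iff)
    have "y \<sqsubseteq> d" by (rule trans[OF mc(2) d(2) assms(2) mc(1) d(1)])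
    then show False using m(2) d n by blast
  qed
  have "d = c" if d: "covers D m d" for d
  proof (rule ccontr)
    assume ne: "d \<noteq> c"
    have car: "c \<in> carrier D" "d \<in> carrier D" "m \<sqsubseteq> c" "m \<sqsubseteq> d" "m \<noteq> c" "m \<noteq> d"
      using c d by (simp_all add: covers_iff)
    have s: "c \<sqinter> d \<in> carrier D" "c \<sqinter> d \<sqsubseteq> c" "c \<sqinter> d \<sqsubseteq> d" "m \<sqsubseteq> c \<sqinter> d"
      using meet(1-3)[OF car(1,2)] meet(4)[OF car(3,4,1,2) mc(1)] by blast+
    have "c \<sqinter> d = c \<or> c \<sqinter> d = m" "c \<sqinter> d = d \<or> c \<sqinter> d = m"
      using c d s unfolding covers_iff by blast+
    then have "c \<sqinter> d = m" using ne by auto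
    moreover have "x \<sqsubseteq> c \<sqinter> d" by (rule meet(4)[OF above[OF c] above[OF d] car(1,2) assms(1)])
    ultimately show False using mc(3) by simp
  qed
  then have "m \<in> meet_irreducibles D" using c mc(1) unfolding meet_irreducibles_def by blast
  then show ?thesis using that[of m] mc by blast
qed

text \<open>
  Suppose that \<open>a\<close> and \<open>m\<close> are incomparable. Choose join-irreducible elements \<open>p\<close> below \<open>a\<close> but not
  below \<open>m\<close>, then \<open>q\<close> below \<open>m\<close> but not below \<open>a\<close>, and \<open>j\<close> below \<open>c\<close> but not below \<open>d\<close>. By slimness two
  of the three lie in a common chain, but each of the six ways of being comparable contradicts
  these choices.
\<close>

lemma equal_meets_comparable:
  assumes car: "a \<in> carrier D" "m \<in> carrier D" "c \<in> carrier D"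
    and d: "a \<sqinter> c = d" "m \<sqinter> c = d" "\<not> c \<sqsubseteq> d"
  shows "a \<sqsubseteq> m \<or> m \<sqsubseteq> a"
proof (rule ccontr)
  assume n: "\<not> ?thesis"
  have dc: "d \<in> carrier D" "d \<sqsubseteq> a" "d \<sqsubseteq> m"
    using meet(1,2)[OF car(1,3)] meet(2)[OF car(2,3)] d by simp_all
  obtain p where p: "p \<in> join_irreducibles D - {\<bottom>}" "p \<in> carrier D" "p \<sqsubseteq> a" "\<not> p \<sqsubseteq> m"
    using join_irreducible_below[OF car(1,2)] n by blast
  obtain q where q: "q \<in> join_irreducibles D - {\<bottom>}" "q \<in> carrier D" "q \<sqsubseteq> m" "\<not> q \<sqsubseteq> a"
    using join_irreducible_below[OF car(2,1)] n by blast
  obtain j where j: "j \<in> join_irreducibles D - {\<bottom>}" "j \<in> carrier D" "j \<sqsubseteq> c" "\<not> j \<sqsubseteq> d"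
    by (rule join_irreducible_below[OF car(3) dc(1) d(3)])
  have ja: "\<not> j \<sqsubseteq> a" "\<not> j \<sqsubseteq> m"
    using meet(4)[OF _ j(3) car(1,3) j(2)] meet(4)[OF _ j(3) car(2,3) j(2)] d j(4) by auto
  have pq: "\<not> p \<sqsubseteq> q" "\<not> q \<sqsubseteq> p"
    using trans[OF _ q(3) p(2) q(2) car(2)] trans[OF _ p(3) q(2) p(2) car(1)] p(4) q(4) by blast+
  have jp: "\<not> j \<sqsubseteq> p" "\<not> j \<sqsubseteq> q"
    using trans[OF _ p(3) j(2) p(2) car(1)] trans[OF _ q(3) j(2) q(2) car(2)] ja by blast+
  have pj: "\<not> p \<sqsubseteq> j"
  proof
    assume "p \<sqsubseteq> j"
    then have "p \<sqsubseteq> c" using trans[OF _ j(3) p(2) j(2) car(3)] by blast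
    then have "p \<sqsubseteq> d" using meet(4)[OF p(3) _ car(1,3) p(2)] d(1) by simp
    then show False using trans[OF _ dc(3) p(2) dc(1) car(2)] p(4) by blast
  qed
  have qj: "\<not> q \<sqsubseteq> j"
  proof
    assume "q \<sqsubseteq> j"
    then have "q \<sqsubseteq> c" using trans[OF _ j(3) q(2) j(2) car(3)] by blast
    then have "q \<sqsubseteq> d" using meet(4)[OF q(3) _ car(2,3) q(2)] d(2) by simp
    then show False using trans[OF _ dc(2) q(2) dc(1) car(1)] q(4) by blast
  qed
  obtain C1 C2 where C: "chain_in D C1" "chain_in D C2" "join_irreducibles D - {\<bottom>} \<subseteq> C1 \<union> C2"
    using slm unfolding slim_def by blast
  have same: "u \<sqsubseteq> v \<or> v \<sqsubseteq> u" if "u \<in> K" "v \<in> K" "chain_in D K" for u v K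
    using that unfolding chain_in_def by blast
  have "p \<in> C1 \<union> C2" "q \<in> C1 \<union> C2" "j \<in> C1 \<union> C2" using C(3) p(1) q(1) j(1) by blast+
  then show False using same[OF _ _ C(1)] same[OF _ _ C(2)] pq jp pj qj by blast
qed

text \<open>
  By semimodularity the join of \<open>c\<close> and \<open>a\<close> is the unique upper cover of \<open>a\<close>. So it is below every
  element that is strictly above \<open>a\<close>, and such an element is above \<open>c\<close>.
\<close>

lemma no_smaller_meet_irreducible:
  assumes a: "a \<in> meet_irreducibles D" and m: "m \<in> carrier D" and c: "covers D d c"
    and d: "d \<sqsubseteq> a" "\<not> c \<sqsubseteq> m" and le: "a \<sqsubseteq> m"
  shows "a = m"
proof (rule ccontr)
  assume ne: "a \<noteq> m"
  have car: "a \<in> carrier D" "d \<in> carrier D" "c \<in> carrier D"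
    using a c by (simp_all add: meet_irreducibles_def covers_iff)
  have ca: "\<not> c \<sqsubseteq> a" using trans[OF _ le car(3,1) m] d(2) by blast
  have "d \<squnion> a = a"
    using antisym[OF join(4)[OF d(1) refl[OF car(1)] car(2,1,1)] join(3)[OF car(2,1)] join(1)[OF car(2,1)] car(1)] .
  moreover have "c \<squnion> a \<noteq> a" using join(2)[OF car(3,1)] ca by metis
  ultimately have cov: "covers D a (c \<squnion> a)"
    using semi c car(1) unfolding semimodular_def by metis
  obtain e where e: "covers D a e" "e \<sqsubseteq> m" by (rule cover_above[OF car(1) m le ne])
  have "e = c \<squnion> a" using a cov e(1) unfolding meet_irreducibles_def by blast
  then have "c \<sqsubseteq> m" using trans[OF join(2)[OF car(3,1)] _ car(3) join(1)[OF car(3,1)] m] e(2) by blast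
  then show False using d(2) by blast
qed

text \<open>
  This is what is needed of the fact that in a slim semimodular lattice every element has a unique
  irredundant representation as a meet of meet-irreducible elements. Replacing \<open>b\<close> by a cover \<open>c\<close> of
  the common meet, one sees from slimness that \<open>a\<close> and \<open>m\<close> are comparable, and then from
  semimodularity that they are equal.
\<close>

lemma unique_meet_complement:
  assumes a: "a \<in> meet_irreducibles D" and m: "m \<in> meet_irreducibles D" and b: "b \<in> carrier D"
    and eq: "a \<sqinter> b = m \<sqinter> b" and ne: "a \<sqinter> b \<noteq> b"
  shows "a = m"
proof -
  have car: "a \<in> carrier D" "m \<in> carrier D" using a m by (simp_all add: meet_irreducibles_def)
  define d where "d = a \<sqinter> b"
  have d: "d \<in> carrier D" "d \<sqsubseteq> a" "d \<sqsubseteq> m" "d \<sqsubseteq> b" "d \<noteq> b"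
    unfolding d_def using meet(1-3)[OF car(1) b] meet(2)[OF car(2) b] eq ne by simp_all
  obtain c where c: "covers D d c" "c \<sqsubseteq> b" by (rule cover_above[OF d(1) b d(4,5)])
  have cc: "c \<in> carrier D" "d \<sqsubseteq> c" "\<not> c \<sqsubseteq> d" using c(1) antisym[of c d] by (auto simp: covers_iff)
  have nc: "\<not> c \<sqsubseteq> a" "\<not> c \<sqsubseteq> m"
    using meet(4)[OF _ c(2) car(1) b cc(1)] meet(4)[OF _ c(2) car(2) b cc(1)] eq cc(3) unfolding d_def by auto
  have "u \<sqinter> c = d" if u: "u \<in> carrier D" "u \<sqinter> b = d" for u
  proof (rule antisym[OF _ _ meet(1)[OF u(1) cc(1)] d(1)])
    have "u \<sqinter> c \<sqsubseteq> b" by (rule trans[OF meet(3)[OF u(1) cc(1)] c(2) meet(1)[OF u(1) cc(1)] cc(1) b])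
    then show "u \<sqinter> c \<sqsubseteq> d" using meet(4)[OF meet(2)[OF u(1) cc(1)] _ u(1) b meet(1)[OF u(1) cc(1)]] u(2) by simp
    have "d \<sqsubseteq> u" using meet(2)[OF u(1) b] u(2) by simp
    then show "d \<sqsubseteq> u \<sqinter> c" by (rule meet(4)[OF _ cc(2) u(1) cc(1) d(1)])
  qed
  then have "a \<sqinter> c = d" "m \<sqinter> c = d" using car eq d_def by simp_all
  then have "a \<sqsubseteq> m \<or> m \<sqsubseteq> a" using equal_meets_comparable[OF car cc(1)] cc(3) by blast
  then show ?thesis
    using no_smaller_meet_irreducible[OF a car(2) c(1) d(2) nc(2)]
      no_smaller_meet_irreducible[OF m car(1) c(1) d(3) nc(1)] by blast
qed

text \<open>
  The two hypotheses on meets say that \<open>a\<close> and \<open>m\<close> have the same meet with \<open>b\<close>. If \<open>a\<close> were not below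
  \<open>m\<close>, both would be meet-irreducible, and hence equal.
\<close>

lemma meet_irreducible_below_by_meets:
  assumes a: "a \<in> insert \<top> (meet_irreducibles D)" and m: "m \<in> insert \<top> (meet_irreducibles D)"
    and b: "b \<in> carrier D" "\<not> b \<sqsubseteq> a" and le: "a \<sqinter> b \<sqsubseteq> m" "m \<sqinter> b \<sqsubseteq> a"
  shows "a \<sqsubseteq> m"
proof (rule ccontr)
  assume n: "\<not> a \<sqsubseteq> m"
  have car: "a \<in> carrier D" "m \<in> carrier D" using a m top(1) by (auto simp: meet_irreducibles_def)
  have mi: "a \<in> meet_irreducibles D" "m \<in> meet_irreducibles D"
    using a m n b(2) top(2)[OF b(1)] top(2)[OF car(1)] by auto
  note ab = meet(1-3)[OF car(1) b(1)] and mb = meet(1-3)[OF car(2) b(1)]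
  have "a \<sqinter> b = m \<sqinter> b"
    by (rule antisym[OF meet(4)[OF le(1) ab(3) car(2) b(1) ab(1)] meet(4)[OF le(2) mb(3) car(1) b(1) mb(1)] ab(1) mb(1)])
  moreover have "a \<sqinter> b \<noteq> b" using ab(2) b(2) by metis
  ultimately have "a = m" by (rule unique_meet_complement[OF mi b(1)])
  then show False using n refl[OF car(1)] by simp
qed

end

section \<open>A slim semimodular diagram as the lattice of filters of its meet-irreducibles\<close>

lemma alpha_exists:
  assumes "planar_lattice_diagram D"
  shows "\<exists>A. is_alpha D A"
proof -
  interpret quasiplanar_diagram D by (rule planar_lattice_quasiplanar[OF assms])
  let ?M = "insert \<top>\<^bsub>D\<^esub> (meet_irreducibles D)"
  have MD: "m \<in> carrier D" if "m \<in> ?M" for m using that top(1) by (auto simp: meet_irreducibles_def)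
  let ?P = "insert None (Some ` ?M)"
  (* ranks are nonnegative, so (-1, -1) puts the new element below all the others *)
  define f where "f u = (case u of None \<Rightarrow> (-1, -1) | Some m \<Rightarrow> (rank1 m, rank2 m))" for u
  have f: "f None = (-1, -1)" "f (Some m) = (rank1 m, rank2 m)" for m by (simp_all add: f_def)
  have r: "0 \<le> rank1 m" "0 \<le> rank2 m" for m by (simp_all add: rank1_def rank2_def)
  let ?A = "grid ?P f"
  have "?M \<subseteq> carrier D" using MD by blast
  then have fP: "finite ?P" using fin finite_subset by blast
  have le: "Some a \<sqsubseteq>\<^bsub>?A\<^esub> Some b \<longleftrightarrow> a \<sqsubseteq>\<^bsub>D\<^esub> b" if "a \<in> ?M" "b \<in> ?M" for a b
    using le_iff[OF MD MD, OF that] rank1_le_iff[OF MD MD, OF that] rank2_le_iff[OF MD MD, OF that]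
    by (simp add: f)
  have leN: "None \<sqsubseteq>\<^bsub>?A\<^esub> u" "\<not> Some m \<sqsubseteq>\<^bsub>?A\<^esub> None" for u m
    using r[of m] r[of "the u"] by (cases u; simp add: f)+
  have inj: "inj_on f ?P"
  proof (rule inj_onI)
    fix u v assume uv: "u \<in> ?P" "v \<in> ?P" "f u = f v"
    then have "u \<sqsubseteq>\<^bsub>?A\<^esub> v" "v \<sqsubseteq>\<^bsub>?A\<^esub> u" by simp_all
    then show "u = v"
      using uv(1,2) le leN antisym MD by (cases u; cases v) (auto simp del: grid_simps)
  qed
  interpret A: hasse ?A using grid_hasse[OF fP inj] by unfold_locales
  have "Some \<top>\<^bsub>D\<^esub> \<in> ?P" "u \<sqsubseteq>\<^bsub>?A\<^esub> Some \<top>\<^bsub>D\<^esub>" if "u \<in> ?P" for u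
    using that le leN top(2) MD by (cases u; auto simp del: grid_simps)+
  then have bd: "bounded_diagram ?A"
    unfolding bounded_diagram_def weak_partial_order_bottom_def weak_partial_order_top_def
      weak_partial_order_bottom_axioms_def weak_partial_order_top_axioms_def least_def greatest_def
    using A.hasse A.weak_order leN(1) by auto
  note qp = grid_quasiplanar[OF fP inj bd]
  have "left_of ?A (Some a) (Some b) \<longleftrightarrow> left_of D a b" if "incomparable ?A (Some a) (Some b)" for a b
  proof -
    have M: "a \<in> ?M" "b \<in> ?M" using that by (auto simp: incomparable_def)
    note car = MD[OF M(1)] MD[OF M(2)]
    have "left_of ?A (Some a) (Some b) \<longleftrightarrow> rank1 a < rank1 b \<and> rank2 b < rank2 a"
      using qp(2)[of "Some a" "Some b"] M unfolding f fst_conv snd_conv by blast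
    then show ?thesis
      unfolding rank1_less_iff[OF car] rank2_less_iff[OF car(2,1)] left_of_iff[OF car] by blast
  qed
  moreover have "u \<sqsubseteq>\<^bsub>?A\<^esub> v \<longleftrightarrow> u = None \<or> (\<exists>a b. u = Some a \<and> v = Some b \<and> a \<sqsubseteq>\<^bsub>D\<^esub> b)"
    if "u \<in> ?P" "v \<in> ?P" for u v
    using that le leN by (cases u; cases v) (auto simp del: grid_simps)
  ultimately have "is_alpha D ?A" unfolding is_alpha_def using qp(1) by simp
  then show ?thesis by blast
qed

locale alpha_of = D: quasiplanar_diagram D + A: quasiplanar_diagram A
  for D :: "'a diagram" and A :: "'a option diagram" +
  assumes alpha: "is_alpha D A"
begin

abbreviation M :: "'a set" where "M \<equiv> insert \<top>\<^bsub>D\<^esub> (meet_irreducibles D)"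

lemma M_carrier: "m \<in> M \<Longrightarrow> m \<in> carrier D"
  using D.top(1) by (auto simp: meet_irreducibles_def)

lemma carrier_A: "carrier A = insert None (Some ` M)"
  using alpha by (simp add: is_alpha_def)

lemma Some_A: "m \<in> M \<Longrightarrow> Some m \<in> carrier A"
  by (simp only: carrier_A) blast

lemma le_A: "u \<in> carrier A \<Longrightarrow> v \<in> carrier A \<Longrightarrow>
    u \<sqsubseteq>\<^bsub>A\<^esub> v \<longleftrightarrow> u = None \<or> (\<exists>a b. u = Some a \<and> v = Some b \<and> a \<sqsubseteq>\<^bsub>D\<^esub> b)"
  using alpha unfolding is_alpha_def by blast

lemma le_A_Some: "a \<in> M \<Longrightarrow> b \<in> M \<Longrightarrow> Some a \<sqsubseteq>\<^bsub>A\<^esub> Some b \<longleftrightarrow> a \<sqsubseteq>\<^bsub>D\<^esub> b"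
  using le_A[OF Some_A Some_A] by simp

lemma left_A_Some:
  assumes "a \<in> M" "b \<in> M"
  shows "left_of A (Some a) (Some b) \<longleftrightarrow> left_of D a b"
proof -
  have i: "incomparable A (Some a) (Some b) \<longleftrightarrow> incomparable D a b"
    unfolding incomparable_def le_A_Some[OF assms] le_A_Some[OF assms(2,1)]
    using Some_A M_carrier assms by blast
  show ?thesis
  proof (cases "incomparable D a b")
    case True then show ?thesis using alpha i unfolding is_alpha_def by blast
  next
    case False then show ?thesis using i by (simp add: left_of_def)
  qed
qed

lemma le1_A_Some: "a \<in> M \<Longrightarrow> b \<in> M \<Longrightarrow> le1 A (Some a) (Some b) \<longleftrightarrow> le1 D a b"
  and le2_A_Some: "a \<in> M \<Longrightarrow> b \<in> M \<Longrightarrow> le2 A (Some a) (Some b) \<longleftrightarrow> le2 D a b"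
  by (simp_all only: le1_def le2_def le_A_Some left_A_Some)

lemma bot_A: "\<bottom>\<^bsub>A\<^esub> = None"
proof -
  have N: "None \<in> carrier A" by (simp add: carrier_A)
  show ?thesis using le_A[OF A.bot(1) N] A.bot(2)[OF N] by blast
qed

lemma nonzero_A: "nonzero A = Some ` M"
  unfolding nonzero_def bot_A carrier_A by blast

lemma nontrivial_A: "nontrivial_quasiplanar A"
proof unfold_locales
  have "{None, Some \<top>\<^bsub>D\<^esub>} \<subseteq> carrier A" using carrier_A by blast
  then have "card {None, Some \<top>\<^bsub>D\<^esub>} \<le> card (carrier A)" by (rule card_mono[OF A.fin])
  then show "2 \<le> card (carrier A)" by simp
qed

definition up :: "'a \<Rightarrow> 'a option set" where
  "up d = Some ` {m \<in> M. d \<sqsubseteq>\<^bsub>D\<^esub> m}"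

lemma Some_up: "Some m \<in> up d \<longleftrightarrow> m \<in> M \<and> d \<sqsubseteq>\<^bsub>D\<^esub> m"
  unfolding up_def by blast

lemma up_hco:
  assumes d: "d \<in> carrier D"
  shows "hco_filter A (up d)"
proof -
  interpret A': nontrivial_quasiplanar A by (rule nontrivial_A)
  show ?thesis
  proof (rule A'.hcoI)
    have "Some \<top>\<^bsub>D\<^esub> \<in> up d" unfolding Some_up using D.top(2)[OF d] by blast
    then show "up d \<noteq> {}" by blast
    show "up d \<subseteq> nonzero A" unfolding nonzero_A up_def by blast
    show "v \<in> up d" if uv: "u \<in> up d" "v \<in> carrier A" "u \<sqsubseteq>\<^bsub>A\<^esub> v" for u v
    proof -
      obtain a where a: "u = Some a" "a \<in> M" "d \<sqsubseteq>\<^bsub>D\<^esub> a" using uv(1) unfolding up_def by blast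
      obtain b where b: "v = Some b" "a \<sqsubseteq>\<^bsub>D\<^esub> b"
        using le_A[OF _ uv(2), of u] uv(3) Some_A[OF a(2)] a(1) by auto
      have bM: "b \<in> M" using uv(2) b(1) unfolding carrier_A by blast
      have "d \<sqsubseteq>\<^bsub>D\<^esub> b" by (rule D.trans[OF a(3) b(2) d M_carrier[OF a(2)] M_carrier[OF bM]])
      then show ?thesis using bM b(1) Some_up by simp
    qed
    show "v \<in> up d" if l: "left_of A u v" "left_of A v w" and uw: "u \<in> up d" "w \<in> up d" for u v w
    proof -
      obtain a where a: "u = Some a" "a \<in> M" "d \<sqsubseteq>\<^bsub>D\<^esub> a" using uw(1) unfolding up_def by blast
      obtain c where c: "w = Some c" "c \<in> M" "d \<sqsubseteq>\<^bsub>D\<^esub> c" using uw(2) unfolding up_def by blast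
      have "v \<in> nonzero A" by (rule A'.left_of_nonzero(2)[OF l(1)])
      then obtain b where b: "v = Some b" "b \<in> M" unfolding nonzero_A by blast
      note car = M_carrier[OF a(2)] M_carrier[OF b(2)] M_carrier[OF c(2)]
      have "left_of D a b" "left_of D b c"
        using l left_A_Some[OF a(2) b(2)] left_A_Some[OF b(2) c(2)] a(1) b(1) c(1) by simp_all
      then have "le1 D a b" "le2 D c b" by (simp_all add: le1_def le2_def)
      then have "le1 D d b" "le2 D d b"
        using D.le1_trans[of d a b] D.le2_trans[of d c b] a(3) c(3) d car by (simp_all add: le1_def le2_def)
      then have "d \<sqsubseteq>\<^bsub>D\<^esub> b" using D.le_iff[OF d car(2)] by blast
      then show ?thesis using b Some_up by simp
    qed
  qed
qed

end

locale alpha_of_slim_semimodular = alpha_of D A + L: slim_semimodular_lattice D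
  for D :: "'a diagram" and A :: "'a option diagram"
begin

sublocale A': nontrivial_quasiplanar A by (rule nontrivial_A)

lemma up_subset_iff:
  assumes "d \<in> carrier D" "e \<in> carrier D"
  shows "up e \<subseteq> up d \<longleftrightarrow> d \<sqsubseteq>\<^bsub>D\<^esub> e"
proof
  assume le: "d \<sqsubseteq>\<^bsub>D\<^esub> e"
  have "d \<sqsubseteq>\<^bsub>D\<^esub> m" if "m \<in> M" "e \<sqsubseteq>\<^bsub>D\<^esub> m" for m by (rule D.trans[OF le that(2) assms M_carrier[OF that(1)]])
  then show "up e \<subseteq> up d" unfolding up_def by blast
next
  assume sub: "up e \<subseteq> up d"
  show "d \<sqsubseteq>\<^bsub>D\<^esub> e"
  proof (rule ccontr)
    assume "\<not> d \<sqsubseteq>\<^bsub>D\<^esub> e"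
    then obtain m where m: "m \<in> meet_irreducibles D" "e \<sqsubseteq>\<^bsub>D\<^esub> m" "\<not> d \<sqsubseteq>\<^bsub>D\<^esub> m"
      using L.meet_irreducible_above[OF assms] by blast
    have "Some m \<in> up e" using m Some_up by blast
    then show False using sub m(3) Some_up by blast
  qed
qed

text \<open>
  Suppose that \<open>m\<close> strictly precedes \<open>a\<close> in the first order. Then the meet of \<open>m\<close> and \<open>b\<close> precedes \<open>a\<close>
  in both orders, so it is below \<open>a\<close>, and \<open>meet_irreducible_below_by_meets\<close> gives \<open>a \<le> m\<close>, a
  contradiction. The claim on the second order is symmetric.
\<close>

lemma above_meet_of_pair:
  assumes ab: "a \<in> M" "b \<in> M" "le1 D a b" "le2 D b a" and m: "m \<in> M" "a \<sqinter>\<^bsub>D\<^esub> b \<sqsubseteq>\<^bsub>D\<^esub> m"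
  shows "le1 D a m" "le2 D b m"
proof -
  note car = M_carrier[OF ab(1)] M_carrier[OF ab(2)] M_carrier[OF m(1)]
  let ?d = "a \<sqinter>\<^bsub>D\<^esub> b"
  have swap: "b \<sqinter>\<^bsub>D\<^esub> a = ?d" by (simp add: meet_def insert_commute)
  have d: "?d \<in> carrier D" using L.meet(1)[OF car(1,2)] .
  have same: "a \<sqsubseteq>\<^bsub>D\<^esub> m" if "a = b"
  proof -
    have "a \<sqsubseteq>\<^bsub>D\<^esub> ?d" using L.meet(4)[OF D.refl[OF car(1)] _ car(1,2,1)] D.refl[OF car(1)] that by simp
    then show ?thesis using D.trans[OF _ m(2) car(1) d car(3)] by blast
  qed
  show "le1 D a m"
  proof (rule ccontr)
    assume n: "\<not> le1 D a m"
    then have ma: "le1 D m a" and nam: "\<not> a \<sqsubseteq>\<^bsub>D\<^esub> m" using D.le1_total[OF car(1,3)] by (auto simp: le1_def)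
    have nba: "\<not> b \<sqsubseteq>\<^bsub>D\<^esub> a"
      using D.le_iff[OF car(2,1)] D.le1_antisym[OF ab(3) _ car(1,2)] same nam by blast
    let ?e = "m \<sqinter>\<^bsub>D\<^esub> b"
    have e: "?e \<in> carrier D" "?e \<sqsubseteq>\<^bsub>D\<^esub> m" "?e \<sqsubseteq>\<^bsub>D\<^esub> b" using L.meet(1-3)[OF car(3,2)] by blast+
    have "le1 D ?e a" using D.le1_trans[OF _ ma e(1) car(3,1)] e(2) by (simp add: le1_def)
    moreover have "le2 D ?e a" using D.le2_trans[OF _ ab(4) e(1) car(2,1)] e(3) by (simp add: le2_def)
    ultimately have "?e \<sqsubseteq>\<^bsub>D\<^esub> a" using D.le_iff[OF e(1) car(1)] by blast
    then show False using L.meet_irreducible_below_by_meets[OF ab(1) m(1) car(2) nba m(2)] nam by blast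
  qed
  show "le2 D b m"
  proof (rule ccontr)
    assume n: "\<not> le2 D b m"
    then have mb: "le2 D m b" and nbm: "\<not> b \<sqsubseteq>\<^bsub>D\<^esub> m" using D.le2_total[OF car(2,3)] by (auto simp: le2_def)
    have nab: "\<not> a \<sqsubseteq>\<^bsub>D\<^esub> b"
      using D.le_iff[OF car(1,2)] D.le2_antisym[OF ab(4) _ car(2,1)] same nbm by blast
    let ?e = "m \<sqinter>\<^bsub>D\<^esub> a"
    have e: "?e \<in> carrier D" "?e \<sqsubseteq>\<^bsub>D\<^esub> m" "?e \<sqsubseteq>\<^bsub>D\<^esub> a" using L.meet(1-3)[OF car(3,1)] by blast+
    have "le2 D ?e b" using D.le2_trans[OF _ mb e(1) car(3,2)] e(2) by (simp add: le2_def)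
    moreover have "le1 D ?e b" using D.le1_trans[OF _ ab(3) e(1) car(1,2)] e(3) by (simp add: le1_def)
    ultimately have "?e \<sqsubseteq>\<^bsub>D\<^esub> b" using D.le_iff[OF e(1) car(2)] by blast
    then show False
      using L.meet_irreducible_below_by_meets[OF ab(2) m(1) car(1) nab] m(2) swap nbm by simp
  qed
qed

text \<open>
  A filter belongs to a pair \<open>(a, b)\<close>; it is the set of all \<open>m\<close> above the meet of \<open>a\<close> and \<open>b\<close>.
\<close>

lemma up_surj:
  assumes X: "hco_filter A X"
  shows "X \<in> up ` carrier D"
proof -
  obtain x y where e: "(x, y) \<in> E_set A" "X = quadrant A x y" by (rule A'.hco_quadrant[OF X])
  obtain a b where ab: "x = Some a" "a \<in> M" "y = Some b" "b \<in> M"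
    using e(1) unfolding A'.E_set_iff nonzero_A by blast
  have l: "le1 D a b" "le2 D b a"
    using e(1) le1_A_Some[OF ab(2,4)] le2_A_Some[OF ab(4,2)] unfolding A'.E_set_iff ab(1,3) by blast+
  note car = M_carrier[OF ab(2)] M_carrier[OF ab(4)]
  let ?d = "a \<sqinter>\<^bsub>D\<^esub> b"
  have d: "?d \<in> carrier D" "?d \<sqsubseteq>\<^bsub>D\<^esub> a" "?d \<sqsubseteq>\<^bsub>D\<^esub> b" using L.meet(1-3)[OF car] by blast+
  have "Some m \<in> X \<longleftrightarrow> Some m \<in> up ?d" if m: "m \<in> M" for m
  proof -
    have "Some m \<in> X \<longleftrightarrow> le1 D a m \<and> le2 D b m"
      unfolding e(2) quadrant_def ab(1,3) nonzero_A using le1_A_Some[OF ab(2) m] le2_A_Some[OF ab(4) m] m by blast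
    moreover have "?d \<sqsubseteq>\<^bsub>D\<^esub> m" if "le1 D a m" "le2 D b m"
    proof -
      have "le1 D ?d m" "le2 D ?d m"
        using D.le1_trans[OF _ that(1) d(1) car(1) M_carrier[OF m]]
          D.le2_trans[OF _ that(2) d(1) car(2) M_carrier[OF m]] d(2,3) by (simp_all add: le1_def le2_def)
      then show ?thesis using D.le_iff[OF d(1) M_carrier[OF m]] by blast
    qed
    ultimately show ?thesis using above_meet_of_pair[OF ab(2,4) l m] Some_up m by blast
  qed
  moreover have "X \<subseteq> Some ` M" "up ?d \<subseteq> Some ` M"
    using A'.hco_subset[OF X] A'.hco_subset[OF up_hco[OF d(1)]] unfolding nonzero_A by blast+
  ultimately have "X = up ?d" by blast
  then show ?thesis using d(1) by blast
qed

text \<open>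
  Let \<open>a\<close> above \<open>d\<close> and \<open>b\<close> above \<open>e\<close> be the witnesses of \<open>filter_left\<close>. If \<open>e \<lambda> d\<close>, then \<open>a\<close> precedes
  \<open>b\<close> in both orders; hence \<open>d \<le> a \<le> b\<close>, although \<open>b\<close> is not above \<open>d\<close>.
\<close>

lemma up_left:
  assumes de: "d \<in> carrier D" "e \<in> carrier D" and l: "filter_left A (up d) (up e)"
  shows "left_of D d e"
proof -
  obtain x1 where x1: "x1 \<in> up d" "\<forall>y\<in>up e. le1 A x1 y \<and> x1 \<noteq> y" using l unfolding filter_left_def by blast
  obtain y2 where y2: "y2 \<in> up e" "\<forall>x\<in>up d. le2 A y2 x \<and> y2 \<noteq> x" using l unfolding filter_left_def by blast
  obtain a where a: "x1 = Some a" "a \<in> M" "d \<sqsubseteq>\<^bsub>D\<^esub> a" using x1(1) unfolding up_def by blast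
  obtain b where b: "y2 = Some b" "b \<in> M" "e \<sqsubseteq>\<^bsub>D\<^esub> b" using y2(1) unfolding up_def by blast
  note car = M_carrier[OF a(2)] M_carrier[OF b(2)]
  have inc: "\<not> d \<sqsubseteq>\<^bsub>D\<^esub> e" "\<not> e \<sqsubseteq>\<^bsub>D\<^esub> d"
    using A'.filter_left_not_subset[OF l] up_subset_iff[OF de] up_subset_iff[OF de(2,1)] by blast+
  have "\<not> left_of D e d"
  proof
    assume "left_of D e d"
    then have ed: "le1 D e d" "le2 D d e" by (simp_all add: le1_def le2_def)
    have "le1 D e a" using D.le1_trans[OF ed(1) _ de(2,1) car(1)] a(3) by (simp add: le1_def)
    moreover have "\<not> e \<sqsubseteq>\<^bsub>D\<^esub> a"
    proof
      assume "e \<sqsubseteq>\<^bsub>D\<^esub> a"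
      then have "x1 \<in> up e" using Some_up a by blast
      then show False using x1(2) by blast
    qed
    ultimately have "le2 D a e" using D.le_iff[OF de(2) car(1)] D.le2_total[OF de(2) car(1)] by blast
    then have "le2 D a b" using D.le2_trans[OF _ _ car(1) de(2) car(2)] b(3) by (simp add: le2_def)
    moreover have "le1 D a b" using x1(2) y2(1) le1_A_Some[OF a(2) b(2)] a(1) b(1) by blast
    ultimately have "a \<sqsubseteq>\<^bsub>D\<^esub> b" using D.le_iff[OF car] by blast
    then have "d \<sqsubseteq>\<^bsub>D\<^esub> b" by (rule D.trans[OF a(3) _ de(1) car])
    then have "y2 \<in> up d" using Some_up b by blast
    then show False using y2(2) by blast
  qed
  then show ?thesis using D.left_of_total[of d e] inc de by (simp add: incomparable_def)
qed

lemma up_filter_diagram: "filter_diagram A D up"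
proof -
  have inj: "inj_on up (carrier D)"
    using up_subset_iff D.antisym by (intro inj_onI) blast
  have "filter_model A D up"
    unfolding filter_model_def bij_betw_def using inj up_hco up_surj up_subset_iff by blast
  moreover have "left_of D d e \<longleftrightarrow> filter_left A (up d) (up e)" if de: "d \<in> carrier D" "e \<in> carrier D" for d e
  proof
    assume l: "left_of D d e"
    then have "\<not> up d \<subseteq> up e" "\<not> up e \<subseteq> up d"
      using up_subset_iff de D.left_of_incomparable by blast+
    then have "filter_left A (up d) (up e) \<or> filter_left A (up e) (up d)"
      using A'.filter_left_total up_hco de by blast
    then show "filter_left A (up d) (up e)" using up_left[OF de(2,1)] D.left_of_asym l by blast
  qed (rule up_left[OF de])
  ultimately show ?thesis unfolding filter_diagram_def by blast
qed

end

lemma alpha_filter_diagram: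
  assumes "slim_semimodular_diagram D" "is_alpha D A"
  shows "nontrivial_quasiplanar A" "\<exists>g. filter_diagram A D g"
proof -
  have pl: "planar_lattice_diagram D" using assms(1) by (simp add: slim_semimodular_diagram_def)
  have "quasiplanar_diagram D" by (rule planar_lattice_quasiplanar[OF pl])
  moreover have "quasiplanar_diagram A" using assms(2) by (simp add: is_alpha_def quasiplanar_diagramI)
  ultimately have "alpha_of D A" using assms(2) by (simp add: alpha_of_def alpha_of_axioms_def)
  moreover have "slim_semimodular_lattice D"
    using \<open>quasiplanar_diagram D\<close> assms(1) pl
    by (simp add: slim_semimodular_lattice_def slim_semimodular_lattice_axioms_def quasiplanar_diagram_def
        slim_semimodular_diagram_def planar_lattice_diagram_def)
  ultimately interpret alpha_of_slim_semimodular D A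
    by (simp add: alpha_of_slim_semimodular_def)
  show "nontrivial_quasiplanar A" "\<exists>g. filter_diagram A D g"
    using nontrivial_A up_filter_diagram by blast+
qed

section \<open>The correspondence\<close>

lemma filter_diagram_round_trip:
  assumes Q: "nontrivial_quasiplanar Q" and B: "filter_diagram Q B g" "planar_diagram B"
  shows "slim_semimodular_diagram B" "\<exists>A. is_alpha B A" "is_alpha B A \<Longrightarrow> similar A Q"
proof -
  show ss: "slim_semimodular_diagram B"
    using filter_model_slim_semimodular[OF Q B(2)] B(1) by (auto simp: filter_diagram_def)
  then have pl: "planar_lattice_diagram B" by (simp add: slim_semimodular_diagram_def)
  show "\<exists>A. is_alpha B A" by (rule alpha_exists[OF pl])
  show "is_alpha B A \<Longrightarrow> similar A Q" by (rule alpha_similar[OF Q planar_lattice_quasiplanar[OF pl] B(1)])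
qed

lemma alpha_round_trip:
  assumes D: "slim_semimodular_diagram D" and A: "is_alpha D A"
    and B: "filter_diagram A B g" "planar_diagram B"
  shows "similar B D"
proof -
  obtain g' where g': "filter_diagram A D g'" using alpha_filter_diagram(2)[OF D A] by blast
  have "hasse_diagram D" "hasse_diagram B"
    using D B(2) by (simp_all add: slim_semimodular_diagram_def planar_lattice_diagram_def planar_diagram_def)
  then show ?thesis using filter_diagrams_similar[OF B(1) g'] by blast
qed

lemma is_beta1_filter_diagram:
  assumes "nontrivial_quasiplanar Q" "is_beta1 Q B"
  shows "filter_diagram Q B (\<lambda>(x, y). quadrant Q x y)" "planar_diagram B"
  using nontrivial_quasiplanar.is_beta1_iff[OF assms(1)] assms(2) by blast+

lemma is_beta2_filter_diagram:
  assumes "nontrivial_quasiplanar Q" "is_beta2 Q B"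
  shows "filter_diagram Q B (\<lambda>X. X)" "planar_diagram B"
  using beta2_filter_diagram[OF assms] assms(2) by (simp_all add: is_beta2_def planar_lattice_diagram_def)

theorem theorem2p9:
  fixes D :: "'a diagram" and Q :: "'b diagram"
  assumes "slim_semimodular_diagram D"
    and "quasiplanar Q" and "card (carrier Q) \<ge> 2"
  shows
    \<comment> \<open>(i)\<close>
    "((\<exists>A. is_alpha D A) \<and> (\<forall>A. is_alpha D A \<longrightarrow> finite (carrier A) \<and> quasiplanar A)) \<and>
     \<comment> \<open>(ii), for p = 1 and p = 2\<close>
     ((\<exists>B. is_beta1 Q B) \<and> (\<forall>B. is_beta1 Q B \<longrightarrow> slim_semimodular_diagram B)) \<and>
     ((\<exists>B. is_beta2 Q B) \<and> (\<forall>B. is_beta2 Q B \<longrightarrow> slim_semimodular_diagram B)) \<and>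
     \<comment> \<open>(iii), for p = 1 and p = 2\<close>
     (\<forall>A. is_alpha D A \<longrightarrow> (\<exists>B. is_beta1 A B) \<and> (\<forall>B. is_beta1 A B \<longrightarrow> similar B D)) \<and>
     (\<forall>A. is_alpha D A \<longrightarrow> (\<exists>B. is_beta2 A B) \<and> (\<forall>B. is_beta2 A B \<longrightarrow> similar B D)) \<and>
     \<comment> \<open>(iv), for p = 1 and p = 2\<close>
     (\<forall>B. is_beta1 Q B \<longrightarrow> (\<exists>A. is_alpha B A) \<and> (\<forall>A. is_alpha B A \<longrightarrow> similar A Q)) \<and>
     (\<forall>B. is_beta2 Q B \<longrightarrow> (\<exists>A. is_alpha B A) \<and> (\<forall>A. is_alpha B A \<longrightarrow> similar A Q))"
proof -
  have Q: "nontrivial_quasiplanar Q"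
    using quasiplanar_diagramI[OF assms(2)] assms(3)
    by (simp add: nontrivial_quasiplanar_def nontrivial_quasiplanar_axioms_def)
  have D: "planar_lattice_diagram D" using assms(1) by (simp add: slim_semimodular_diagram_def)
  note b1 = is_beta1_filter_diagram[OF Q] and b2 = is_beta2_filter_diagram[OF Q]
  note A = alpha_filter_diagram(1)[OF assms(1)]
  have quasi: "quasiplanar A" if "is_alpha D A" for A
    using that unfolding is_alpha_def by blast
  have fin: "finite (carrier A)" if "is_alpha D A" for A
    using quasi[OF that] by (simp add: quasiplanar_def bounded_diagram_def hasse_diagram_def)
  have i: "(\<exists>A. is_alpha D A) \<and> (\<forall>A. is_alpha D A \<longrightarrow> finite (carrier A) \<and> quasiplanar A)"
    using alpha_exists[OF D] quasi fin by blast
  have ii1: "(\<exists>B. is_beta1 Q B) \<and> (\<forall>B. is_beta1 Q B \<longrightarrow> slim_semimodular_diagram B)"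
    using nontrivial_quasiplanar.beta1_exists[OF Q] filter_diagram_round_trip(1)[OF Q b1] by blast
  have ii2: "(\<exists>B. is_beta2 Q B) \<and> (\<forall>B. is_beta2 Q B \<longrightarrow> slim_semimodular_diagram B)"
    using beta2_exists[OF Q] filter_diagram_round_trip(1)[OF Q b2] by blast
  have iii1: "(\<exists>B. is_beta1 A B) \<and> (\<forall>B. is_beta1 A B \<longrightarrow> similar B D)" if al: "is_alpha D A" for A
    using nontrivial_quasiplanar.beta1_exists[OF A[OF al]]
      alpha_round_trip[OF assms(1) al is_beta1_filter_diagram[OF A[OF al]]] by blast
  have iii2: "(\<exists>B. is_beta2 A B) \<and> (\<forall>B. is_beta2 A B \<longrightarrow> similar B D)" if al: "is_alpha D A" for A
    using beta2_exists[OF A[OF al]]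
      alpha_round_trip[OF assms(1) al is_beta2_filter_diagram[OF A[OF al]]] by blast
  have iv1: "(\<exists>A. is_alpha B A) \<and> (\<forall>A. is_alpha B A \<longrightarrow> similar A Q)" if "is_beta1 Q B" for B
    using filter_diagram_round_trip(2,3)[OF Q b1, OF that that] by blast
  have iv2: "(\<exists>A. is_alpha B A) \<and> (\<forall>A. is_alpha B A \<longrightarrow> similar A Q)" if "is_beta2 Q B" for B
    using filter_diagram_round_trip(2,3)[OF Q b2, OF that that] by blast
  show ?thesis using i ii1 ii2 iii1 iii2 iv1 iv2 by blast
qed

end
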